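(* Let $N\in\mathbb Z^+$, let $\Delta\in\{2N,-2N\}$, and let $L=\mathbb Z$ with bilinear form $\langle x,y\rangle=\Delta xy$ (an even lattice of rank $1$). Let $\alpha=\frac a\Delta,\ \beta=\frac b\Delta\in L'/L$ with $a,b\in\mathbb Z$, and let $m,n$ be integers satisfying $m\equiv a^2\pmod{4N}$ and $n\equiv b^2\pmod{4N}$. Suppose that $m$ is a fundamental discriminant. Then for any $v\in\mathbb Z$ and any integer $c\geq1$ we have $$\sum_{u\mid(v,c)}\left(\frac mu\right)\sqrt{\frac uc}\;S_{\alpha\frac vu,\beta}\left(\frac{mv^2}{u^2},n,\frac cu\right)=\frac{i^{-\sigma}}{\sqrt{2N}}\sum_{\substack{\ell\bmod 2Nc\\ \ell\equiv ab\,(2N)\\ \ell^2\equiv mn\,(4Nc)}}\chi_m\left(Nc,\ell,\frac{\ell^2-mn}{4Nc}\right)e_{\Delta c}(\ell v),$$ where $u$ runs over positive divisors.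
   Context: Notation. $e_c(x)=e^{2\pi ix/c}$; $i^s=e^{\pi is/2}$ for real $s$; $(x,y)$ is the gcd (with $(0,c)=c$); $\left(\frac{\cdot}{\cdot}\right)$ is the Kronecker symbol. Fundamental discriminant: an integer $D$ such that either $D\equiv1\pmod 4$ is squarefree (including $D=1$), or $4\mid D$ with $D/4\equiv2,3\pmod4$ squarefree. Lattice. $q(x)=\frac12\langle x,x\rangle=\frac12\Delta x^2$, $L'=\frac1\Delta\mathbb Z$ is the dual lattice, $|L'/L|=2N$, and $(b^+,b^-)$ is the signature of $L$ (so $(1,0)$ if $\Delta>0$ and $(0,1)$ if $\Delta<0$). Weil representation coefficients. For $\gamma=\begin{pmatrix}a&b\\c&d\end{pmatrix}\in\mathrm{SL}_2(\mathbb Z)$ with $c>0$ let $\tilde\gamma=(\gamma,\sqrt{cz+d})$ be its lift to the metaplectic group (principal branch), and for $\alpha,\beta\in L'/L$ $$\rho_{\alpha\beta}(\tilde\gamma)=\frac{i^{(b^--b^+)/2}}{c^{(b^++b^-)/2}\sqrt{|L'/L|}}\sum_{r\in L/cL}e_c\big(aq(\alpha+r)-\langle\beta,\alpha+r\rangle+dq(\beta)\big)$$ (with any representatives of $\alpha,\beta$ in $L'$; here $a,b,c,d$ are the matrix entries). Kloosterman sums. Fix a half-integer $k$ ($2k\in\mathbb Z$) with $\sigma:=k+\frac12(b^--b^+)\in\mathbb Z$. For $c\in\mathbb Z^+$, $\frac{m}{2\Delta}\in\mathbb Z+q(\alpha)$ and $\frac{n}{2\Delta}\in\mathbb Z+q(\beta)$,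 $$S_{\alpha,\beta}(m,n,c)=e^{-\pi ik/2}\sum_{d\in(\mathbb Z/c\mathbb Z)^\times}\overline{\rho_{\alpha\beta}(\tilde\gamma)}\,e_{2\Delta c}(ma+nd),$$ where $\gamma=\begin{pmatrix}a&b\\c&d\end{pmatrix}\in\mathrm{SL}_2(\mathbb Z)$ is any matrix with bottom row $(c\ d)$; the sum does not depend on the choices made. The character $\chi_m$ (Gross--Kohnen--Zagier). Let $m$ be a fundamental discriminant and suppose $m,n$ are squares modulo $4N$. For integers $A,B,C$ with $B^2-4NAC=mn$ define $$\chi_m(AN,B,C)=\begin{cases}\left(\frac mr\right)&\text{if }\gcd(A,B,C,m)=1,\\0&\text{otherwise},\end{cases}$$ where, in the first case, $r$ is any integer coprime to $m$ represented by the quadratic form $AN_1x^2+Bxy+CN_2y^2$ for some splitting $N=N_1N_2$ with $N_1>0$. (It is known that such an $r$ exists and that the value is independent of the choice of $r$ and of the splitting.) *)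

theory Defs
  imports
    "HOL-Analysis.Analysis"
    "HOL-Number_Theory.Number_Theory"
    "HOL-Computational_Algebra.Squarefree"
begin

subsection \<open>Arithmetic notation\<close>

definition e_mod :: "int \<Rightarrow> real \<Rightarrow> complex" where
  "e_mod c x = exp (2 * of_real pi * \<i> * of_real x / of_int c)"

definition i_powr :: "real \<Rightarrow> complex" where
  "i_powr s = exp (of_real pi * \<i> * of_real s / 2)"

definition fundamental_discriminant :: "int \<Rightarrow> bool" where
  "fundamental_discriminant D \<longleftrightarrow>
     [D = 1] (mod 4) \<and> squarefree D \<or>
     4 dvd D \<and> ([D div 4 = 2] (mod 4) \<or> [D div 4 = 3] (mod 4)) \<and> squarefree (D div 4)"

definition kronecker_at_prime :: "int \<Rightarrow> nat \<Rightarrow> int" where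
  "kronecker_at_prime a p =
     (if p = 2 then (if even a then 0 else if a mod 8 = 1 \<or> a mod 8 = 7 then 1 else - 1)
      else Legendre a (int p))"

definition kronecker :: "int \<Rightarrow> int \<Rightarrow> int" where
  "kronecker a n =
     (if n = 0 then (if \<bar>a\<bar> = 1 then 1 else 0)
      else (if n < 0 \<and> a < 0 then - 1 else 1) *
           (\<Prod>p\<in>#prime_factorization (nat \<bar>n\<bar>). kronecker_at_prime a p))"


subsection \<open>The lattice \<open>L = \<int>\<close> with bilinear form \<open>\<Delta>xy\<close>\<close>

text \<open>
  Elements of \<open>L' = \<int>/\<Delta>\<close> are given as real numbers, and classes in \<open>L'/L\<close> by
  representatives in \<open>L'\<close>.
\<close>

definition lat_bil :: "int \<Rightarrow> real \<Rightarrow> real \<Rightarrow> real" where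
  "lat_bil \<Delta> x y = of_int \<Delta> * x * y"

definition lat_q :: "int \<Rightarrow> real \<Rightarrow> real" where
  "lat_q \<Delta> x = lat_bil \<Delta> x x / 2"

definition b_plus :: "int \<Rightarrow> real" where
  "b_plus \<Delta> = (if \<Delta> > 0 then 1 else 0)"

definition b_minus :: "int \<Rightarrow> real" where
  "b_minus \<Delta> = (if \<Delta> < 0 then 1 else 0)"

text \<open>
  The coefficient \<open>\<rho>\<^sub>\<alpha>\<^sub>\<beta>\<close> at the lift \<open>(\<gamma>, \<surd>(cz + d))\<close> of a matrix \<open>\<gamma>\<close> in \<open>SL\<^sub>2(\<int>)\<close> with
  lower left entry \<open>c > 0\<close>. The order of \<open>L'/L\<close> is \<open>\<bar>\<Delta>\<bar>\<close>.
\<close>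

definition weil_coeff :: "int \<Rightarrow> real \<Rightarrow> real \<Rightarrow> int^2^2 \<Rightarrow> complex" where
  "weil_coeff \<Delta> \<alpha> \<beta> \<gamma> =
     (let a = \<gamma> $ 1 $ 1; c = \<gamma> $ 2 $ 1; d = \<gamma> $ 2 $ 2 in
      i_powr ((b_minus \<Delta> - b_plus \<Delta>) / 2) /
        of_real (real_of_int c powr ((b_plus \<Delta> + b_minus \<Delta>) / 2) * sqrt (real_of_int \<bar>\<Delta>\<bar>)) *
      (\<Sum>r\<in>{0..<c}. e_mod c (of_int a * lat_q \<Delta> (\<alpha> + of_int r)
                            - lat_bil \<Delta> \<beta> (\<alpha> + of_int r) + of_int d * lat_q \<Delta> \<beta>)))"


subsection \<open>Kloosterman sums\<close>

definition sl2_completion :: "int \<Rightarrow> int \<Rightarrow> int^2^2" where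
  "sl2_completion c d = (SOME \<gamma>. det \<gamma> = 1 \<and> \<gamma> $ 2 $ 1 = c \<and> \<gamma> $ 2 $ 2 = d)"

definition kloosterman ::
  "int \<Rightarrow> real \<Rightarrow> real \<Rightarrow> real \<Rightarrow> int \<Rightarrow> int \<Rightarrow> int \<Rightarrow> complex" where
  "kloosterman \<Delta> k \<alpha> \<beta> m n c =
     exp (- (of_real pi * \<i> * of_real k / 2)) *
     (\<Sum>d | d \<in> {0..<c} \<and> coprime d c.
        let \<gamma> = sl2_completion c d in
        cnj (weil_coeff \<Delta> \<alpha> \<beta> \<gamma>) *
        e_mod (2 * \<Delta> * c) (of_int (m * \<gamma> $ 1 $ 1 + n * d)))"

definition sigma_weight :: "int \<Rightarrow> real \<Rightarrow> real" where
  "sigma_weight \<Delta> k = k + (b_minus \<Delta> - b_plus \<Delta>) / 2"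


subsection \<open>The Gross--Kohnen--Zagier character\<close>

definition gkz_represents :: "int \<Rightarrow> int \<Rightarrow> int \<Rightarrow> int \<Rightarrow> int \<Rightarrow> bool" where
  "gkz_represents N A B C r \<longleftrightarrow>
     (\<exists>N1 N2 x y. N = N1 * N2 \<and> N1 > 0 \<and> r = A * N1 * x\<^sup>2 + B * x * y + C * N2 * y\<^sup>2)"

text \<open>
  \<open>gkz_char N m A B C\<close> is \<open>\<chi>\<^sub>m(AN, B, C)\<close>: the third argument is \<open>A\<close>, not \<open>AN\<close>.
\<close>

definition gkz_char :: "int \<Rightarrow> int \<Rightarrow> int \<Rightarrow> int \<Rightarrow> int \<Rightarrow> int" where
  "gkz_char N m A B C =
     (if Gcd {A, B, C, m} = 1
      then kronecker m (SOME r. coprime r m \<and> gkz_represents N A B C r)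
      else 0)"

end

theory Submission
  imports Defs
begin

text \<open>
  Inserting the definitions, the left-hand side becomes a finite Fourier series in \<open>v\<close>: for
  \<open>l = a b + \<Delta> j\<close> its coefficient is a divisor sum, twisted by \<open>(m/u)\<close>, whose term at \<open>u\<close> adds up
  the Ramanujan sums of modulus \<open>c/u\<close> at the values of an inhomogeneous binary quadratic
  polynomial. The leading form \<open>Q\<close> of the polynomial has discriminant \<open>m\<close>, and its determinant is,
  up to a constant factor, \<open>P = (l\<^sup>2 - m n) / (2 \<Delta>)\<close>. The coefficient is multiplicative in \<open>c\<close>. At a prime not dividing \<open>m\<close>,
  completing the square gives \<open>(m/p)\<^sup>k\<close> if \<open>p\<^sup>k\<close> divides \<open>P\<close> and 0 otherwise. At a prime dividing \<open>m\<close>,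
  a descent on \<open>k\<close> gives 0 unless \<open>p\<^sup>k\<close> divides \<open>P\<close> exactly, in which case one obtains the Hilbert
  symbol at \<open>p\<close> of \<open>m\<close> and \<open>- P\<close> times a number represented by \<open>Q\<close>. On the other side, if \<open>r\<close> is
  prime to \<open>m\<close> and represented by \<open>c N\<^sub>1 x\<^sup>2 + l x y + C N\<^sub>2 y\<^sup>2\<close>, then \<open>(m/r)\<close> is the product over the
  primes dividing \<open>m\<close> of the local symbols of \<open>r\<close>, each of which is that of \<open>c N\<^sub>1\<close> or of \<open>C N\<^sub>2\<close>;
  the product formula for Hilbert symbols turns this into the same product over the primes dividing \<open>c\<close>.
\<close>

subsection \<open>Sums over residue classes\<close>

text \<open>The leading form is \<open>e x^2 - a x y + h y^2\<close> with
  \<open>h = - \<Delta> / 2\<close> and \<open>m = a^2 - 4 h e\<close>. Conjugating the Weil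
  coefficient subtracts a square from \<open>m w^2\<close> in the exponent, and the congruences on
  \<open>m\<close> and \<open>n\<close> make the differences divisible by \<open>2 \<Delta>\<close>.
  The divisor sum serves the primes not dividing \<open>m\<close>: the twist \<open>(m/u)\<close>
  brings all terms at powers of \<open>p\<close> to the common sign \<open>(m/p)^k\<close>, and then
  the Ramanujan sums over the divisors of \<open>p^k\<close> add up to an indicator. At a prime
  dividing \<open>m\<close> fundamentality is decisive: \<open>m\<close> is not \<open>p^2\<close>
  times a discriminant, so the form is nonzero mod \<open>p\<close> and stays so after each descent
  step. The prime 2 shapes many statements: gradients and double roots replace formulas that divide
  by 2, and the symbols at 2 are checked on residues mod 8. The represented number in the Hilbert
  symbol is taken to be \<open>h\<close>, because \<open>h\<close> is \<open>N\<close> or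
  \<open>- N\<close> whereas \<open>e\<close> may vanish; then \<open>- P * h\<close> is
  \<open>N * (c * C)\<close> for either sign of \<open>\<Delta>\<close>, which is the number that
  the character side produces.\<close>

definition periodic_mod :: "int \<Rightarrow> (int \<Rightarrow> 'a) \<Rightarrow> bool" where
  "periodic_mod c f \<longleftrightarrow> (\<forall>x y. [x = y] (mod c) \<longrightarrow> f x = f y)"

lemma periodic_modI: "(\<And>x y. [x = y] (mod c) \<Longrightarrow> f x = f y) \<Longrightarrow> periodic_mod c f"
  by (auto simp: periodic_mod_def)

lemma periodic_modD: "periodic_mod c f \<Longrightarrow> [x = y] (mod c) \<Longrightarrow> f x = f y"
  by (auto simp: periodic_mod_def)

text \<open>An injective self-map of a finite set is bijective, so injectivity of \<open>g\<close>
  modulo \<open>c\<close> suffices. Shifts and unit multiples are the instances used later.\<close>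

lemma sum_residues_reindex:
  fixes f :: "int \<Rightarrow> 'a::comm_monoid_add"
  assumes "c > 0" "periodic_mod c f" "\<And>x y. [g x = g y] (mod c) \<Longrightarrow> [x = y] (mod c)"
  shows "(\<Sum>x=0..<c. f (g x)) = (\<Sum>x=0..<c. f x)"
proof -
  let ?h = "\<lambda>x. g x mod c"
  have inj: "inj_on ?h {0..<c}"
  proof (rule inj_onI)
    fix x y assume xy: "x \<in> {0..<c}" "y \<in> {0..<c}" "g x mod c = g y mod c"
    then have "x mod c = y mod c" using assms(3)[of x y] by (simp add: cong_def)
    with xy show "x = y" by simp
  qed
  have sub: "?h ` {0..<c} \<subseteq> {0..<c}" using assms(1) by auto
  have bij: "bij_betw ?h {0..<c} {0..<c}"
    unfolding bij_betw_def using inj endo_inj_surj[OF _ sub inj] by simp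
  have "(\<Sum>x=0..<c. f (g x)) = (\<Sum>x=0..<c. f (?h x))"
    by (rule sum.cong) (auto intro!: periodic_modD[OF assms(2)] simp: cong_def)
  also have "\<dots> = (\<Sum>x=0..<c. f x)" by (rule sum.reindex_bij_betw[OF bij])
  finally show ?thesis .
qed

lemma sum_residues_shift:
  fixes f :: "int \<Rightarrow> 'a::comm_monoid_add"
  assumes "c > 0" "periodic_mod c f"
  shows "(\<Sum>x=0..<c. f (x + t)) = (\<Sum>x=0..<c. f x)"
  by (rule sum_residues_reindex[OF assms]) (simp add: cong_add_rcancel)

lemma sum_residues_affine:
  fixes f :: "int \<Rightarrow> 'a::comm_monoid_add"
  assumes "c > 0" "periodic_mod c f" "coprime d c"
  shows "(\<Sum>x=0..<c. f (d * x + t)) = (\<Sum>x=0..<c. f x)"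
  by (rule sum_residues_reindex[OF assms(1,2)])
     (use assms(3) in \<open>simp add: cong_add_rcancel cong_mult_lcancel\<close>)

lemma sum_residues_mult:
  fixes f :: "int \<Rightarrow> 'a::comm_monoid_add"
  assumes "c > 0" "periodic_mod c f" "coprime d c"
  shows "(\<Sum>x=0..<c. f (d * x)) = (\<Sum>x=0..<c. f x)"
  using sum_residues_affine[OF assms, of 0] by simp

lemma sum_residues_blocks:
  fixes f :: "int \<Rightarrow> 'a::comm_monoid_add"
  assumes "a > 0" "b > 0"
  shows "(\<Sum>x=0..<a * b. f x) = (\<Sum>i=0..<a. \<Sum>j=0..<b. f (i + a * j))"
proof -
  have bij: "bij_betw (\<lambda>(i, j). i + a * j) ({0..<a} \<times> {0..<b}) {0..<a * b}"
  proof (rule bij_betw_byWitness[where f' = "\<lambda>x. (x mod a, x div a)"])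
    show "\<forall>x\<in>{0..<a} \<times> {0..<b}. ((case x of (i, j) \<Rightarrow> i + a * j) mod a, (case x of (i, j) \<Rightarrow> i + a * j) div a) = x"
      by auto
    show "\<forall>x\<in>{0..<a * b}. (case (x mod a, x div a) of (i, j) \<Rightarrow> i + a * j) = x"
      by auto
    show "(\<lambda>(i, j). i + a * j) ` ({0..<a} \<times> {0..<b}) \<subseteq> {0..<a * b}"
    proof (rule image_subsetI)
      fix x :: "int \<times> int" assume x: "x \<in> {0..<a} \<times> {0..<b}"
      obtain i j where ij: "x = (i, j)" by fastforce
      have "i + a * j < a * (j + 1)" using x ij by (simp add: algebra_simps)
      also have "\<dots> \<le> a * b" using x ij assms by (intro mult_left_mono) auto
      finally show "(case x of (i, j) \<Rightarrow> i + a * j) \<in> {0..<a * b}" using x ij assms by simp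
    qed
    show "(\<lambda>x. (x mod a, x div a)) ` {0..<a * b} \<subseteq> {0..<a} \<times> {0..<b}"
    proof (rule image_subsetI)
      fix x assume x: "x \<in> {0..<a * b}"
      have "a * (x div a) \<le> x" using assms pos_mod_sign[of a x] minus_mod_eq_mult_div[of x a] by linarith
      with x have "a * (x div a) < a * b" by simp
      then show "(x mod a, x div a) \<in> {0..<a} \<times> {0..<b}"
        using assms x by (simp add: pos_imp_zdiv_nonneg_iff)
    qed
  qed
  show ?thesis
    by (simp add: sum.cartesian_product sum.reindex_bij_betw[OF bij, symmetric] case_prod_unfold)
qed

lemma sum_residues_multiples:
  fixes f :: "int \<Rightarrow> 'a::comm_monoid_add"
  assumes "a > 0" "b > 0"
  shows "(\<Sum>x=0..<a * b. if a dvd x then f x else 0) = (\<Sum>j=0..<b. f (a * j))"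
proof -
  have "(\<Sum>x=0..<a * b. if a dvd x then f x else 0)
      = (\<Sum>i=0..<a. \<Sum>j=0..<b. if i = 0 then f (a * j) else 0)"
    unfolding sum_residues_blocks[OF assms]
  proof (intro sum.cong refl)
    fix i j assume "i \<in> {0..<a}"
    then have "a dvd i \<longleftrightarrow> i = 0" by (auto dest: zdvd_imp_le simp: order_le_less)
    then show "(if a dvd i + a * j then f (i + a * j) else 0) = (if i = 0 then f (a * j) else 0)"
      by (auto simp: dvd_add_left_iff)
  qed
  also have "\<dots> = (\<Sum>i=0..<a. if i = 0 then (\<Sum>j=0..<b. f (a * j)) else 0)"
    by (intro sum.cong) auto
  finally show ?thesis using assms by simp
qed

lemma coprime_cong_mult_cancel:
  fixes x y c1 c2 :: int
  assumes "coprime c1 c2" "[x1 * c2 + x2 * c1 = y1 * c2 + y2 * c1] (mod c1 * c2)"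
  shows "[x1 = y1] (mod c1)" "[x2 = y2] (mod c2)"
proof -
  have 1: "[x1 * c2 + x2 * c1 = y1 * c2 + y2 * c1] (mod c1)"
    and 2: "[x1 * c2 + x2 * c1 = y1 * c2 + y2 * c1] (mod c2)"
    using assms(2) by (metis cong_modulus_mult mult.commute)+
  from 1 have "[x1 * c2 = y1 * c2] (mod c1)" by (simp add: cong_def)
  then show "[x1 = y1] (mod c1)" using assms(1) by (simp add: cong_mult_rcancel coprime_commute)
  from 2 have "[x2 * c1 = y2 * c1] (mod c2)" by (simp add: cong_def)
  then show "[x2 = y2] (mod c2)" using assms(1) by (simp add: cong_mult_rcancel coprime_commute)
qed

text \<open>The parametrization \<open>x1 * c2 + x2 * c1\<close> avoids inverses modulo
  \<open>c1\<close> and \<open>c2\<close>. The price is a unit factor in each variable, which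
  multiplicativity proofs remove by \<open>sum_residues_mult\<close> or absorb in the additive
  character.\<close>

lemma sum_residues_crt:
  fixes f :: "int \<Rightarrow> 'a::comm_monoid_add"
  assumes "c1 > 0" "c2 > 0" "coprime c1 c2" "periodic_mod (c1 * c2) f"
  shows "(\<Sum>x=0..<c1 * c2. f x) = (\<Sum>x1=0..<c1. \<Sum>x2=0..<c2. f (x1 * c2 + x2 * c1))"
proof -
  let ?h = "\<lambda>x. (fst x * c2 + snd x * c1) mod (c1 * c2)"
  let ?A = "{0..<c1} \<times> {0..<c2}"
  have inj: "inj_on ?h ?A"
  proof (rule inj_onI)
    fix x y assume xy: "x \<in> ?A" "y \<in> ?A" "?h x = ?h y"
    have "[fst x * c2 + snd x * c1 = fst y * c2 + snd y * c1] (mod c1 * c2)"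
      using xy(3) by (simp add: cong_def)
    from coprime_cong_mult_cancel[OF assms(3) this] xy(1,2) show "x = y"
      by (auto simp: cong_def mem_Times_iff prod_eq_iff)
  qed
  have pos: "c1 * c2 > 0" using assms by simp
  have "?h ` ?A \<subseteq> {0..<c1 * c2}" using pos by auto
  moreover have "card (?h ` ?A) = card {0..<c1 * c2}"
    using assms(1,2) by (simp add: card_image[OF inj] card_cartesian_product nat_mult_distrib)
  ultimately have "?h ` ?A = {0..<c1 * c2}" by (intro card_subset_eq) auto
  with inj have bij: "bij_betw ?h ?A {0..<c1 * c2}" by (simp add: bij_betw_def)
  have "(\<Sum>x=0..<c1 * c2. f x) = (\<Sum>x\<in>?A. f (?h x))"
    by (simp add: sum.reindex_bij_betw[OF bij])
  also have "\<dots> = (\<Sum>x\<in>?A. f (fst x * c2 + snd x * c1))"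
    by (rule sum.cong) (auto intro!: periodic_modD[OF assms(4)] simp: cong_def)
  finally show ?thesis by (simp add: sum.cartesian_product case_prod_unfold)
qed

subsection \<open>Additive characters and Ramanujan sums\<close>

text \<open>Integer numerators give periodicity modulo \<open>c\<close>. The real version
  \<open>e_mod\<close> remains necessary for the Weil coefficients, whose exponents have denominator
  \<open>2 \<Delta>\<close>.\<close>

definition echar :: "int \<Rightarrow> int \<Rightarrow> complex" where
  "echar c z = e_mod c (of_int z)"

lemma e_mod_add: "e_mod c (x + y) = e_mod c x * e_mod c y"
  by (simp add: e_mod_def exp_add [symmetric] add_divide_distrib ring_distribs)

lemma e_mod_0 [simp]: "e_mod c 0 = 1"
  by (simp add: e_mod_def)

lemma e_mod_minus: "e_mod c (- x) = cnj (e_mod c x)"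
  by (simp add: e_mod_def exp_cnj)

lemma e_mod_mult_cancel: "u \<noteq> 0 \<Longrightarrow> e_mod (u * c) (of_int u * x) = e_mod c x"
  by (simp add: e_mod_def field_simps)

lemma e_mod_int_period: "c \<noteq> 0 \<Longrightarrow> e_mod c (of_int (c * z)) = 1"
  using exp_integer_2pi[of "of_int z"] by (simp add: e_mod_def field_simps)

lemma echar_add: "echar c (x + y) = echar c x * echar c y"
  by (simp add: echar_def e_mod_add)

lemma echar_0 [simp]: "echar c 0 = 1"
  by (simp add: echar_def)

lemma echar_1 [simp]: "echar 1 z = 1"
  using e_mod_int_period[of 1 z] by (simp add: echar_def)

lemma echar_period: "c \<noteq> 0 \<Longrightarrow> echar c (c * z) = 1"
  unfolding echar_def by (rule e_mod_int_period)

lemma echar_cong: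
  assumes "c \<noteq> 0" "[x = y] (mod c)"
  shows "echar c x = echar c y"
proof -
  obtain z where "x = y + c * z" using assms(2) by (metis cong_iff_lin cong_sym)
  then show ?thesis using assms(1) by (simp add: echar_add echar_period)
qed

lemma echar_mult_cancel: "u \<noteq> 0 \<Longrightarrow> echar (u * c) (u * z) = echar c z"
  using e_mod_mult_cancel[of u c "of_int z"] by (simp add: echar_def)

lemma echar_eq_1_imp_dvd:
  assumes "c > 0" "echar c z = 1"
  shows "c dvd z"
proof -
  have "exp (2 * of_real pi * \<i> * of_int z / of_int c) = (1::complex)"
    using assms(2) by (simp add: echar_def e_mod_def)
  then obtain n :: int where "2 * pi * of_int z / of_int c = of_int (2 * n) * pi"
    using assms(1) unfolding exp_eq_1 by (auto simp: Re_divide power2_eq_square)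
  then have "real_of_int z = of_int (n * c)" using assms(1) by (simp add: field_simps)
  then have "z = n * c" by linarith
  then show ?thesis by simp
qed

lemma sum_echar:
  assumes "c > 0"
  shows "(\<Sum>x=0..<c. echar c (x * z)) = (if c dvd z then of_int c else 0)"
proof (cases "c dvd z")
  case True
  then have "echar c (x * z) = 1" for x
    using echar_cong[of c "x * z" 0] assms by (simp add: cong_0_iff)
  then show ?thesis using True assms by simp
next
  case False
  have per: "periodic_mod c (\<lambda>x. echar c (x * z))"
    using assms by (intro periodic_modI echar_cong) (auto intro: cong_mult)
  have "(\<Sum>x=0..<c. echar c (x * z)) = (\<Sum>x=0..<c. echar c ((x + 1) * z))"
    using sum_residues_shift[OF assms per, of 1] by simp
  also have "\<dots> = (\<Sum>x=0..<c. echar c (x * z)) * echar c z"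
    by (simp add: ring_distribs echar_add sum_distrib_right)
  finally have "(\<Sum>x=0..<c. echar c (x * z)) = 0"
    using False echar_eq_1_imp_dvd[OF assms] by (metis mult_cancel_left1)
  then show ?thesis using False by simp
qed

definition ramanujan_sum :: "int \<Rightarrow> int \<Rightarrow> complex" where
  "ramanujan_sum c z = (\<Sum>d | d \<in> {0..<c} \<and> coprime d c. echar c (d * z))"

lemma ramanujan_sum_altdef:
  "ramanujan_sum c z = (\<Sum>d=0..<c. if coprime d c then echar c (d * z) else 0)"
  unfolding ramanujan_sum_def by (subst sum.inter_filter [symmetric]) auto

lemma ramanujan_sum_cong:
  assumes "c > 0" "[x = y] (mod c)"
  shows "ramanujan_sum c x = ramanujan_sum c y"
  unfolding ramanujan_sum_def
  using assms by (intro sum.cong refl echar_cong cong_mult) auto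

lemma ramanujan_sum_1 [simp]: "ramanujan_sum 1 z = 1"
  by (simp add: ramanujan_sum_altdef)

lemma periodic_mod_coprime: "periodic_mod c (\<lambda>d. coprime d (c::int))"
  by (rule periodic_modI) (metis cong_imp_coprime cong_sym)

lemma ramanujan_sum_unit_mult:
  assumes "c > 0" "coprime u c"
  shows "ramanujan_sum c (u * z) = ramanujan_sum c z"
proof -
  let ?f = "\<lambda>d. if coprime d c then echar c (d * z) else 0"
  have "periodic_mod c ?f"
    using assms(1) periodic_modD[OF periodic_mod_coprime[of c]] echar_cong[of c]
    by (intro periodic_modI) (metis cong_mult cong_refl less_irrefl)
  from sum_residues_mult[OF assms(1) this assms(2)] show ?thesis
    using assms(2) by (simp add: ramanujan_sum_altdef mult_ac coprime_mult_left_iff cong: if_cong)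
qed

lemma ramanujan_sum_mult:
  assumes "c1 > 0" "c2 > 0" "coprime c1 c2"
  shows "ramanujan_sum (c1 * c2) z = ramanujan_sum c1 z * ramanujan_sum c2 z"
proof -
  let ?f = "\<lambda>d. if coprime d (c1 * c2) then echar (c1 * c2) (d * z) else 0"
  have "periodic_mod (c1 * c2) ?f"
    using assms periodic_modD[OF periodic_mod_coprime[of "c1 * c2"]] echar_cong[of "c1 * c2"]
    by (intro periodic_modI) (metis cong_mult cong_refl less_irrefl mult_pos_pos)
  note crt = sum_residues_crt[OF assms this]
  have cop: "coprime (x1 * c2 + x2 * c1) (c1 * c2) \<longleftrightarrow> coprime x1 c1 \<and> coprime x2 c2" for x1 x2
  proof -
    have "coprime (x1 * c2 + x2 * c1) c1 \<longleftrightarrow> coprime (x1 * c2) c1"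
      by (metis coprime_iff_gcd_eq_1 gcd_add_mult mult.commute add.commute gcd.commute)
    moreover have "coprime (x1 * c2 + x2 * c1) c2 \<longleftrightarrow> coprime (x2 * c1) c2"
      by (metis coprime_iff_gcd_eq_1 gcd_add_mult mult.commute add.commute gcd.commute)
    ultimately show ?thesis using assms(3)
      by (auto simp: coprime_mult_right_iff coprime_mult_left_iff coprime_commute)
  qed
  have ech: "echar (c1 * c2) ((x1 * c2 + x2 * c1) * z) = echar c1 (x1 * z) * echar c2 (x2 * z)" for x1 x2
    using echar_mult_cancel[of c2 c1 "x1 * z"] echar_mult_cancel[of c1 c2 "x2 * z"] assms
    by (simp add: ring_distribs echar_add mult_ac)
  show ?thesis
    unfolding ramanujan_sum_altdef crt cop ech sum_product by (intro sum.cong refl) auto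
qed

text \<open>The non-units are the multiples of \<open>p\<close>, and the sum over them is a complete
  sum of modulus \<open>p ^ (k - 1)\<close>.\<close>

lemma ramanujan_sum_prime_power:
  assumes "prime p" "k > 0"
  shows "ramanujan_sum (p ^ k) z =
    (if p ^ k dvd z then of_int (p ^ k) else 0) - (if p ^ (k - 1) dvd z then of_int (p ^ (k - 1)) else 0)"
proof -
  obtain j where k: "k = Suc j" using assms(2) by (cases k) auto
  have p: "p > 0" using assms(1) prime_gt_0_int by blast
  have cop: "coprime d (p ^ k) \<longleftrightarrow> \<not> p dvd d" for d
  proof -
    have "coprime d (p ^ k) \<longleftrightarrow> coprime p d"
      using assms(2) by (simp add: coprime_commute)
    moreover have "\<not> coprime p d" if "p dvd d"
      using that assms(1) not_coprimeI[of p p d] by auto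
    ultimately show ?thesis using prime_imp_coprime[OF assms(1)] by blast
  qed
  have "ramanujan_sum (p ^ k) z = (\<Sum>d=0..<p ^ k. echar (p ^ k) (d * z))
      - (\<Sum>d=0..<p ^ k. if p dvd d then echar (p ^ k) (d * z) else 0)"
    unfolding ramanujan_sum_altdef sum_subtractf [symmetric] cop by (intro sum.cong) auto
  also have "(\<Sum>d=0..<p ^ k. if p dvd d then echar (p ^ k) (d * z) else 0)
     = (\<Sum>y=0..<p ^ j. echar (p ^ k) (p * y * z))"
    using sum_residues_multiples[of p "p ^ j" "\<lambda>d. echar (p ^ k) (d * z)"] p by (simp add: k)
  also have "\<dots> = (\<Sum>y=0..<p ^ j. echar (p ^ j) (y * z))"
    using p echar_mult_cancel[of p "p ^ j"] by (simp add: k mult.assoc)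
  finally show ?thesis using p by (simp add: sum_echar k)
qed

subsection \<open>Legendre symbols\<close>

lemma Legendre_cong:
  assumes "[a = b] (mod p)"
  shows "Legendre a p = Legendre b p"
proof -
  have "[z = a] (mod p) \<longleftrightarrow> [z = b] (mod p)" "[a = 0] (mod p) \<longleftrightarrow> [b = 0] (mod p)" for z
    using assms by (simp_all add: cong_def)
  then show ?thesis by (simp add: Legendre_def QuadRes_def)
qed

lemma Legendre_eq_0_iff: "Legendre a p = 0 \<longleftrightarrow> p dvd a"
  by (auto simp: Legendre_def cong_0_iff)

lemma Legendre_cases: "Legendre a p \<in> {0, 1, -1}"
  by (auto simp: Legendre_def)

lemma Legendre_euler:
  fixes p :: int
  assumes "prime p" "p \<noteq> 2"
  shows "[Legendre a p = a ^ nat ((p - 1) div 2)] (mod p)"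
proof -
  have p: "p > 2" using assms prime_ge_2_int[of p] by linarith
  have "prime (nat p)" using assms by (simp add: prime_nat_iff_prime)
  from euler_criterion[OF this, of a] p show ?thesis
    by (simp add: nat_div_distrib nat_diff_distrib)
qed

text \<open>Turns congruences modulo \<open>p > 2\<close> between values in
  \<open>{0, 1, -1}\<close> into equalities, which lifts Euler's criterion to identities of
  symbols.\<close>

lemma cong_small_eq:
  fixes x y p :: int
  assumes "[x = y] (mod p)" "\<bar>x - y\<bar> < p"
  shows "x = y"
  using assms by (metis cong_iff_dvd_diff dvd_imp_le_int abs_of_pos eq_iff_diff_eq_0 linorder_not_less order.strict_trans1 abs_ge_zero)

lemma Legendre_mult:
  fixes p :: int
  assumes "prime p" "p \<noteq> 2"
  shows "Legendre (a * b) p = Legendre a p * Legendre b p"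
proof (rule cong_small_eq)
  show "[Legendre (a * b) p = Legendre a p * Legendre b p] (mod p)"
    using cong_mult[OF Legendre_euler[OF assms, of a] Legendre_euler[OF assms, of b]]
      Legendre_euler[OF assms, of "a * b"]
    by (metis cong_sym cong_trans power_mult_distrib)
  have p: "p > 2" using assms prime_ge_2_int[of p] by linarith
  show "\<bar>Legendre (a * b) p - Legendre a p * Legendre b p\<bar> < p"
    using p Legendre_cases[of a p] Legendre_cases[of b p] Legendre_cases[of "a * b" p] by auto
qed

lemma Legendre_square: "\<not> p dvd a \<Longrightarrow> prime p \<Longrightarrow> Legendre (a\<^sup>2) p = 1"
  unfolding Legendre_def QuadRes_def cong_0_iff using cong_refl prime_dvd_power by metis

lemma Legendre_1: "prime p \<Longrightarrow> Legendre 1 (p::int) = 1"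
  using Legendre_square[of p 1] not_prime_unit[of p] by auto

lemma Legendre_abs: "prime p \<Longrightarrow> \<not> p dvd a \<Longrightarrow> Legendre a p = 1 \<or> Legendre a (p::int) = -1"
  using Legendre_cases[of a p] Legendre_eq_0_iff[of a p] by auto

lemma Legendre_minus_1:
  fixes p :: int
  assumes "prime p" "p \<noteq> 2"
  shows "Legendre (-1) p = (if p mod 4 = 1 then 1 else -1)"
proof -
  have p: "p > 2" "odd p" using assms prime_ge_2_int[of p] primes_dvd_imp_eq[of 2 p] by auto
  have "Legendre (-1) p = (-1) ^ nat ((p - 1) div 2)"
  proof (rule cong_small_eq[OF Legendre_euler[OF assms]])
    have "((-1) ^ nat ((p - 1) div 2)) \<in> {1, -1::int}" by (cases "even (nat ((p - 1) div 2))") auto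
    then show "\<bar>Legendre (-1) p - (-1) ^ nat ((p - 1) div 2)\<bar> < p"
      using p Legendre_cases[of "-1" p] by auto
  qed
  moreover have "even (nat ((p - 1) div 2)) \<longleftrightarrow> p mod 4 = 1"
    using p by (simp add: even_nat_iff) presburger
  ultimately show ?thesis by simp
qed

lemma Legendre_2:
  fixes p :: int
  assumes "prime p" "p \<noteq> 2"
  shows "Legendre 2 p = (if p mod 8 = 1 \<or> p mod 8 = 7 then 1 else -1)"
proof -
  have p: "p > 2" "odd p" using assms prime_ge_2_int[of p] primes_dvd_imp_eq[of 2 p] by auto
  define h where "h = (p - 1) div 2"
  have h: "p = 2 * h + 1" "h > 0" using p by (auto simp: h_def)
  interpret G: GAUSS "nat p" 2
    by standard (use assms p in \<open>auto simp: prime_nat_iff_prime cong_0_iff dest: zdvd_imp_le\<close>)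
  have ip: "int (nat p) = p" using p by simp
  \<comment> \<open>For the multiplier 2 nothing is reduced modulo \<open>p\<close>: the products
    are the even numbers up to \<open>p - 1\<close>. Hence \<open>G.E\<close> consists of those
    exceeding \<open>h\<close>, and Gauss's lemma becomes a count.\<close>
  have C: "G.C = (\<lambda>x. 2 * x) ` {0<..h}"
    unfolding G.C_def G.B_def G.A_def ip image_image h_def [symmetric]
    by (rule image_cong) (use h in auto)
  have "G.E = (\<lambda>x. 2 * x) ` {h div 2<..h}"
    unfolding G.E_def C ip h_def [symmetric] using h by (auto simp: image_iff)
  then have "card G.E = nat (h - h div 2)"
    by (simp add: card_image inj_on_def)
  then have "Legendre 2 p = (-1) ^ nat (h - h div 2)"
    using G.gauss_lemma ip by simp
  moreover have "even (nat (h - h div 2)) \<longleftrightarrow> p mod 8 = 1 \<or> p mod 8 = 7"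
    using h by (simp add: even_nat_iff) presburger
  ultimately show ?thesis by simp
qed

lemma odd_prime_gt_2: "prime p \<Longrightarrow> p \<noteq> 2 \<Longrightarrow> p > 2 \<and> odd (p::int)"
  using prime_ge_2_int[of p] primes_dvd_imp_eq[of 2 p] by auto

text \<open>Giving \<open>p\<close> the sign that makes it 1 mod 4 absorbs the usual sign factor.
  This is the version that fits prime discriminants.\<close>

lemma Legendre_reciprocity:
  fixes p q :: int
  assumes "prime p" "p \<noteq> 2" "prime q" "q \<noteq> 2" "p \<noteq> q"
  shows "Legendre (if p mod 4 = 1 then p else - p) q = Legendre q p"
proof -
  note p = odd_prime_gt_2[OF assms(1,2)] and q = odd_prime_gt_2[OF assms(3,4)]
  have "\<not> p dvd q" using assms primes_dvd_imp_eq by blast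
  from Legendre_abs[OF assms(1) this] have v: "Legendre q p = 1 \<or> Legendre q p = -1" .
  have QR: "Legendre p q * Legendre q p = (-1) ^ nat ((p - 1) div 2 * ((q - 1) div 2))"
    by (rule Quadratic_Reciprocity_int) (use assms p q in \<open>simp_all add: prime_nat_iff_prime\<close>)
  have par: "even (nat ((p - 1) div 2 * ((q - 1) div 2))) \<longleftrightarrow> p mod 4 = 1 \<or> q mod 4 = 1"
  proof -
    have "even ((p - 1) div 2) \<longleftrightarrow> p mod 4 = 1" "even ((q - 1) div 2) \<longleftrightarrow> q mod 4 = 1"
      using p q by presburger+
    moreover have "(p - 1) div 2 * ((q - 1) div 2) \<ge> 0" using p q by simp
    ultimately show ?thesis by (simp add: even_nat_iff)
  qed
  have QR': "Legendre p q * Legendre q p = (if p mod 4 = 1 \<or> q mod 4 = 1 then 1 else -1)"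
    unfolding QR using par by simp
  show ?thesis
  proof (cases "p mod 4 = 1")
    case True
    then show ?thesis using QR' v by auto
  next
    case False
    then have "Legendre (- p) q = Legendre (-1) q * Legendre p q"
      using Legendre_mult[OF assms(3,4), of "-1" p] by simp
    then show ?thesis using False QR' v Legendre_minus_1[OF assms(3,4)]
      by (cases "q mod 4 = 1") auto
  qed
qed

abbreviation kron_at :: "int \<Rightarrow> int \<Rightarrow> int" where
  "kron_at a p \<equiv> kronecker_at_prime a (nat p)"

lemma kron_at_odd: "p > 2 \<Longrightarrow> kron_at a p = Legendre a p"
  unfolding kronecker_at_prime_def by (subst if_not_P) auto

lemma kron_at_2: "kronecker_at_prime a 2 = (if even a then 0 else if a mod 8 = 1 \<or> a mod 8 = 7 then 1 else - 1)"
  by (simp add: kronecker_at_prime_def)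

lemma odd_mod_8: "odd a \<Longrightarrow> a mod 8 \<in> {1, 3, 5, 7::int}"
  by simp presburger

lemma kron_at_mult:
  assumes "prime p"
  shows "kron_at (a * b) p = kron_at a p * kron_at b p"
proof (cases "p = 2")
  case True
  have "kronecker_at_prime (a * b) 2 = kronecker_at_prime a 2 * kronecker_at_prime b 2" if "odd a" "odd b"
  proof -
    obtain A B where A: "a mod 8 = A" and B: "b mod 8 = B" by blast
    have "a * b mod 8 = A * B mod 8" using A B by (metis mod_mult_eq)
    then show ?thesis
      using odd_mod_8[OF that(1)] odd_mod_8[OF that(2)] that
      unfolding kron_at_2 A B insert_iff empty_iff by (elim disjE) simp_all
  qed
  then show ?thesis using True by (auto simp: kron_at_2)
next
  case False
  then show ?thesis using assms odd_prime_gt_2[of p] by (simp add: kron_at_odd Legendre_mult)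
qed

lemma kron_at_1 [simp]: "prime p \<Longrightarrow> kron_at 1 p = 1"
  using odd_prime_gt_2[of p] by (cases "p = 2") (auto simp: kron_at_2 kron_at_odd Legendre_1)

lemma kron_at_eq_0_iff: "prime p \<Longrightarrow> kron_at a p = 0 \<longleftrightarrow> p dvd a"
  using odd_prime_gt_2[of p] by (cases "p = 2") (auto simp: kron_at_2 kron_at_odd Legendre_eq_0_iff)

lemma kron_at_abs: "prime p \<Longrightarrow> \<not> p dvd a \<Longrightarrow> kron_at a p = 1 \<or> kron_at a p = -1"
  using odd_prime_gt_2[of p] Legendre_abs[of p a] by (cases "p = 2") (auto simp: kron_at_2 kron_at_odd)

lemma kron_at_prod: "prime p \<Longrightarrow> kron_at (\<Prod>x\<in>S. f x) p = (\<Prod>x\<in>S. kron_at (f x) p)"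
  by (induction S rule: infinite_finite_induct) (auto simp: kron_at_mult)

lemma card_square_roots:
  fixes p t :: int
  assumes "prime p" "p \<noteq> 2"
  shows "int (card {x \<in> {0..<p}. [x\<^sup>2 = t] (mod p)}) = 1 + Legendre t p"
proof -
  note p = odd_prime_gt_2[OF assms]
  consider "p dvd t" | "\<not> p dvd t" "QuadRes p t" | "\<not> p dvd t" "\<not> QuadRes p t" by blast
  then show ?thesis
  proof cases
    case 1
    then have "[x\<^sup>2 = t] (mod p) \<longleftrightarrow> p dvd x" for x
      using prime_dvd_power_iff[OF assms(1), of 2 x] dvd_diff_left_iff[of p t "x\<^sup>2"]
      by (simp add: cong_iff_dvd_diff)
    then have "{x \<in> {0..<p}. [x\<^sup>2 = t] (mod p)} = {0}"
      using p by (auto dest: zdvd_imp_le simp: order_le_less)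
    then show ?thesis using 1 by (simp add: Legendre_eq_0_iff)
  next
    case 2
    then obtain y where y: "[y\<^sup>2 = t] (mod p)" by (auto simp: QuadRes_def)
    have ny: "\<not> p dvd y" using y 2(1) by (metis cong_dvd_iff dvd_power pos2 dvd_trans)
    have "[x\<^sup>2 = t] (mod p) \<longleftrightarrow> [x = y] (mod p) \<or> [x = - y] (mod p)" for x
    proof -
      have "[x\<^sup>2 = t] (mod p) \<longleftrightarrow> [x\<^sup>2 = y\<^sup>2] (mod p)" using y by (metis cong_sym cong_trans)
      also have "\<dots> \<longleftrightarrow> p dvd (x - y) * (x + y)"
        by (simp add: cong_iff_dvd_diff power2_eq_square algebra_simps)
      finally show ?thesis by (simp add: prime_dvd_mult_iff[OF assms(1)] cong_iff_dvd_diff)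
    qed
    moreover have "[x = z] (mod p) \<longleftrightarrow> x = z mod p" if "x \<in> {0..<p}" for x z
      using that by (auto simp: cong_def)
    moreover have "y mod p \<in> {0..<p}" "(- y) mod p \<in> {0..<p}" using p by auto
    ultimately have "{x \<in> {0..<p}. [x\<^sup>2 = t] (mod p)} = {y mod p, (- y) mod p}"
      by blast
    moreover have "y mod p \<noteq> (- y) mod p"
    proof
      assume "y mod p = (- y) mod p"
      then have "p dvd 2 * y" by (simp add: mod_eq_dvd_iff)
      then show False using ny assms primes_dvd_imp_eq[of p 2] by (auto simp: prime_dvd_mult_iff)
    qed
    ultimately show ?thesis using 2 by (simp add: Legendre_def cong_0_iff)
  next
    case 3
    then have "{x \<in> {0..<p}. [x\<^sup>2 = t] (mod p)} = {}" by (auto simp: QuadRes_def)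
    then show ?thesis using 3 by (simp only: card.empty) (simp add: Legendre_def cong_0_iff)
  qed
qed

lemma sum_squares_residues:
  fixes f :: "int \<Rightarrow> complex"
  assumes "prime p" "p \<noteq> 2" "periodic_mod p f"
  shows "(\<Sum>x=0..<p. f (x\<^sup>2)) = (\<Sum>t=0..<p. (1 + of_int (Legendre t p)) * f t)"
proof -
  note p = odd_prime_gt_2[OF assms(1,2)]
  have "(\<Sum>x=0..<p. f (x\<^sup>2)) = (\<Sum>x=0..<p. \<Sum>t=0..<p. if [x\<^sup>2 = t] (mod p) then f t else 0)"
  proof (rule sum.cong[OF refl])
    fix x assume "x \<in> {0..<p}"
    have "(\<Sum>t=0..<p. if [x\<^sup>2 = t] (mod p) then f t else 0)
      = (\<Sum>t=0..<p. if t = x\<^sup>2 mod p then f t else 0)"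
      by (intro sum.cong refl) (auto simp: cong_def)
    also have "\<dots> = f (x\<^sup>2)"
      using p periodic_modD[OF assms(3), of "x\<^sup>2 mod p" "x\<^sup>2"] by simp
    finally show "f (x\<^sup>2) = (\<Sum>t=0..<p. if [x\<^sup>2 = t] (mod p) then f t else 0)" by simp
  qed
  also have "\<dots> = (\<Sum>t=0..<p. \<Sum>x=0..<p. if [x\<^sup>2 = t] (mod p) then f t else 0)"
    by (rule sum.swap)
  also have "\<dots> = (\<Sum>t=0..<p. of_int (int (card {x \<in> {0..<p}. [x\<^sup>2 = t] (mod p)})) * f t)"
    by (subst sum.inter_filter [symmetric]) auto
  finally show ?thesis by (simp only: card_square_roots[OF assms(1,2)]) simp
qed

lemma quadratic_gauss_sum:
  assumes "prime p" "p \<noteq> 2" "\<not> p dvd A" "\<not> p dvd B"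
  shows "(\<Sum>x=0..<p. echar p (A * x\<^sup>2)) * (\<Sum>x=0..<p. echar p (B * x\<^sup>2))
    = of_int (Legendre (- (A * B)) p * p)"
proof -
  note p = odd_prime_gt_2[OF assms(1,2)]
  define g where "g A = (\<Sum>x=0..<p. echar p (A * x\<^sup>2))" for A
  have g: "g A = of_int (Legendre A p) * g 1" if "\<not> p dvd A" for A
  proof -
    have cop: "coprime A p" using that assms(1) prime_imp_coprime coprime_commute by blast
    have per: "periodic_mod p (\<lambda>t. echar p (A * t))" for A
      using p by (intro periodic_modI echar_cong cong_mult) auto
    have gt: "g A = (\<Sum>t=0..<p. of_int (Legendre t p) * echar p (A * t))" if "\<not> p dvd A" for A
      using sum_squares_residues[OF assms(1,2) per[of A]] sum_echar[of p A] p that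
      by (simp add: g_def ring_distribs sum.distrib mult.commute)
    have per': "periodic_mod p (\<lambda>t. of_int (Legendre t p) * echar p t)"
      using p echar_cong[of p] Legendre_cong[of _ _ p] by (intro periodic_modI) (metis not_numeral_less_zero)
    have "of_int (Legendre A p) * g A = (\<Sum>t=0..<p. of_int (Legendre (A * t) p) * echar p (A * t))"
      unfolding gt[OF that] by (simp add: Legendre_mult[OF assms(1,2)] sum_distrib_left mult.assoc)
    also have "\<dots> = g 1"
      using sum_residues_mult[OF _ per' cop] p gt[of 1] by (simp add: zdvd_not_zless)
    finally show ?thesis using Legendre_abs[OF assms(1) that] minus_equation_iff[of "g A"] by auto
  qed
  have n1: "\<not> p dvd -1" "\<not> p dvd 1" using p by (auto simp: zdvd_not_zless)
  have "g 1 * g (-1) = (\<Sum>y=0..<p. \<Sum>x=0..<p. echar p (x\<^sup>2 - y\<^sup>2))"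
    unfolding g_def sum_product by (subst sum.swap) (simp add: echar_add [symmetric])
  \<comment> \<open>After this shift the exponent \<open>x^2 + 2 x y\<close> is linear in
    \<open>y\<close>, and summing over \<open>y\<close> leaves only \<open>x = 0\<close>.\<close>
  also have "\<dots> = (\<Sum>y=0..<p. \<Sum>x=0..<p. echar p ((x + y)\<^sup>2 - y\<^sup>2))"
  proof (rule sum.cong[OF refl])
    fix y
    have "periodic_mod p (\<lambda>x. echar p (x\<^sup>2 - y\<^sup>2))"
      using p by (intro periodic_modI echar_cong cong_diff cong_pow) auto
    from sum_residues_shift[OF _ this, of y] p
    show "(\<Sum>x=0..<p. echar p (x\<^sup>2 - y\<^sup>2)) = (\<Sum>x=0..<p. echar p ((x + y)\<^sup>2 - y\<^sup>2))" by simp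
  qed
  also have "\<dots> = (\<Sum>x=0..<p. \<Sum>y=0..<p. echar p (x\<^sup>2) * echar p (y * (2 * x)))"
    by (subst sum.swap) (simp add: echar_add [symmetric] power2_eq_square algebra_simps)
  also have "\<dots> = (\<Sum>x=0..<p. if x = 0 then of_int p else 0)"
  proof (rule sum.cong[OF refl])
    fix x assume x: "x \<in> {0..<p}"
    have "p dvd 2 * x \<longleftrightarrow> p dvd x"
      using assms(1,2) primes_dvd_imp_eq[of p 2] by (auto simp: prime_dvd_mult_iff)
    also have "\<dots> \<longleftrightarrow> x = 0" using x by (auto dest: zdvd_imp_le simp: order_le_less)
    finally show "(\<Sum>y=0..<p. echar p (x\<^sup>2) * echar p (y * (2 * x))) = (if x = 0 then of_int p else 0)"
      using p by (simp add: sum_distrib_left [symmetric] sum_echar)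
  qed
  also have "\<dots> = of_int p" using p by simp
  finally have g1: "of_int (Legendre (-1) p) * (g 1 * g 1) = of_int p"
    using g[OF n1(1)] by (simp add: mult_ac)
  have sq: "of_int (Legendre (-1) p) * of_int (Legendre (-1) p) = (1::complex)"
    using Legendre_abs[OF assms(1) n1(1)] by auto
  have "g 1 * g 1 = of_int (Legendre (-1) p) * of_int p"
    using arg_cong[OF g1, of "\<lambda>x. of_int (Legendre (-1) p) * x"] sq by (simp add: mult.assoc [symmetric])
  then have "g A * g B = of_int (Legendre (-1) p * Legendre A p * Legendre B p * p)"
    using g[OF assms(3)] g[OF assms(4)] by simp
  also have "Legendre (-1) p * Legendre A p * Legendre B p = Legendre (- (A * B)) p"
    using Legendre_mult[OF assms(1,2)] by (metis mult_minus1 mult.assoc)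
  finally show ?thesis by (simp add: g_def)
qed

subsection \<open>Inhomogeneous binary quadratic polynomials modulo prime powers\<close>

definition conic_poly :: "int \<Rightarrow> int \<Rightarrow> int \<Rightarrow> int \<Rightarrow> int \<Rightarrow> int \<Rightarrow> int \<Rightarrow> int \<Rightarrow> int" where
  "conic_poly e g h s t n x y = e * x\<^sup>2 + g * x * y + h * y\<^sup>2 + s * x + t * y + n"

text \<open>Half the determinant of the symmetric 3 by 3 matrix with diagonal
  \<open>2e, 2h, 2n\<close> and off-diagonal entries \<open>g, s, t\<close>, that is, of the
  homogenized polynomial. Halving keeps it meaningful at 2.\<close>

definition conic_det :: "int \<Rightarrow> int \<Rightarrow> int \<Rightarrow> int \<Rightarrow> int \<Rightarrow> int \<Rightarrow> int" where
  "conic_det e g h s t n = - (g\<^sup>2 - 4 * e * h) * n - (e * t\<^sup>2 - g * s * t + h * s\<^sup>2)"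

definition conic_sum :: "int \<Rightarrow> int \<Rightarrow> int \<Rightarrow> int \<Rightarrow> int \<Rightarrow> int \<Rightarrow> int \<Rightarrow> complex" where
  "conic_sum c e g h s t n = (\<Sum>x=0..<c. \<Sum>y=0..<c. ramanujan_sum c (conic_poly e g h s t n x y))"

lemma conic_cong:
  "[x = x'] (mod c) \<Longrightarrow> [y = y'] (mod c) \<Longrightarrow> [conic_poly e g h s t n x y = conic_poly e g h s t n x' y'] (mod c)"
  unfolding conic_poly_def by (intro cong_add cong_mult cong_pow) auto

lemma conic_sum_swap: "conic_sum c e g h s t n = conic_sum c h g e t s n"
  unfolding conic_sum_def by (subst sum.swap) (simp add: conic_poly_def mult_ac add_ac)

lemma conic_det_swap: "conic_det e g h s t n = conic_det h g e t s n"
  by (simp add: conic_det_def algebra_simps)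

lemma conic_sum_shift:
  assumes "c > 0"
  shows "conic_sum c e g h s t n = conic_sum c e g h (s + 2 * e * x0) (t + g * x0) (n + e * x0\<^sup>2 + s * x0)"
proof -
  have "periodic_mod c (\<lambda>x. \<Sum>y=0..<c. ramanujan_sum c (conic_poly e g h s t n x y))"
    using assms by (intro periodic_modI sum.cong refl ramanujan_sum_cong conic_cong) auto
  from sum_residues_shift[OF assms this, of x0] show ?thesis
    by (simp add: conic_sum_def conic_poly_def power2_eq_square algebra_simps)
qed

lemma conic_det_shift:
  "conic_det e g h (s + 2 * e * x0) (t + g * x0) (n + e * x0\<^sup>2 + s * x0) = conic_det e g h s t n"
  by (simp add: conic_det_def power2_eq_square algebra_simps)

definition form_sum :: "int \<Rightarrow> int \<Rightarrow> int \<Rightarrow> int \<Rightarrow> complex" where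
  "form_sum c e g h = (\<Sum>x=0..<c. \<Sum>y=0..<c. echar c (conic_poly e g h 0 0 0 x y))"

lemma form_sum_swap: "form_sum c e g h = form_sum c h g e"
  unfolding form_sum_def by (subst sum.swap) (simp add: conic_poly_def mult_ac add_ac)

lemma form_sum_prime_unit:
  assumes "prime p" "p \<noteq> 2" "\<not> p dvd g\<^sup>2 - 4 * e * h" "\<not> p dvd e"
  shows "form_sum p e g h = of_int (Legendre (g\<^sup>2 - 4 * e * h) p * p)"
proof -
  note p = odd_prime_gt_2[OF assms(1,2)]
  let ?m = "g\<^sup>2 - 4 * e * h"
  have "\<not> p dvd 2" using primes_dvd_imp_eq[of p 2] assms(1,2) by auto
  then have n2e: "\<not> p dvd 2 * e" using assms(1,4) by (simp add: prime_dvd_mult_iff)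
  then have "coprime (2 * e) p" using assms(1) prime_imp_coprime coprime_commute by blast
  then obtain k where k: "[2 * e * k = 1] (mod p)" using cong_solve_coprime_int by blast
  have nk: "\<not> p dvd k"
  proof
    assume "p dvd k"
    then have "p dvd 1" using k by (metis cong_dvd_iff dvd_mult)
    then show False using p by (simp add: zdvd_not_zless)
  qed
  \<comment> \<open>Complete the square in \<open>x\<close>, with \<open>k = 1/(2e)\<close>.\<close>
  define B where "B = h - e * (g * k)\<^sup>2"
  have row: "(\<Sum>x=0..<p. echar p (conic_poly e g h 0 0 0 x y)) = (\<Sum>x=0..<p. echar p (e * x\<^sup>2)) * echar p (B * y\<^sup>2)" for y
  proof -
    have "periodic_mod p (\<lambda>x. echar p (conic_poly e g h 0 0 0 x y))"
      using p by (intro periodic_modI echar_cong conic_cong) auto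
    from sum_residues_shift[OF _ this, of "- (g * k * y)"] p
    have "(\<Sum>x=0..<p. echar p (conic_poly e g h 0 0 0 x y)) = (\<Sum>x=0..<p. echar p (conic_poly e g h 0 0 0 (x - g * k * y) y))"
      by simp
    also have "\<dots> = (\<Sum>x=0..<p. echar p (e * x\<^sup>2 + B * y\<^sup>2))"
    proof (rule sum.cong[OF refl], rule echar_cong)
      fix x
      have "conic_poly e g h 0 0 0 (x - g * k * y) y - (e * x\<^sup>2 + B * y\<^sup>2) = (2 * e * k - 1) * (g\<^sup>2 * k * y\<^sup>2 - g * x * y)"
        by (simp add: conic_poly_def B_def power2_eq_square algebra_simps)
      then show "[conic_poly e g h 0 0 0 (x - g * k * y) y = e * x\<^sup>2 + B * y\<^sup>2] (mod p)"
        using k by (simp add: cong_iff_dvd_diff)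
    qed (use p in auto)
    finally show ?thesis by (simp add: echar_add sum_distrib_right)
  qed
  have eB: "[- (e * B) = k\<^sup>2 * (e\<^sup>2 * ?m)] (mod p)"
  proof -
    have "- (e * B) - k\<^sup>2 * (e\<^sup>2 * ?m) = (2 * e * k - 1) * ((2 * e * k + 1) * e * h)"
      by (simp add: B_def power2_eq_square algebra_simps)
    then show ?thesis using k by (simp add: cong_iff_dvd_diff)
  qed
  have nB: "\<not> p dvd B"
  proof
    assume "p dvd B"
    then have "p dvd k\<^sup>2 * (e\<^sup>2 * ?m)" using eB by (metis cong_dvd_iff dvd_minus_iff dvd_mult)
    then show False using assms nk prime_dvd_power[OF assms(1)] by (auto simp: prime_dvd_mult_iff)
  qed
  have "form_sum p e g h = (\<Sum>x=0..<p. echar p (e * x\<^sup>2)) * (\<Sum>x=0..<p. echar p (B * x\<^sup>2))"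
    unfolding form_sum_def by (subst sum.swap) (simp add: row sum_distrib_left)
  also have "\<dots> = of_int (Legendre (- (e * B)) p * p)"
    by (rule quadratic_gauss_sum) (use assms nB in auto)
  also have "Legendre (- (e * B)) p = Legendre (k\<^sup>2 * (e\<^sup>2 * ?m)) p" by (rule Legendre_cong[OF eB])
  finally show ?thesis using Legendre_square nk assms by (simp add: Legendre_mult)
qed

lemma form_sum_prime_odd:
  assumes "prime p" "p \<noteq> 2" "\<not> p dvd g\<^sup>2 - 4 * e * h"
  shows "form_sum p e g h = of_int (Legendre (g\<^sup>2 - 4 * e * h) p * p)"
proof -
  note p = odd_prime_gt_2[OF assms(1,2)]
  consider "\<not> p dvd e" | "\<not> p dvd h" | "p dvd e" "p dvd h" by blast
  then show ?thesis
  proof cases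
    case 1
    then show ?thesis using form_sum_prime_unit assms by blast
  next
    case 2
    then show ?thesis using form_sum_prime_unit[of p g h e] assms
      by (simp add: form_sum_swap[of p e] mult.commute mult.left_commute)
  next
    \<comment> \<open>Both outer coefficients vanish modulo \<open>p\<close>, so no square can be
      completed; the form is the hyperbolic plane \<open>g x y\<close>, and its discriminant is a
      square.\<close>
    case 3
    then have ng: "\<not> p dvd g"
      using assms(3) by (metis dvd_diff dvd_mult dvd_mult2 dvd_power_same power2_eq_square)
    have m: "[g\<^sup>2 - 4 * e * h = g\<^sup>2] (mod p)" using 3 by (simp add: cong_iff_dvd_diff)
    have "echar p (conic_poly e g h 0 0 0 x y) = echar p (y * (g * x))" for x y
    proof (rule echar_cong)
      have "conic_poly e g h 0 0 0 x y - y * (g * x) = e * x\<^sup>2 + h * y\<^sup>2" by (simp add: conic_poly_def)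
      then show "[conic_poly e g h 0 0 0 x y = y * (g * x)] (mod p)" using 3 by (simp add: cong_iff_dvd_diff)
    qed (use p in auto)
    then have "form_sum p e g h = (\<Sum>x=0..<p. if p dvd g * x then of_int p else 0)"
      using p by (simp add: form_sum_def sum_echar)
    also have "\<dots> = (\<Sum>x=0..<p. if x = 0 then of_int p else 0)"
      using ng p by (intro sum.cong refl) (auto simp: prime_dvd_mult_iff[OF assms(1)] zdvd_not_zless order_le_less)
    finally show ?thesis using p Legendre_cong[OF m] Legendre_square[OF ng assms(1)] by simp
  qed
qed

lemma echar_2: "echar 2 z = (if even z then 1 else -1)"
proof (cases "even z")
  case True
  then show ?thesis using echar_cong[of 2 z 0] by (simp add: cong_0_iff)
next
  case False
  have "echar 2 1 = -1" by (simp add: echar_def e_mod_def exp_pi_i' mult.commute)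
  moreover have "[z = 1] (mod 2)" using False by (simp add: cong_def odd_iff_mod_2_eq_one)
  ultimately show ?thesis using False echar_cong[of 2 z 1] by simp
qed

text \<open>An odd discriminant is 1 or 5 mod 8 according to the parity of \<open>e * h\<close>, and
  the same parity decides the sum of the four terms.\<close>

lemma form_sum_2:
  assumes "odd (g\<^sup>2 - 4 * e * h)"
  shows "form_sum 2 e g h = of_int (kronecker_at_prime (g\<^sup>2 - 4 * e * h) 2 * 2)"
proof -
  have g: "odd g" using assms by simp
  then obtain z where "g = 2 * z + 1" by (elim oddE)
  then have "g\<^sup>2 = 4 * (z * (z + 1)) + 1" by (simp add: power2_eq_square algebra_simps)
  moreover obtain w where "z * (z + 1) = 2 * w" by (meson dvdE even_mult_iff even_plus_one_iff)
  ultimately have g2: "g\<^sup>2 mod 8 = 1" by simp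
  have *: "(g\<^sup>2 - 4 * e * h) mod 8 = (if even (e * h) then 1 else 5)"
  proof (cases "even (e * h)")
    case True
    then obtain w where "e * h = 2 * w" by auto
    then show ?thesis using g2 True by (simp add: mult.assoc) presburger
  next
    case False
    then obtain w where "e * h = 2 * w + 1" by (elim oddE)
    then show ?thesis using g2 False by (simp add: mult.assoc) presburger
  qed
  have "{0..<2} = {0, 1::int}" by auto
  then have "form_sum 2 e g h = 1 + echar 2 h + echar 2 e + echar 2 (e + g + h)"
    by (simp add: form_sum_def conic_poly_def)
  also have "\<dots> = (if even (e * h) then 2 else -2)" using g by (auto simp: echar_2)
  finally show ?thesis using * assms by (simp add: kronecker_at_prime_def)
qed

lemma form_sum_prime:
  assumes "prime p" "\<not> p dvd g\<^sup>2 - 4 * e * h"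
  shows "form_sum p e g h = of_int (kron_at (g\<^sup>2 - 4 * e * h) p * p)"
  using form_sum_prime_odd[OF assms(1) _ assms(2)] form_sum_2[of g e h] assms odd_prime_gt_2[OF assms(1)]
  by (cases "p = 2") (simp_all add: kron_at_odd)

text \<open>Translating \<open>(x, y)\<close> by multiples of \<open>p ^ Suc k\<close> changes the
  exponent linearly, so only points with gradient 0 mod \<open>p\<close> survive. The gradient is a
  linear map of determinant \<open>- m\<close>, a unit even for \<open>p = 2\<close>, so these are
  the points divisible by \<open>p\<close>, where homogeneity lowers the exponent by 2.\<close>

lemma form_sum_step:
  assumes "prime p" "\<not> p dvd g\<^sup>2 - 4 * e * h"
  shows "form_sum (p ^ Suc (Suc k)) e g h = of_int (p\<^sup>2) * form_sum (p ^ k) e g h"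
proof -
  have p: "p > 0" using assms(1) prime_gt_0_int by blast
  define q where "q = p ^ Suc k"
  have q: "q > 0" "p dvd q" using p by (auto simp: q_def)
  have pq: "p ^ Suc (Suc k) = q * p" by (simp add: q_def)
  let ?F = "conic_poly e g h 0 0 0"
  have ph: "echar (q * p) (?F (x + q * z) (y + q * w)) =
      echar (q * p) (?F x y) * (echar p (z * (2 * e * x + g * y)) * echar p (w * (g * x + 2 * h * y)))" for x y z w
  proof -
    have "?F (x + q * z) (y + q * w) - (?F x y + (q * (z * (2 * e * x + g * y)) + q * (w * (g * x + 2 * h * y))))
      = q * q * ?F z w" by (simp add: conic_poly_def power2_eq_square algebra_simps)
    then have "[?F (x + q * z) (y + q * w) = ?F x y + (q * (z * (2 * e * x + g * y)) + q * (w * (g * x + 2 * h * y)))] (mod q * p)"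
      using q by (simp add: cong_iff_dvd_diff mult_dvd_mono)
    then have "echar (q * p) (?F (x + q * z) (y + q * w)) =
       echar (q * p) (?F x y + (q * (z * (2 * e * x + g * y)) + q * (w * (g * x + 2 * h * y))))"
      using p q by (intro echar_cong) auto
    then show ?thesis using q by (simp add: echar_add echar_mult_cancel)
  qed
  have grad: "p dvd 2 * e * x + g * y \<and> p dvd g * x + 2 * h * y \<longleftrightarrow> p dvd x \<and> p dvd y" for x y
  proof
    assume *: "p dvd 2 * e * x + g * y \<and> p dvd g * x + 2 * h * y"
    have "(g\<^sup>2 - 4 * e * h) * x = g * (g * x + 2 * h * y) - 2 * h * (2 * e * x + g * y)"
      "(g\<^sup>2 - 4 * e * h) * y = g * (2 * e * x + g * y) - 2 * e * (g * x + 2 * h * y)"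
      by (simp_all add: power2_eq_square algebra_simps)
    then have "p dvd (g\<^sup>2 - 4 * e * h) * x" "p dvd (g\<^sup>2 - 4 * e * h) * y" using * by auto
    then show "p dvd x \<and> p dvd y" using assms by (simp add: prime_dvd_mult_iff)
  qed auto
  have "form_sum (q * p) e g h = (\<Sum>x=0..<q. \<Sum>z=0..<p. \<Sum>y=0..<q. \<Sum>w=0..<p. echar (q * p) (?F (x + q * z) (y + q * w)))"
    unfolding form_sum_def by (simp add: sum_residues_blocks[OF q(1) p])
  also have "\<dots> = (\<Sum>x=0..<q. \<Sum>y=0..<q. \<Sum>z=0..<p. \<Sum>w=0..<p. echar (q * p) (?F (x + q * z) (y + q * w)))"
    by (rule sum.cong[OF refl], rule sum.swap)
  also have "\<dots> = (\<Sum>x=0..<q. \<Sum>y=0..<q. if p dvd x then (if p dvd y then of_int (p\<^sup>2) * echar (q * p) (?F x y) else 0) else 0)"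
  proof (intro sum.cong refl)
    fix x y
    have "(\<Sum>z=0..<p. \<Sum>w=0..<p. echar (q * p) (?F (x + q * z) (y + q * w))) =
       echar (q * p) (?F x y) * ((\<Sum>z=0..<p. echar p (z * (2 * e * x + g * y))) * (\<Sum>w=0..<p. echar p (w * (g * x + 2 * h * y))))"
      unfolding ph sum_distrib_left [symmetric] sum_distrib_right [symmetric] by simp
    also have "\<dots> = (if p dvd 2 * e * x + g * y \<and> p dvd g * x + 2 * h * y then of_int (p\<^sup>2) * echar (q * p) (?F x y) else 0)"
      using p by (simp add: sum_echar power2_eq_square)
    finally show "(\<Sum>z=0..<p. \<Sum>w=0..<p. echar (q * p) (?F (x + q * z) (y + q * w))) =
      (if p dvd x then (if p dvd y then of_int (p\<^sup>2) * echar (q * p) (?F x y) else 0) else 0)"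
      by (simp add: grad)
  qed
  also have "\<dots> = (\<Sum>x=0..<q. if p dvd x then (\<Sum>y=0..<q. if p dvd y then of_int (p\<^sup>2) * echar (q * p) (?F x y) else 0) else 0)"
    by (intro sum.cong) auto
  also have "\<dots> = (\<Sum>x=0..<p ^ k. \<Sum>y=0..<p ^ k. of_int (p\<^sup>2) * echar (q * p) (?F (p * x) (p * y)))"
    using p by (simp add: q_def sum_residues_multiples)
  also have "\<dots> = of_int (p\<^sup>2) * form_sum (p ^ k) e g h"
  proof -
    have "echar (q * p) (?F (p * x) (p * y)) = echar (p ^ k) (?F x y)" for x y
      using p echar_mult_cancel[of "p * p" "p ^ k" "?F x y"]
      by (simp add: q_def conic_poly_def power2_eq_square algebra_simps)
    then show ?thesis by (simp add: form_sum_def sum_distrib_left)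
  qed
  finally show ?thesis by (simp only: pq)
qed

lemma form_sum_prime_power:
  assumes "prime p" "\<not> p dvd g\<^sup>2 - 4 * e * h"
  shows "form_sum (p ^ k) e g h = of_int (kron_at (g\<^sup>2 - 4 * e * h) p ^ k * p ^ k)"
proof (induction k rule: induct_nat_012)
  case 0
  then show ?case by (simp add: form_sum_def)
next
  case 1
  then show ?case using form_sum_prime[OF assms] by simp
next
  case (ge2 k)
  have "kron_at (g\<^sup>2 - 4 * e * h) p * kron_at (g\<^sup>2 - 4 * e * h) p = 1"
    using kron_at_abs[OF assms] by auto
  then have chi: "kron_at (g\<^sup>2 - 4 * e * h) p ^ Suc (Suc k) = kron_at (g\<^sup>2 - 4 * e * h) p ^ k"
    by (simp add: mult.assoc [symmetric])
  show ?case
    unfolding form_sum_step[OF assms] ge2(1) chi by (simp add: power2_eq_square)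
qed

lemma conic_sum_prime_power_unramified:
  assumes "prime p" "\<not> p dvd g\<^sup>2 - 4 * e * h"
  shows "conic_sum (p ^ k) e g h s t n =
    of_int (kron_at (g\<^sup>2 - 4 * e * h) p ^ k * p ^ k) * ramanujan_sum (p ^ k) (conic_det e g h s t n)"
proof -
  let ?m = "g\<^sup>2 - 4 * e * h"
  define c where "c = p ^ k"
  have p: "p > 0" using assms(1) prime_gt_0_int by blast
  then have c: "c > 0" by (simp add: c_def)
  have cop: "coprime ?m c"
    using assms prime_imp_coprime[OF assms] by (simp add: c_def coprime_commute)
  then obtain i where i: "[?m * i = 1] (mod c)" using cong_solve_coprime_int by blast
  define x0 where "x0 = (2 * h * s - g * t) * i"
  define y0 where "y0 = (2 * e * t - g * s) * i"
  define n' where "n' = conic_poly e g h s t n x0 y0"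
  \<comment> \<open>\<open>(x0, y0)\<close> is the critical point modulo \<open>c\<close>.\<close>
  have crit: "[2 * e * x0 + g * y0 + s = 0] (mod c)" "[g * x0 + 2 * h * y0 + t = 0] (mod c)"
  proof -
    have "2 * e * x0 + g * y0 + s = (1 - ?m * i) * s" "g * x0 + 2 * h * y0 + t = (1 - ?m * i) * t"
      by (simp_all add: x0_def y0_def power2_eq_square algebra_simps)
    then show "[2 * e * x0 + g * y0 + s = 0] (mod c)" "[g * x0 + 2 * h * y0 + t = 0] (mod c)"
      using i by (simp_all add: cong_iff_dvd_diff dvd_diff_commute)
  qed
  have ph: "echar c (d * conic_poly e g h s t n (x + x0) (y + y0)) = echar c (conic_poly (d * e) (d * g) (d * h) 0 0 0 x y) * echar c (d * n')" for d x y
  proof -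
    have "d * conic_poly e g h s t n (x + x0) (y + y0) - (conic_poly (d * e) (d * g) (d * h) 0 0 0 x y + d * n')
      = (2 * e * x0 + g * y0 + s) * (d * x) + (g * x0 + 2 * h * y0 + t) * (d * y)"
      by (simp add: conic_poly_def n'_def power2_eq_square algebra_simps)
    then have "[d * conic_poly e g h s t n (x + x0) (y + y0) = conic_poly (d * e) (d * g) (d * h) 0 0 0 x y + d * n'] (mod c)"
      using crit by (simp add: cong_iff_dvd_diff)
    then show ?thesis using c by (simp add: echar_add [symmetric] echar_cong)
  qed
  have per: "periodic_mod c (\<lambda>x. \<Sum>y=0..<c. echar c (d * conic_poly e g h s t n x y))"
      "periodic_mod c (\<lambda>y. echar c (d * conic_poly e g h s t n x y))" for d x
    using c by (intro periodic_modI sum.cong refl echar_cong cong_mult conic_cong; simp)+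
  have inner: "(\<Sum>x=0..<c. \<Sum>y=0..<c. echar c (d * conic_poly e g h s t n x y)) =
      of_int (kron_at ?m p ^ k * p ^ k) * echar c (d * n')" if "coprime d c" for d
  proof (cases "k = 0")
    case True
    then show ?thesis by (simp add: c_def)
  next
    case False
    then have nd: "\<not> p dvd d" using that assms(1) not_coprimeI[of p d p]
      by (auto simp: c_def coprime_commute)
    have "(\<Sum>x=0..<c. \<Sum>y=0..<c. echar c (d * conic_poly e g h s t n x y)) =
        (\<Sum>x=0..<c. \<Sum>y=0..<c. echar c (d * conic_poly e g h s t n (x + x0) (y + y0)))"
      using sum_residues_shift[OF c per(1), of d x0] sum_residues_shift[OF c per(2), of d _ y0] by simp
    also have "\<dots> = form_sum c (d * e) (d * g) (d * h) * echar c (d * n')"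
      unfolding ph form_sum_def sum_distrib_right ..
    also have "form_sum c (d * e) (d * g) (d * h) = of_int (kron_at ((d * g)\<^sup>2 - 4 * (d * e) * (d * h)) p ^ k * p ^ k)"
    proof -
      have "(d * g)\<^sup>2 - 4 * (d * e) * (d * h) = d * d * ?m" by (simp add: power2_eq_square algebra_simps)
      then have "\<not> p dvd (d * g)\<^sup>2 - 4 * (d * e) * (d * h)" using assms nd by (simp add: prime_dvd_mult_iff)
      then show ?thesis unfolding c_def by (rule form_sum_prime_power[OF assms(1)])
    qed
    also have "kron_at ((d * g)\<^sup>2 - 4 * (d * e) * (d * h)) p = kron_at ?m p"
    proof -
      have "(d * g)\<^sup>2 - 4 * (d * e) * (d * h) = d * d * ?m" by (simp add: power2_eq_square algebra_simps)
      moreover have "kron_at (d * d) p = 1" using kron_at_abs[OF assms(1) nd] by (auto simp: kron_at_mult[OF assms(1)])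
      ultimately show ?thesis using kron_at_mult[OF assms(1), of "d * d" ?m] by simp
    qed
    finally show ?thesis .
  qed
  have "conic_sum c e g h s t n = (\<Sum>x=0..<c. \<Sum>d | d \<in> {0..<c} \<and> coprime d c. \<Sum>y=0..<c. echar c (d * conic_poly e g h s t n x y))"
    unfolding conic_sum_def ramanujan_sum_def by (rule sum.cong[OF refl], rule sum.swap)
  also have "\<dots> = (\<Sum>d | d \<in> {0..<c} \<and> coprime d c. \<Sum>x=0..<c. \<Sum>y=0..<c. echar c (d * conic_poly e g h s t n x y))"
    by (rule sum.swap)
  also have "\<dots> = of_int (kron_at ?m p ^ k * p ^ k) * ramanujan_sum c n'"
    unfolding ramanujan_sum_def sum_distrib_left by (intro sum.cong refl inner) auto
  \<comment> \<open>The critical value satisfies \<open>- m n' = P\<close> modulo \<open>c\<close>,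
    and unit factors do not affect a Ramanujan sum, so no division by \<open>m\<close> is
    required.\<close>
  also have "ramanujan_sum c n' = ramanujan_sum c ((- ?m) * n')"
    by (rule ramanujan_sum_unit_mult [symmetric]) (use c cop in \<open>simp_all only: coprime_minus_left_iff\<close>)
  also have "\<dots> = ramanujan_sum c (conic_det e g h s t n)"
  proof (rule ramanujan_sum_cong[OF c])
    have "- ?m * n' - conic_det e g h s t n =
       (g * x0 + 2 * h * y0 + t) * (e * (g * x0 + 2 * h * y0 + t) - g * (2 * e * x0 + g * y0 + s))
          + (2 * e * x0 + g * y0 + s) * (h * (2 * e * x0 + g * y0 + s))"
      by (simp add: n'_def conic_poly_def conic_det_def power2_eq_square algebra_simps)
    then show "[- ?m * n' = conic_det e g h s t n] (mod c)"
      using crit by (simp add: cong_iff_dvd_diff)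
  qed
  finally show ?thesis by (simp add: c_def)
qed

subsection \<open>Local symbols at the primes dividing a fundamental discriminant\<close>

text \<open>
  \<open>prime_disc m p\<close> is the factor at \<open>p\<close> of the decomposition of \<open>m\<close> into prime discriminants,
  \<open>local_char m p\<close> the component at \<open>p\<close> of the Dirichlet character \<open>(m/\<cdot>)\<close> (on integers prime
  to \<open>p\<close>), and \<open>hilbert m p z\<close> is the Hilbert symbol \<open>(z, m)\<close> at \<open>p\<close>.
\<close>

definition prime_disc :: "int \<Rightarrow> int \<Rightarrow> int" where
  "prime_disc m p =
     (if p = 2 then (if odd (m div 4) then - 4 else if m div 8 mod 4 = 1 then 8 else - 8)
      else if p mod 4 = 1 then p else - p)"

definition local_char :: "int \<Rightarrow> int \<Rightarrow> int \<Rightarrow> int" where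
  "local_char m p u =
     (if p = 2 then
        (if odd (m div 4) then (if u mod 4 = 1 then 1 else - 1)
         else if m div 8 mod 4 = 1 then (if u mod 8 = 1 \<or> u mod 8 = 7 then 1 else - 1)
         else (if u mod 8 = 1 \<or> u mod 8 = 3 then 1 else - 1))
      else Legendre u p)"

definition hilbert :: "int \<Rightarrow> int \<Rightarrow> int \<Rightarrow> int" where
  "hilbert m p z = local_char m p (z div p ^ multiplicity p z) *
     kron_at (m div prime_disc m p) p ^ multiplicity p z"

lemma prime_2_dvd_iff: "prime p \<Longrightarrow> p dvd 2 \<longleftrightarrow> p = (2::int)"
  using primes_dvd_imp_eq[of p 2] by auto

lemma prime_dvd_4_mult: "prime p \<Longrightarrow> p \<noteq> 2 \<Longrightarrow> p dvd 4 * z \<longleftrightarrow> p dvd (z::int)"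
  using prime_dvd_mult_iff[of p 2 "2 * z"] prime_dvd_mult_iff[of p 2 z] prime_2_dvd_iff[of p] by simp

lemma local_char_mult:
  assumes "prime p" "\<not> p dvd u" "\<not> p dvd v"
  shows "local_char m p (u * v) = local_char m p u * local_char m p v"
proof (cases "p = 2")
  case True
  obtain A B where A: "u mod 8 = A" and B: "v mod 8 = B" by blast
  have AB: "u * v mod 8 = A * B mod 8" using A B by (metis mod_mult_eq)
  have 4: "z mod 4 = z mod 8 mod 4" for z :: int by (simp add: mod_mod_cancel)
  have uv: "odd u" "odd v" using assms True by auto
  show ?thesis
    using odd_mod_8[OF uv(1)] odd_mod_8[OF uv(2)] True
    unfolding local_char_def 4[of u] 4[of v] 4[of "u * v"] A B AB insert_iff empty_iff
    by (elim disjE) simp_all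
next
  case False
  then show ?thesis using assms by (simp add: local_char_def Legendre_mult)
qed

lemma local_char_abs: "prime p \<Longrightarrow> \<not> p dvd u \<Longrightarrow> local_char m p u = 1 \<or> local_char m p u = -1"
  using Legendre_abs[of p u] unfolding local_char_def by (simp only: split: if_split) simp

locale fund_disc =
  fixes m :: int
  assumes fund: "fundamental_discriminant m"
begin

lemma nonzero: "m \<noteq> 0"
  using fund by (auto simp: fundamental_discriminant_def cong_def)

lemma even_cases:
  assumes "even m"
  obtains M where "m = 4 * M" "odd M" "M mod 8 = 3 \<or> M mod 8 = 7" | M where "m = 8 * M" "odd M"
proof -
  have "m mod 4 \<noteq> 1" using assms by presburger
  then have "4 dvd m" "m div 4 mod 4 = 2 \<or> m div 4 mod 4 = 3"
    using fund by (simp_all add: fundamental_discriminant_def cong_def)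
  then show thesis
  proof (elim dvdE disjE)
    fix M assume M: "m = 4 * M" and "m div 4 mod 4 = 2"
    then have "M mod 4 = 2" by simp
    then have "M = 2 * (M div 2)" "odd (M div 2)" by presburger+
    then show thesis using M by (intro that(2)[of "M div 2"]) auto
  next
    fix M assume M: "m = 4 * M" and "m div 4 mod 4 = 3"
    then have "M mod 4 = 3" by simp
    then have "odd M" "M mod 8 = 3 \<or> M mod 8 = 7" by presburger+
    then show thesis using M by (intro that(1)[of M])
  qed
qed

lemma square_not_dvd:
  assumes "prime p" "p \<noteq> 2"
  shows "\<not> p\<^sup>2 dvd m"
proof
  assume p2: "p\<^sup>2 dvd m"
  have np: "\<not> p dvd 1" using assms(1) by auto
  show False
  proof (cases "squarefree m")
    case True
    then show False using p2 np squarefreeD by blast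
  next
    case False
    then have "4 dvd m" "squarefree (m div 4)" using fund by (auto simp: fundamental_discriminant_def)
    moreover have "coprime (p\<^sup>2) 4"
      using assms prime_dvd_4_mult[of p 1] prime_imp_coprime[of p 4] np by simp
    ultimately have "p\<^sup>2 dvd m div 4"
      using p2 by (metis coprime_dvd_mult_right_iff dvd_mult_div_cancel)
    then show False using \<open>squarefree (m div 4)\<close> np squarefreeD by blast
  qed
qed

lemma odd_cofactor:
  assumes "prime p" "p \<noteq> 2" "m = p * m1"
  shows "\<not> p dvd m1"
  using square_not_dvd[OF assms(1,2)] assms(3) by (auto simp: power2_eq_square)

lemma hilbert_unit: "\<not> p dvd u \<Longrightarrow> hilbert m p u = local_char m p u"
  by (simp add: hilbert_def not_dvd_imp_multiplicity_0)

lemma cofactor_odd: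
  assumes "prime p" "p \<noteq> 2" "m = p * m1"
  shows "m div prime_disc m p = (if p mod 4 = 1 then m1 else - m1)"
proof -
  have "p \<noteq> 0" using assms(1) by auto
  moreover have "m = (- p) * (- m1)" using assms(3) by simp
  ultimately have "m div p = m1" "m div (- p) = - m1"
    using assms(3) nonzero_mult_div_cancel_left[of p m1] nonzero_mult_div_cancel_left[of "- p" "- m1"] by auto
  then show ?thesis using assms(2) by (simp add: prime_disc_def)
qed

lemma cofactor_4: "m = 4 * M \<Longrightarrow> odd M \<Longrightarrow> m div prime_disc m 2 = - M"
  by (simp add: prime_disc_def)

lemma cofactor_8: "m = 8 * M \<Longrightarrow> odd M \<Longrightarrow> m div prime_disc m 2 = (if M mod 4 = 1 then M else - M)"
  by (simp add: prime_disc_def)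

lemma cofactor_unit:
  assumes "prime p" "p dvd m"
  shows "\<not> p dvd m div prime_disc m p"
proof (cases "p = 2")
  case True
  then have "even m" using assms by simp
  then show ?thesis
  proof (cases rule: even_cases)
    case (1 M)
    then show ?thesis using cofactor_4[OF 1(1,2)] True by simp
  next
    case (2 M)
    then show ?thesis using cofactor_8[OF 2] True by simp
  qed
next
  case False
  obtain m1 where m1: "m = p * m1" using assms(2) by auto
  then show ?thesis using odd_cofactor[OF assms(1) False m1] cofactor_odd[OF assms(1) False m1] by simp
qed

lemma hilbert_uniformizer:
  assumes "prime p" "\<not> p dvd z"
  shows "hilbert m p (p * z) = local_char m p z * kron_at (m div prime_disc m p) p"
proof -
  have "p \<noteq> 0" using assms(1) by auto
  moreover have "multiplicity p (p * z) = 1"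
    using assms by (intro multiplicity_eqI) (auto simp: power2_eq_square)
  ultimately show ?thesis by (simp add: hilbert_def)
qed

lemma multiplicity_cofactor_unit: "prime p \<Longrightarrow> z \<noteq> 0 \<Longrightarrow> \<not> p dvd z div p ^ multiplicity p z"
  using multiplicity_decompose[of z p] by (auto simp: not_prime_unit)

lemma hilbert_mult:
  assumes "prime p" "z \<noteq> 0" "w \<noteq> 0"
  shows "hilbert m p (z * w) = hilbert m p z * hilbert m p w"
proof -
  have "multiplicity p (z * w) = multiplicity p z + multiplicity p w"
    using assms by (intro prime_elem_multiplicity_mult_distrib) auto
  moreover have "(z * w) div p ^ (multiplicity p z + multiplicity p w)
      = (z div p ^ multiplicity p z) * (w div p ^ multiplicity p w)"
    by (simp add: power_add div_mult_div_if_dvd multiplicity_dvd)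
  ultimately show ?thesis
    using local_char_mult[OF assms(1) multiplicity_cofactor_unit[OF assms(1,2)] multiplicity_cofactor_unit[OF assms(1,3)]]
    by (simp add: hilbert_def power_add mult_ac)
qed

lemma hilbert_abs:
  assumes "prime p" "p dvd m" "z \<noteq> 0"
  shows "hilbert m p z = 1 \<or> hilbert m p z = -1"
proof -
  have "x ^ k = 1 \<or> x ^ k = -1" if "x = 1 \<or> x = -1" for x :: int and k
    using that by (cases "even k") auto
  from this[OF kron_at_abs[OF assms(1) cofactor_unit[OF assms(1,2)]], of "multiplicity p z"]
  show ?thesis
    using local_char_abs[OF assms(1) multiplicity_cofactor_unit[OF assms(1,3)], of m]
    unfolding hilbert_def by (elim disjE) simp_all
qed

lemma hilbert_square: "prime p \<Longrightarrow> p dvd m \<Longrightarrow> z \<noteq> 0 \<Longrightarrow> hilbert m p (z * z) = 1"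
  using hilbert_abs[of p z] hilbert_mult[of p z z] by auto

lemma hilbert_sq_mult: "prime p \<Longrightarrow> p dvd m \<Longrightarrow> z \<noteq> 0 \<Longrightarrow> w \<noteq> 0 \<Longrightarrow> hilbert m p (z * z * w) = hilbert m p w"
  using hilbert_square[of p z] hilbert_mult[of p "z * z" w] by auto

end

section \<open>Prime discriminants and the product formula for Hilbert symbols\<close>

lemma sgn_prod_int: "sgn (\<Prod>x\<in>A. f x) = (\<Prod>x\<in>A. sgn (f x :: int))"
  by (induction A rule: infinite_finite_induct) (auto simp: sgn_mult)

lemma squarefree_prod_primes:
  assumes "squarefree (n::int)"
  shows "(\<Prod>p\<in>prime_factors n. p) = \<bar>n\<bar>"
proof -
  have n: "n \<noteq> 0" using assms by auto
  have "\<bar>n\<bar> = (\<Prod>p\<in>prime_factors n. p ^ multiplicity p n)" using prod_prime_factors[OF n] by simp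
  also have "\<dots> = (\<Prod>p\<in>prime_factors n. p)"
    using assms by (intro prod.cong refl) (auto simp: squarefree_factorial_semiring'[OF n])
  finally show ?thesis by simp
qed

text \<open>Both sides have absolute value \<open>\<bar>n\<bar>\<close> and are 1 mod 4, which fixes
  the sign.\<close>

lemma odd_squarefree_prod:
  assumes "squarefree (n::int)" "odd n"
  shows "(\<Prod>p\<in>prime_factors n. if p mod 4 = 1 then p else - p) = (if n mod 4 = 1 then n else - n)"
proof -
  let ?f = "\<lambda>p::int. if p mod 4 = 1 then p else - p"
  have odd: "odd p" if "p \<in> prime_factors n" for p
    using that assms(2) by (metis dvd_trans in_prime_factors_imp_dvd)
  have "(\<Prod>p\<in>A. ?f p) mod 4 = 1" if "finite A" "A \<subseteq> prime_factors n" for A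
    using that
  proof (induction A rule: finite_induct)
    case (insert p A)
    have "odd p" using odd[of p] insert by simp
    then have "p mod 4 \<noteq> 1 \<Longrightarrow> (- p) mod 4 = 1" by presburger
    then have f: "?f p mod 4 = 1" by simp
    have P: "(\<Prod>p\<in>A. ?f p) mod 4 = 1" using insert by simp
    have "(?f p * (\<Prod>p\<in>A. ?f p)) mod 4 = ((?f p mod 4) * ((\<Prod>p\<in>A. ?f p) mod 4)) mod 4"
      by (rule mod_mult_eq [symmetric])
    also have "\<dots> = 1" unfolding f P by simp
    finally show ?case using insert(1,2) by simp
  qed auto
  then have 1: "(\<Prod>p\<in>prime_factors n. ?f p) mod 4 = 1" by simp
  have "\<bar>\<Prod>p\<in>prime_factors n. ?f p\<bar> = (\<Prod>p\<in>prime_factors n. \<bar>?f p\<bar>)" by (rule abs_prod)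
  also have "\<dots> = (\<Prod>p\<in>prime_factors n. p)"
    by (intro prod.cong) (auto simp: prime_ge_0_int in_prime_factors_imp_prime)
  finally have "\<bar>\<Prod>p\<in>prime_factors n. ?f p\<bar> = \<bar>n\<bar>" using squarefree_prod_primes[OF assms(1)] by simp
  then have "(\<Prod>p\<in>prime_factors n. ?f p) = n \<or> (\<Prod>p\<in>prime_factors n. ?f p) = - n" by linarith
  moreover have "n mod 4 = 1 \<or> (- n) mod 4 = 1" "\<not> (n mod 4 = 1 \<and> (- n) mod 4 = 1)"
    using assms(2) by presburger+
  ultimately show ?thesis using 1 by auto
qed

context fund_disc
begin

text \<open>The odd primes contribute the odd part of \<open>m\<close> with the sign that makes it 1
  mod 4. The choice among \<open>- 4\<close>, \<open>8\<close> and \<open>- 8\<close> is the one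
  that corrects this sign.\<close>

lemma prod_prime_disc: "(\<Prod>p\<in>prime_factors m. prime_disc m p) = m"
proof -
  have oddpart: "(\<Prod>p\<in>prime_factors n. prime_disc m p) = (if n mod 4 = 1 then n else - n)" if "squarefree n" "odd n" for n
  proof -
    have "p \<noteq> 2" if "p \<in> prime_factors n" for p
      using that \<open>odd n\<close> by (auto dest: in_prime_factors_imp_dvd)
    then have "(\<Prod>p\<in>prime_factors n. prime_disc m p) = (\<Prod>p\<in>prime_factors n. if p mod 4 = 1 then p else - p)"
      by (intro prod.cong) (auto simp: prime_disc_def)
    then show ?thesis using odd_squarefree_prod[OF that] by simp
  qed
  have pf2: "prime_factors (2 ^ k * n) = insert 2 (prime_factors n)" if "k > 0" "n \<noteq> 0" for k :: nat and n :: int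
    using that by (simp add: prime_factorization_mult prime_factors_power prime_factorization_prime)
  show ?thesis
  proof (cases "even m")
    case False
    then have "m mod 4 = 1" "squarefree m" using fund by (auto simp: fundamental_discriminant_def cong_def)
    then show ?thesis using oddpart[of m] False by simp
  next
    case True
    then show ?thesis
    proof (cases rule: even_cases)
      case (1 M)
      note M = 1(2)
      have sq: "squarefree M" using fund 1 by (auto simp: fundamental_discriminant_def cong_def)
      have "prime_factors m = insert 2 (prime_factors M)" using pf2[of 2 M] 1 M by auto
      moreover have "2 \<notin> prime_factors M" using M by (auto dest: in_prime_factors_imp_dvd)
      moreover have "M mod 4 \<noteq> 1" using 1(3) by presburger
      ultimately show ?thesis using oddpart[OF sq M] 1 M by (simp add: prime_disc_def)
    next
      case (2 M)
      have "squarefree (2 * M)" using fund 2 by (auto simp: fundamental_discriminant_def cong_def)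
      then have sq: "squarefree M" using squarefree_multD by blast
      have "prime_factors m = insert 2 (prime_factors M)" using pf2[of 3 M] 2 by auto
      moreover have "2 \<notin> prime_factors M" using 2 by (auto dest: in_prime_factors_imp_dvd)
      ultimately show ?thesis using oddpart[OF sq 2(2)] 2 by (simp add: prime_disc_def)
    qed
  qed
qed

text \<open>Quadratic reciprocity and its two supplements, according to whether
  \<open>p = 2\<close>, \<open>q = 2\<close> or both are odd.\<close>

lemma local_char_prime:
  assumes "prime p" "p dvd m" "prime q" "p \<noteq> q"
  shows "local_char m p q = kron_at (prime_disc m p) q"
proof (cases "p = 2")
  case True
  then have q: "q \<noteq> 2" using assms by auto
  note q' = odd_prime_gt_2[OF assms(3) q]
  have 4: "Legendre 4 q = 1" using Legendre_square[of q 2] assms(3) q prime_2_dvd_iff[of q] by simp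
  have 8: "Legendre 8 q = Legendre 2 q" using Legendre_mult[OF assms(3) q, of 4 2] 4 by simp
  have m4: "Legendre (-4) q = Legendre (-1) q" using Legendre_mult[OF assms(3) q, of "-1" 4] 4 by simp
  have m8: "Legendre (-8) q = Legendre (-1) q * Legendre 2 q" using Legendre_mult[OF assms(3) q, of "-1" 8] 8 by simp
  obtain Q where Q: "q mod 8 = Q" by blast
  then have Q4: "q mod 4 = Q mod 4" using mod_mod_cancel[of 4 8 q] by simp
  show ?thesis
    using odd_mod_8[of q] q' True
    unfolding Q local_char_def prime_disc_def Legendre_2[OF assms(3) q] Legendre_minus_1[OF assms(3) q] Q4 insert_iff empty_iff
    by (auto simp: kron_at_odd m4 8 m8 Legendre_2[OF assms(3) q] Legendre_minus_1[OF assms(3) q] Q Q4)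
next
  case False
  note p = odd_prime_gt_2[OF assms(1) False]
  show ?thesis
  proof (cases "q = 2")
    case True
    obtain Q where Q: "p mod 8 = Q" by blast
    have Q': "p mod 4 = Q mod 4" "(- p) mod 8 = (- Q) mod 8"
      using mod_mod_cancel[of 4 8 p] mod_minus_eq[of p 8] Q by simp_all
    have "Q = 1 \<or> Q = 3 \<or> Q = 5 \<or> Q = 7" using odd_mod_8[of p] p Q by simp
    then show ?thesis using p False True
      by (elim disjE) (simp_all add: local_char_def prime_disc_def kron_at_2 Legendre_2[OF assms(1) False] Q Q')
  next
    case q: False
    then show ?thesis using Legendre_reciprocity[OF assms(1) False assms(3) q assms(4)] odd_prime_gt_2[OF assms(3) q]
      by (simp add: local_char_def prime_disc_def kron_at_odd False)
  qed
qed

text \<open>The product formula for the pair \<open>(q, m)\<close>. The real place is trivial since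
  \<open>q > 0\<close>, so if \<open>q\<close> does not divide \<open>m\<close> the only omitted
  factor is \<open>(m/q)\<close> at \<open>q\<close> itself. If \<open>q\<close> divides
  \<open>m\<close>, reciprocity makes the product over the other primes equal to the factor at
  \<open>q\<close>, and a sign squares to 1.\<close>

lemma prod_hilbert_prime:
  assumes "prime q"
  shows "(\<Prod>p\<in>prime_factors m. hilbert m p q) = (if q dvd m then 1 else kron_at m q)"
proof -
  have pr: "prime p" "p dvd m" if "p \<in> prime_factors m" for p
    using that by (auto intro: in_prime_factors_imp_prime in_prime_factors_imp_dvd)
  have other: "hilbert m p q = kron_at (prime_disc m p) q" if "p \<in> prime_factors m" "p \<noteq> q" for p
  proof -
    have "\<not> p dvd q" using pr[OF that(1)] that(2) assms primes_dvd_imp_eq[of p q] by blast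
    then show ?thesis using pr[OF that(1)] that(2) assms by (simp add: hilbert_unit local_char_prime)
  qed
  show ?thesis
  proof (cases "q dvd m")
    case False
    then have "(\<Prod>p\<in>prime_factors m. hilbert m p q) = (\<Prod>p\<in>prime_factors m. kron_at (prime_disc m p) q)"
      using other pr by (intro prod.cong refl) auto
    also have "\<dots> = kron_at m q" using kron_at_prod[OF assms, of "prime_disc m" "prime_factors m"] prod_prime_disc by simp
    finally show ?thesis using False by simp
  next
    case True
    let ?S = "prime_factors m - {q}"
    have qin: "q \<in> prime_factors m" using True assms nonzero by (simp add: in_prime_factors_iff)
    have "(\<Prod>p\<in>?S. prime_disc m p) * prime_disc m q = m"
      using prod.remove[OF _ qin, of "prime_disc m"] prod_prime_disc by (simp add: mult.commute)
    then have co: "(\<Prod>p\<in>?S. prime_disc m p) = m div prime_disc m q"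
      using nonzero by (metis nonzero_mult_div_cancel_right mult_zero_right)
    have "(\<Prod>p\<in>prime_factors m. hilbert m p q) = hilbert m q q * (\<Prod>p\<in>?S. hilbert m p q)"
      using prod.remove[OF _ qin] by simp
    also have "(\<Prod>p\<in>?S. hilbert m p q) = (\<Prod>p\<in>?S. kron_at (prime_disc m p) q)"
      using other by (intro prod.cong) auto
    also have "\<dots> = kron_at (m div prime_disc m q) q" by (simp add: co kron_at_prod[OF assms, symmetric])
    also have "hilbert m q q = kron_at (m div prime_disc m q) q"
    proof -
      have "\<not> q dvd 1" using assms by auto
      then have "hilbert m q q = local_char m q 1 * kron_at (m div prime_disc m q) q"
        using hilbert_uniformizer[OF assms, of 1] by simp
      moreover have "local_char m q 1 = 1" using Legendre_1[OF assms] by (simp add: local_char_def)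
      ultimately show ?thesis by simp
    qed
    finally show ?thesis using True kron_at_abs[OF assms cofactor_unit[OF assms True]]
      by (elim disjE) simp_all
  qed
qed

lemma hilbert_1:
  assumes "prime p"
  shows "hilbert m p 1 = 1"
proof -
  have "\<not> p dvd 1" using assms not_prime_unit by blast
  then have "hilbert m p 1 = local_char m p 1" by (rule hilbert_unit)
  also have "\<dots> = 1" unfolding local_char_def using Legendre_1[OF assms] by simp
  finally show ?thesis .
qed

lemma prod_hilbert_prod_mset:
  assumes "\<forall>q\<in>#A. prime q"
  shows "(\<Prod>p\<in>prime_factors m. hilbert m p (int (prod_mset A)))
    = (\<Prod>q\<in>#A. if int q dvd m then 1 else kronecker_at_prime m q)"
  using assms
proof (induction A)
  case empty
  then show ?case by (auto intro!: prod.neutral simp: hilbert_1 in_prime_factors_imp_prime)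
next
  case (add q A)
  then have q: "prime (int q)" by simp
  have "prod_mset A \<noteq> 0" using add.prems by (auto simp: prod_mset_zero_iff)
  then have "hilbert m p (int (q * prod_mset A)) = hilbert m p (int q) * hilbert m p (int (prod_mset A))"
    if "p \<in> prime_factors m" for p
    using hilbert_mult[OF in_prime_factors_imp_prime[OF that], of "int q" "int (prod_mset A)"] q
    by (metis not_prime_0 of_nat_eq_0_iff of_nat_mult)
  then have "(\<Prod>p\<in>prime_factors m. hilbert m p (int (prod_mset (add_mset q A))))
     = (\<Prod>p\<in>prime_factors m. hilbert m p (int q)) * (\<Prod>p\<in>prime_factors m. hilbert m p (int (prod_mset A)))"
    by (simp add: prod.distrib [symmetric] cong: prod.cong)
  then show ?case using add prod_hilbert_prime[OF q] by simp
qed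

lemma prod_hilbert:
  assumes "z > 0"
  shows "(\<Prod>p\<in>prime_factors m. hilbert m p z)
    = (\<Prod>q\<in>#prime_factorization (nat z). if int q dvd m then 1 else kronecker_at_prime m q)"
  using prod_hilbert_prod_mset[of "prime_factorization (nat z)"] assms
  by (simp add: in_prime_factors_imp_prime)

text \<open>The value at \<open>-1\<close> is the sign of the prime discriminant at
  \<open>p\<close>; the product is the contribution of the real place.\<close>

lemma prod_local_char_minus_1: "(\<Prod>p\<in>prime_factors m. local_char m p (-1)) = (if m < 0 then -1 else 1)"
proof -
  have "local_char m p (-1) = sgn (prime_disc m p)" if "p \<in> prime_factors m" for p
  proof -
    have p: "prime p" using that by (rule in_prime_factors_imp_prime)
    then show ?thesis using odd_prime_gt_2[OF p]
      by (cases "p = 2") (auto simp: local_char_def prime_disc_def Legendre_minus_1)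
  qed
  then have "(\<Prod>p\<in>prime_factors m. local_char m p (-1)) = (\<Prod>p\<in>prime_factors m. sgn (prime_disc m p))"
    by (rule prod.cong[OF refl])
  also have "\<dots> = sgn m" using prod_prime_disc by (metis sgn_prod_int)
  finally show ?thesis using nonzero by auto
qed

text \<open>For \<open>\<bar>r\<bar>\<close> this is the product formula, and the sign of
  \<open>r\<close> is treated by the value at \<open>-1\<close>. The argument \<open>r = 0\<close>
  is coprime to \<open>m\<close> only if \<open>m\<close> is a unit, where both sides are 1.\<close>

lemma kronecker_eq_prod_local_char:
  assumes "coprime r m"
  shows "kronecker m r = (\<Prod>p\<in>prime_factors m. local_char m p r)"
proof (cases "r = 0")
  case True
  then have "\<bar>m\<bar> = 1" using assms by simp
  then have "prime_factorization m = {#}" by (simp add: prime_factorization_unit)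
  then show ?thesis using True \<open>\<bar>m\<bar> = 1\<close> by (simp add: kronecker_def)
next
  case False
  have nd: "\<not> p dvd r" "prime p" if "p \<in> prime_factors m" for p
    using in_prime_factors_imp_prime[OF that] in_prime_factors_imp_dvd[OF that]
      coprime_common_divisor[OF assms, of p] not_prime_unit[of p] by auto
  have "(\<Prod>p\<in>prime_factors m. local_char m p r) =
      (\<Prod>p\<in>prime_factors m. (if r < 0 then local_char m p (-1) else 1) * hilbert m p \<bar>r\<bar>)"
  proof (rule prod.cong[OF refl])
    fix p assume "p \<in> prime_factors m"
    note p = nd[OF this]
    have "hilbert m p \<bar>r\<bar> = local_char m p \<bar>r\<bar>" using p by (intro hilbert_unit) simp
    moreover have "local_char m p r = local_char m p (-1) * local_char m p (-r)"
      using local_char_mult[of p "-1" "-r" m] p by auto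
    ultimately show "local_char m p r = (if r < 0 then local_char m p (-1) else 1) * hilbert m p \<bar>r\<bar>" by auto
  qed
  also have "\<dots> = (if r < 0 \<and> m < 0 then -1 else 1) * (\<Prod>p\<in>prime_factors m. hilbert m p \<bar>r\<bar>)"
  proof (cases "r < 0")
    case True
    then show ?thesis unfolding prod.distrib using prod_local_char_minus_1 by simp
  qed simp
  also have "(\<Prod>p\<in>prime_factors m. hilbert m p \<bar>r\<bar>) = (\<Prod>q\<in>#prime_factorization (nat \<bar>r\<bar>). kronecker_at_prime m q)"
  proof -
    have "\<not> int q dvd m" if "q \<in># prime_factorization (nat \<bar>r\<bar>)" for q
    proof -
      have "prime q" "q dvd nat \<bar>r\<bar>" using that by (auto intro: in_prime_factors_imp_prime in_prime_factors_imp_dvd)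
      then have "prime (int q)" "int q dvd r" by simp_all
      then show ?thesis using coprime_common_divisor[OF assms, of "int q"] not_prime_unit[of "int q"] by blast
    qed
    then show ?thesis using prod_hilbert[of "\<bar>r\<bar>"] False by (simp cong: image_mset_cong)
  qed
  finally show ?thesis using False by (simp add: kronecker_def)
qed

end

section \<open>Norms and their local symbols\<close>

lemma odd_square_form:
  assumes "odd (x::int)"
  obtains w where "x\<^sup>2 = 8 * w + 1"
proof -
  obtain y where y: "x = 2 * y + 1" using assms by (elim oddE)
  have "even (y * (y + 1))" by simp
  then obtain w where "y * (y + 1) = 2 * w" by (elim evenE)
  then have "x\<^sup>2 = 8 * w + 1" by (simp add: y power2_eq_square algebra_simps)
  then show ?thesis using that by blast
qed

lemma square_form:
  obtains w where "(x::int)\<^sup>2 = 8 * w \<or> x\<^sup>2 = 8 * w + 1 \<or> x\<^sup>2 = 8 * w + 4"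
proof (cases "odd x")
  case True
  then show ?thesis using odd_square_form that by blast
next
  case False
  then obtain y where y: "x = 2 * y" by auto
  show ?thesis
  proof (cases "odd y")
    case True
    then obtain w where "y\<^sup>2 = 8 * w + 1" by (rule odd_square_form)
    then show ?thesis using that[of "4 * w"] y by (simp add: power2_eq_square)
  next
    case False
    then obtain w where "y = 2 * w" by auto
    then show ?thesis using that[of "2 * w\<^sup>2"] y by (simp add: power2_eq_square)
  qed
qed

lemma square_diff_mod_4: "((x::int)\<^sup>2 - 4 * z) mod 4 = 0 \<or> (x\<^sup>2 - 4 * z) mod 4 = 1"
proof (cases "even x")
  case True
  then obtain y where "x = 2 * y" by auto
  then have "x\<^sup>2 - 4 * z = 4 * (y\<^sup>2 - z)" by (simp add: power2_eq_square)
  then show ?thesis by simp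
next
  case False
  then obtain y where "x = 2 * y + 1" by (elim oddE)
  then have "x\<^sup>2 - 4 * z = 4 * (y\<^sup>2 + y - z) + 1" by (simp add: power2_eq_square algebra_simps)
  then show ?thesis by (simp only: mod_mult_self4) simp
qed

text \<open>The finite check behind the case \<open>m = 8 M'\<close> of \<open>hilbert_at_2\<close>:
  \<open>d\<close> is \<open>M'\<close> mod 8, \<open>c\<close> is the residue of twice a square,
  \<open>z\<close> is the residue of the odd part, and \<open>ev\<close> the parity that determines
  the sign.\<close>

lemma sign_table_mod_8:
  fixes c d :: int
  assumes "c = 0 \<or> c = 2" "d = 1 \<or> d = 3 \<or> d = 5 \<or> d = 7" "z = (if ev then (c - d) mod 8 else (c + 3 * d) mod 8)"
  shows "(if d mod 4 = 1
          then (if z = 1 \<or> z = 7 then 1 else -1) * (if d = 1 \<or> d = 7 then 1 else -1)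
          else (if z = 1 \<or> z = 3 then 1 else -1) * (if (-d) mod 8 = 1 \<or> (-d) mod 8 = 7 then 1 else -1)) = (if ev then 1 else - 1 :: int)"
  using assms(1,2) unfolding assms(3) by (cases ev; elim disjE; hypsubst; simp)

context fund_disc
begin

text \<open>For odd \<open>p\<close>, \<open>4 z\<close> is the square of \<open>X\<close> modulo
  \<open>p\<close>. At 2 one divides by 4 and runs through residues mod 8, where the condition on
  \<open>n\<close> leaves only 0, 1, 4, 5 for \<open>n * Y^2\<close>. The factor \<open>n\<close> is
  there for the forms of discriminant \<open>m n\<close> in the definition of the character;
  \<open>n = 1\<close> gives ordinary norms.\<close>

lemma local_char_norm:
  assumes "prime p" "p dvd m" "\<not> p dvd z" "4 * z = X\<^sup>2 - m * n * Y\<^sup>2" "n mod 4 = 0 \<or> n mod 4 = 1"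
  shows "local_char m p z = 1"
proof (cases "p = 2")
  case False
  have "\<not> p dvd 4 * z" using prime_dvd_4_mult[OF assms(1) False, of z] assms(3) by simp
  moreover have "[4 * z = X\<^sup>2] (mod p)" using assms by (simp add: cong_iff_dvd_diff)
  ultimately have X: "\<not> p dvd X" by (metis cong_dvd_iff dvd_power pos2 dvd_trans)
  have "Legendre (4 * z) p = Legendre 4 p * Legendre z p" by (rule Legendre_mult[OF assms(1) False])
  moreover have "Legendre 4 p = 1"
    using Legendre_square[of p 2] assms(1) False prime_2_dvd_iff[of p] by simp
  moreover have "Legendre (4 * z) p = 1"
    using Legendre_cong[OF \<open>[4 * z = X\<^sup>2] (mod p)\<close>] Legendre_square[OF X assms(1)] by simp
  ultimately show ?thesis using False by (simp add: local_char_def)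
next
  case True
  define M where "M = m div 4"
  have m: "m = 4 * M"
    using assms(2) True unfolding M_def by (auto elim!: even_cases)
  have "X\<^sup>2 = 4 * (z + M * n * Y\<^sup>2)" using assms(4) m by (simp add: algebra_simps)
  then have "even (X\<^sup>2)" by presburger
  then obtain X' where X: "X = 2 * X'" by auto
  have z: "z = X'\<^sup>2 - M * n * Y\<^sup>2" using assms(4) by (simp add: X m power2_eq_square)
  obtain x y where x: "X'\<^sup>2 mod 8 = x" and y: "Y\<^sup>2 mod 8 = y" by blast
  obtain wx where "X'\<^sup>2 = 8 * wx \<or> X'\<^sup>2 = 8 * wx + 1 \<or> X'\<^sup>2 = 8 * wx + 4" by (rule square_form)
  then have x': "x = 0 \<or> x = 1 \<or> x = 4" using x by auto
  obtain wy where "Y\<^sup>2 = 8 * wy \<or> Y\<^sup>2 = 8 * wy + 1 \<or> Y\<^sup>2 = 8 * wy + 4" by (rule square_form)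
  then have y': "y = 0 \<or> y = 1 \<or> y = 4" using y by auto
  obtain N where N: "n mod 8 = N" by blast
  have N': "N = 0 \<or> N = 1 \<or> N = 4 \<or> N = 5"
  proof -
    have "0 \<le> N" "N < 8" using N by auto
    then have "N = 0 \<or> N = 1 \<or> N = 2 \<or> N = 3 \<or> N = 4 \<or> N = 5 \<or> N = 6 \<or> N = 7" by linarith
    moreover have "N mod 4 = 0 \<or> N mod 4 = 1" using assms(5) mod_mod_cancel[of 4 8 n] N by simp
    ultimately show ?thesis by (elim disjE) simp_all
  qed
  obtain t where t: "(n * Y\<^sup>2) mod 8 = t" by blast
  have "t = (N * y) mod 8" using t N y by (metis mod_mult_eq)
  then have t': "t = 0 \<or> t = 1 \<or> t = 4 \<or> t = 5" using N' y' by (elim disjE) simp_all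
  obtain K where K: "M mod 8 = K" by blast
  have "[X'\<^sup>2 - M * (n * Y\<^sup>2) = x - K * t] (mod 8)"
    unfolding x [symmetric] K [symmetric] t [symmetric] by (intro cong_diff cong_mult) (simp_all add: cong_def)
  then have zm: "z mod 8 = (x - K * t) mod 8" by (simp add: z cong_def mult.assoc)
  have zo: "(x - K * t) mod 8 \<noteq> 0" "(x - K * t) mod 8 \<noteq> 2" "(x - K * t) mod 8 \<noteq> 4" "(x - K * t) mod 8 \<noteq> 6"
    using assms(3) True unfolding zm [symmetric] by presburger+
  have res3: "z mod 8 = 1 \<or> z mod 8 = 5" if "K = 3"
    using zo x' t' unfolding zm that by (elim disjE) simp_all
  have res7: "z mod 8 = 1 \<or> z mod 8 = 5" if "K = 7"
    using zo x' t' unfolding zm that by (elim disjE) simp_all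
  have res2: "z mod 8 = 1 \<or> z mod 8 = 7" if "K = 2"
    using zo x' t' unfolding zm that by (elim disjE) simp_all
  have res6: "z mod 8 = 1 \<or> z mod 8 = 3" if "K = 6"
    using zo x' t' unfolding zm that by (elim disjE) simp_all
  have "even m" using assms(2) True by simp
  then show ?thesis
  proof (cases rule: even_cases)
    case (1 M')
    then have "M' = M" by (simp add: m)
    then have "z mod 8 = 1 \<or> z mod 8 = 5" using res3 res7 1 K by blast
    then have "z mod 4 = 1" by presburger
    then show ?thesis using True 1 by (simp add: local_char_def)
  next
    case (2 M')
    then have "M = 2 * M'" by (simp add: m)
    show ?thesis
    proof (cases "M' mod 4 = 1")
      case t: True
      then have "K = 2" using K \<open>M = 2 * M'\<close> by presburger
      then show ?thesis using res2 t 2 True by (simp add: local_char_def)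
    next
      case False
      then have "K = 6" using K \<open>M = 2 * M'\<close> 2(2) by presburger
      then show ?thesis using res6 False 2 True by (simp add: local_char_def)
    qed
  qed
qed

text \<open>
  The shapes of \<open>z\<close> below are those taken by \<open>- P * e\<close> in \<open>conic_nondegenerate\<close>; for \<open>d\<close> a
  square and for \<open>k = 0\<close> they are norms from the quadratic order of discriminant \<open>m\<close>.
\<close>

lemma hilbert_at_odd_prime:
  assumes "prime p" "p \<noteq> 2" "p dvd m" "4 * z = p\<^sup>2 * w - m * d" "\<not> p dvd d"
  shows "hilbert m p z = Legendre d p" "p dvd z" "\<not> p\<^sup>2 dvd z"
proof -
  obtain m1 where m1: "m = p * m1" using assms(3) by auto
  note nm1 = odd_cofactor[OF assms(1,2) m1]
  have p0: "p \<noteq> 0" using assms(1) by auto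
  have "p dvd 4 * z" using assms(3,4) by (simp add: power2_eq_square)
  then show pz: "p dvd z" using prime_dvd_4_mult assms(1,2) by blast
  then obtain z1 where z1: "z = p * z1" by auto
  have "p * (4 * z1) = p * (p * w - m1 * d)" using assms(4) z1 m1 by (simp add: power2_eq_square algebra_simps)
  then have e: "4 * z1 = p * w - m1 * d" using p0 by simp
  have "\<not> p dvd m1 * d" using nm1 assms(5) assms(1) by (simp add: prime_dvd_mult_iff)
  then have "\<not> p dvd 4 * z1" using e by (metis dvd_diff_right_iff dvd_triv_left dvd_minus_iff)
  then have nz1: "\<not> p dvd z1" by (metis dvd_mult)
  then show "\<not> p\<^sup>2 dvd z" using z1 p0 by (simp add: power2_eq_square)
  have 4: "Legendre 4 p = 1" using Legendre_square[of p 2] assms(1,2) prime_2_dvd_iff[of p] by simp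
  have "[4 * z1 = - m1 * d] (mod p)" using e by (simp add: cong_iff_dvd_diff)
  then have "Legendre z1 p = Legendre (- m1) p * Legendre d p"
    using Legendre_cong[of "4 * z1" "- m1 * d" p] Legendre_mult[OF assms(1,2), of 4 z1] Legendre_mult[OF assms(1,2), of "- m1" d] 4
    by simp
  moreover have "kron_at (m div prime_disc m p) p = Legendre (- m1) p"
    using cofactor_odd[OF assms(1,2) m1] odd_prime_gt_2[OF assms(1,2)] Legendre_mult[OF assms(1,2), of "-1" m1]
      Legendre_minus_1[OF assms(1,2)] by (auto simp: kron_at_odd)
  moreover have "Legendre (- m1) p * Legendre (- m1) p = 1" using Legendre_abs[OF assms(1), of "- m1"] nm1 by auto
  ultimately show "hilbert m p z = Legendre d p"
    using hilbert_uniformizer[OF assms(1) nz1] assms(2) by (simp add: z1 local_char_def mult_ac)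
qed

lemma hilbert_at_2:
  assumes "m = 4 * M" "z = W\<^sup>2 - M * S\<^sup>2 + 4 * (M * k)" "odd S" "even (W + M)"
  shows "hilbert m 2 z = (if even k then 1 else - 1)" "2 dvd z" "\<not> 4 dvd z"
proof -
  obtain b where b: "S\<^sup>2 = 8 * b + 1" using assms(3) by (rule odd_square_form)
  obtain j where j: "k = 2 * j + (if even k then 0 else 1)" by (metis add.right_neutral evenE oddE)
  have "even m" using assms(1) by simp
  then have "hilbert m 2 z = (if even k then 1 else - 1) \<and> 2 dvd z \<and> \<not> 4 dvd z"
  proof (cases rule: even_cases)
    case (1 M')
    then have M: "odd M" "M mod 8 = 3 \<or> M mod 8 = 7" using assms(1) by simp_all
    then obtain a where a: "W\<^sup>2 = 8 * a + 1" using assms(4) odd_square_form by auto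
    define q where "q = a - M * b + M * j"
    define i where "i = M div 8"
    obtain f where f: "M = 8 * i + 2 * f + 1" "f = 1 \<or> f = 3"
    proof
      show "M = 8 * i + 2 * (M mod 8 div 2) + 1" "M mod 8 div 2 = 1 \<or> M mod 8 div 2 = 3"
        using M(2) mult_div_mod_eq[of 8 M] unfolding i_def by (elim disjE; simp)+
    qed
    \<comment> \<open>\<open>z1\<close> is \<open>z / 2\<close> with multiples of 4 split off. As
      \<open>M = 8 i + 2 f + 1\<close>, only \<open>f\<close> and the parity of \<open>k\<close>
      decide \<open>z1\<close> mod 4.\<close>
    define z1 where "z1 = (if even k then 4 * (q - i) + (- f) else 4 * (q + 3 * i) + (2 + 3 * f))"
    have "z = 8 * q + 1 - M + (if even k then 0 else 4 * M)"
      unfolding assms(2) a b q_def by (subst j) (simp add: algebra_simps)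
    then have z1: "z = 2 * z1" using f(1) by (simp add: z1_def)
    have odd: "odd z1" using f(2) by (auto simp: z1_def)
    have m4: "z1 mod 4 = (if even k then (- f) mod 4 else (2 + 3 * f) mod 4)"
      unfolding z1_def by (simp only: mod_mult_self4 split: if_split) simp
    have "M mod 8 = (2 * f + 1) mod 8" unfolding f(1) add.assoc by (rule mod_mult_self4)
    then have "(- M) mod 8 = (- (2 * f + 1)) mod 8" by (rule mod_minus_cong)
    moreover have "hilbert m 2 z = local_char m 2 z1 * kronecker_at_prime (- M) 2"
      using hilbert_uniformizer[of 2 z1] z1 odd cofactor_4[OF assms(1) M(1)] by simp
    ultimately have "hilbert m 2 z = (if even k then 1 else - 1)"
      using f(2) m4 M(1) assms(1) by (elim disjE) (simp_all add: local_char_def kron_at_2)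
    then show ?thesis using z1 odd by (auto elim: oddE)
  next
    case (2 M')
    then have M: "M = 2 * M'" using assms(1) by simp
    then obtain W' where W': "W = 2 * W'" using assms(4) by auto
    obtain a c where a: "2 * W'\<^sup>2 = 8 * a + c" "c = 0 \<or> c = 2"
    proof (cases "odd W'")
      case True
      then obtain w where "W'\<^sup>2 = 8 * w + 1" by (rule odd_square_form)
      then show ?thesis using that[of "2 * w" 2] by simp
    next
      case False
      then obtain V where "W' = 2 * V" by auto
      then show ?thesis using that[of "V\<^sup>2" 0] by (simp add: power2_eq_square)
    qed
    define q where "q = a - M' * b + M' * j"
    define z1 where "z1 = 2 * W'\<^sup>2 - M' * S\<^sup>2 + 4 * (M' * k)"
    have z1: "z = 2 * z1" unfolding assms(2) z1_def M W' by (simp add: power2_eq_square)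
    define i where "i = M' div 8"
    define d where "d = M' mod 8"
    have d: "M' = 8 * i + d" "d = 1 \<or> d = 3 \<or> d = 5 \<or> d = 7"
      using odd_mod_8[OF 2(2)] by (simp_all add: i_def d_def)
    have d4: "M' mod 4 = d mod 4" "(- M') mod 8 = (- d) mod 8"
      by (simp_all add: d_def mod_mod_cancel mod_minus_eq)
    \<comment> \<open>Modulo 8 only \<open>c\<close>, \<open>d\<close> and the parity of
      \<open>k\<close> remain, the entries of \<open>sign_table_mod_8\<close>.\<close>
    have z1q: "z1 = (if even k then 8 * (q - i) + (c - d) else 8 * (q + 3 * i) + (c + 3 * d))"
      unfolding z1_def a(1) b q_def by (subst j) (simp add: d(1) algebra_simps)
    have m8: "z1 mod 8 = (if even k then (c - d) mod 8 else (c + 3 * d) mod 8)"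
      unfolding z1q by (simp only: mod_mult_self4 split: if_split) simp
    have "odd d" "even c" using a(2) d(2) by auto
    then have odd: "odd z1" unfolding z1q by simp
    have h: "hilbert m 2 z = local_char m 2 z1 * kronecker_at_prime (if M' mod 4 = 1 then M' else - M') 2"
      using hilbert_uniformizer[of 2 z1] z1 odd cofactor_8[OF 2] by simp
    have "hilbert m 2 z = (if even k then 1 else - 1)"
    proof -
      have A: "local_char m 2 z1 = (if d mod 4 = 1 then (if z1 mod 8 = 1 \<or> z1 mod 8 = 7 then 1 else -1)
          else (if z1 mod 8 = 1 \<or> z1 mod 8 = 3 then 1 else -1))"
        using 2 d4 by (simp add: local_char_def)
      have B: "kronecker_at_prime (if M' mod 4 = 1 then M' else - M') 2
         = (if d mod 4 = 1 then (if d = 1 \<or> d = 7 then 1 else -1) else (if (-d) mod 8 = 1 \<or> (-d) mod 8 = 7 then 1 else -1))"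
      proof -
        have "even M' = False" "even (- M') = False" "M' mod 8 = d" using 2 by (simp_all add: d_def)
        then show ?thesis
          by (cases "M' mod 4 = 1") (simp_all only: kron_at_2 d4(1) [symmetric] d4(2) if_True if_False simp_thms)
      qed
      have "hilbert m 2 z = (if d mod 4 = 1
          then (if z1 mod 8 = 1 \<or> z1 mod 8 = 7 then 1 else -1) * (if d = 1 \<or> d = 7 then 1 else -1)
          else (if z1 mod 8 = 1 \<or> z1 mod 8 = 3 then 1 else -1) * (if (-d) mod 8 = 1 \<or> (-d) mod 8 = 7 then 1 else -1))"
        unfolding h A B by (cases "d mod 4 = 1") (simp_all only: if_True if_False simp_thms)
      also have "\<dots> = (if even k then 1 else - 1)"
        by (rule sign_table_mod_8[OF a(2) d(2) m8])
      finally show ?thesis .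
    qed
    then show ?thesis using z1 odd by (auto elim: oddE)
  qed
  then show "hilbert m 2 z = (if even k then 1 else - 1)" "2 dvd z" "\<not> 4 dvd z" by auto
qed

text \<open>Factors \<open>p^2\<close> are squares for the symbol, and dividing them out shrinks
  \<open>\<bar>z\<bar>\<close>. The descent ends either at a \<open>z\<close> prime to
  \<open>p\<close> or at a \<open>Y\<close> prime to \<open>p\<close>, where \<open>p\<close>
  divides \<open>z\<close> exactly once.\<close>

lemma hilbert_norm:
  assumes "prime p" "p dvd m" "z \<noteq> 0" "4 * z = X\<^sup>2 - m * Y\<^sup>2"
  shows "hilbert m p z = 1"
  using assms(3,4)
proof (induction "nat \<bar>z\<bar>" arbitrary: z X Y rule: less_induct)
  case less
  have p2: "p \<ge> 2" using assms(1) prime_ge_2_int by blast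
  have descent: "hilbert m p z = 1" if "z = p\<^sup>2 * z'" "4 * z' = X'\<^sup>2 - m * Y'\<^sup>2" for z' X' Y'
  proof -
    have z': "z' \<noteq> 0" using that less.prems by auto
    have "1 * \<bar>z'\<bar> < (p * p) * \<bar>z'\<bar>" using p2 z' by (intro mult_strict_right_mono) (auto intro: less_1_mult)
    then have "nat \<bar>z'\<bar> < nat \<bar>z\<bar>" using that p2 by (simp add: abs_mult power2_eq_square)
    from less.hyps[OF this z' that(2)] show ?thesis
      using that(1) hilbert_sq_mult[OF assms(1,2), of p z'] z' p2 by (simp add: power2_eq_square)
  qed
  show ?case
  proof (cases "p dvd z")
    case False
    then show ?thesis using local_char_norm[of p z X 1 Y] less.prems assms by (simp add: hilbert_unit)
  next
    case True
    show ?thesis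
    proof (cases "p = 2")
      case False
      obtain m1 where m1: "m = p * m1" using assms(2) by auto
      have "p dvd X\<^sup>2 - m * Y\<^sup>2" using True less.prems(2) by (metis dvd_mult)
      then have "p dvd X\<^sup>2" using assms(2) by (metis dvd_diff_left_iff dvd_mult2)
      then obtain X' where X': "X = p * X'" using prime_dvd_power[OF assms(1)] by blast
      show ?thesis
      proof (cases "p dvd Y")
        case True
        then obtain Y' where Y': "Y = p * Y'" by auto
        have e: "4 * z = p\<^sup>2 * (X'\<^sup>2 - m * Y'\<^sup>2)" using less.prems(2) X' Y' by (simp add: power2_eq_square algebra_simps)
        moreover have "coprime (p\<^sup>2) 4"
          using prime_imp_coprime[OF assms(1), of 4] prime_dvd_4_mult[OF assms(1) False, of 1] assms(1) by auto
        ultimately obtain z' where z': "z = p\<^sup>2 * z'" by (metis coprime_dvd_mult_right_iff dvdE dvd_triv_left)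
        then have "4 * z' = X'\<^sup>2 - m * Y'\<^sup>2" using e p2 by (simp add: power2_eq_square)
        then show ?thesis using descent z' by blast
      next
        case nY: False
        then have "\<not> p dvd Y\<^sup>2" using prime_dvd_power[OF assms(1)] by blast
        moreover have "4 * z = p\<^sup>2 * X'\<^sup>2 - m * Y\<^sup>2" using less.prems(2) X' by (simp add: power_mult_distrib)
        ultimately have "hilbert m p z = Legendre (Y\<^sup>2) p"
          using hilbert_at_odd_prime(1)[OF assms(1) False assms(2)] by blast
        then show ?thesis using Legendre_square[OF nY assms(1)] by simp
      qed
    next
      case p: True
      define M where "M = m div 4"
      have m: "m = 4 * M"
        using assms(2) p unfolding M_def by (auto elim!: even_cases)
      have "X\<^sup>2 = 4 * (z + M * Y\<^sup>2)" using less.prems(2) m by (simp add: algebra_simps)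
      then have "even (X\<^sup>2)" by presburger
      then obtain W where X: "X = 2 * W" by auto
      have z: "z = W\<^sup>2 - M * Y\<^sup>2" using less.prems(2) by (simp add: X m power2_eq_square)
      have ev: "even (W + M * Y)" using True z p by (simp add: power2_eq_square)
      show ?thesis
      proof (cases "odd Y")
        case True
        then show ?thesis using hilbert_at_2(1)[of M z W Y 0] m z ev p by simp
      next
        case False
        then have "even W" using ev by simp
        then obtain W' Y' where "W = 2 * W'" "Y = 2 * Y'" using False by (auto elim!: evenE)
        then have "z = p\<^sup>2 * (W'\<^sup>2 - M * Y'\<^sup>2)" using z p by (simp add: power2_eq_square algebra_simps)
        moreover have "4 * (W'\<^sup>2 - M * Y'\<^sup>2) = (2 * W')\<^sup>2 - m * Y'\<^sup>2" by (simp add: m power2_eq_square algebra_simps)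
        ultimately show ?thesis using descent by blast
      qed
    qed
  qed
qed

end

section \<open>Conic sums at primes dividing the discriminant\<close>

lemma sum_ramanujan_line:
  assumes "prime p" "\<not> p dvd T" "q > 0"
  shows "(\<Sum>z=0..<p. ramanujan_sum (q * p) (A + q * (z * T))) = 0"
proof -
  have p: "p > 0" using assms(1) prime_gt_0_int by blast
  \<comment> \<open>For each unit \<open>d\<close>, \<open>z\<close> runs through a complete sum of
    a nontrivial character modulo \<open>p\<close>.\<close>
  have "(\<Sum>z=0..<p. echar (q * p) (d * (A + q * (z * T)))) = 0" if "coprime d (q * p)" for d
  proof -
    have nd: "\<not> p dvd d" using that coprime_common_divisor[of d "q * p" p] not_prime_unit[of p] assms(1) by auto
    have "echar (q * p) (d * (A + q * (z * T))) = echar (q * p) (d * A) * echar p (z * (d * T))" for z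
      using echar_mult_cancel[of q p "z * (d * T)"] assms(3) by (simp add: ring_distribs echar_add mult_ac)
    then show ?thesis using nd assms p by (simp add: sum_distrib_left [symmetric] sum_echar prime_dvd_mult_iff)
  qed
  then show ?thesis
    unfolding ramanujan_sum_def by (subst sum.swap) (simp cong: sum.cong_simp)
qed

lemma ramanujan_sum_prime: "prime p \<Longrightarrow> ramanujan_sum p z = (if p dvd z then of_int p else 0) - 1"
  using ramanujan_sum_prime_power[of p 1 z] by simp

lemma ramanujan_sum_prime_power_eq_0:
  assumes "prime p" "k \<ge> 2" "\<not> p dvd z"
  shows "ramanujan_sum (p ^ k) z = 0"
proof -
  have "p dvd p ^ k" "p dvd p ^ (k - 1)" using assms(2) by auto
  then have "\<not> p ^ k dvd z" "\<not> p ^ (k - 1) dvd z" using assms(3) dvd_trans by blast+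
  then show ?thesis using assms ramanujan_sum_prime_power[of p k z] by simp
qed

lemma ramanujan_sum_prime_power_mult:
  assumes "prime p" "k > 0"
  shows "ramanujan_sum (p ^ Suc k) (p * z) = of_int p * ramanujan_sum (p ^ k) z"
proof -
  obtain j where k: "k = Suc j" using assms(2) by (cases k) auto
  have "p \<noteq> 0" using assms(1) by auto
  then show ?thesis
    using ramanujan_sum_prime_power[OF assms(1), of "Suc k" "p * z"] ramanujan_sum_prime_power[OF assms(1), of k z]
    by (simp add: k right_diff_distrib)
qed

text \<open>The substitution \<open>x + w y\<close> for \<open>x\<close>. It serves to move the
  radical of the form modulo \<open>p\<close> onto the \<open>y\<close>-axis.\<close>

lemma conic_sum_shear:
  assumes "c > 0"
  shows "conic_sum c e g h s t n = conic_sum c e (g + 2 * e * w) (h + g * w + e * w\<^sup>2) s (t + s * w) n"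
proof -
  have "(\<Sum>x=0..<c. ramanujan_sum c (conic_poly e g h s t n x y)) =
      (\<Sum>x=0..<c. ramanujan_sum c (conic_poly e (g + 2 * e * w) (h + g * w + e * w\<^sup>2) s (t + s * w) n x y))" for y
  proof -
    have "periodic_mod c (\<lambda>x. ramanujan_sum c (conic_poly e g h s t n x y))"
      using assms by (intro periodic_modI ramanujan_sum_cong conic_cong) auto
    from sum_residues_shift[OF assms this, of "w * y"] show ?thesis
      by (simp add: conic_poly_def power2_eq_square algebra_simps)
  qed
  then show ?thesis unfolding conic_sum_def by (subst (1 2) sum.swap) simp
qed

lemma conic_det_shear:
  "conic_det e (g + 2 * e * w) (h + g * w + e * w\<^sup>2) s (t + s * w) n = conic_det e g h s t n"
  by (simp add: conic_det_def power2_eq_square algebra_simps)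

lemma discriminant_shear: "(g + 2 * e * w)\<^sup>2 - 4 * e * (h + g * w + e * w\<^sup>2) = g\<^sup>2 - 4 * e * (h::int)"
  by (simp add: power2_eq_square algebra_simps)

lemma sum_residues_multiple_period:
  fixes f :: "int \<Rightarrow> complex"
  assumes "a > 0" "b > 0" "periodic_mod a f"
  shows "(\<Sum>x=0..<a * b. f x) = of_int b * (\<Sum>x=0..<a. f x)"
proof -
  have "f (i + a * j) = f i" for i j using periodic_modD[OF assms(3), of "i + a * j" i] by (simp add: cong_def)
  then show ?thesis using assms by (simp add: sum_residues_blocks sum_distrib_left)
qed

context fund_disc
begin

text \<open>For odd \<open>p\<close> no square of \<open>p\<close> divides \<open>m\<close>. For
  \<open>p = 2\<close> the bracket is 0 or 1 mod 4, whereas \<open>m / 4\<close> is 2 or 3 mod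
  4.\<close>

lemma discriminant_minimal:
  assumes "prime p"
  shows "m \<noteq> p\<^sup>2 * (x\<^sup>2 - 4 * z)"
proof
  assume mp: "m = p\<^sup>2 * (x\<^sup>2 - 4 * z)"
  show False
  proof (cases "p = 2")
    case False
    then show False using square_not_dvd[OF assms] mp by simp
  next
    case True
    then have m: "m = 4 * (x\<^sup>2 - 4 * z)" using mp by simp
    then have "even m" by simp
    then show False
    proof (cases rule: even_cases)
      case (1 M)
      have "M mod 4 = 3" using 1(3) mod_mod_cancel[of 4 8 M] by auto
      moreover have "M = x\<^sup>2 - 4 * z" using 1(1) m by simp
      ultimately show False using square_diff_mod_4[of x z] by simp
    next
      case (2 M)
      have "2 * M mod 4 = 2" using 2(2) by (elim oddE) simp
      moreover have "2 * M = x\<^sup>2 - 4 * z" using 2(1) m by simp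
      ultimately show False using square_diff_mod_4[of x z] by simp
    qed
  qed
qed

text \<open>In the descent \<open>h / p\<close> becomes the leading coefficient. That it is a unit
  again is what lets the induction continue.\<close>

lemma ramified_coeffs:
  assumes "m = g\<^sup>2 - 4 * e * h" "prime p" "p dvd g"
  shows "\<not> p\<^sup>2 dvd h"
proof
  assume "p\<^sup>2 dvd h"
  then obtain g' h' where "g = p * g'" "h = p\<^sup>2 * h'" using assms(3) by (elim dvdE)
  then have "m = p\<^sup>2 * (g'\<^sup>2 - 4 * (e * h'))" using assms(1) by (simp add: power2_eq_square algebra_simps)
  then show False using discriminant_minimal[OF assms(2)] by blast
qed

text \<open>Since \<open>4 e h = g^2 - m\<close>, the product \<open>e * h\<close> is a norm, so
  \<open>e\<close> and \<open>h\<close> have the same symbol.\<close>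

lemma hilbert_represented:
  assumes m: "m = g\<^sup>2 - 4 * e * h" and p: "prime p" "p dvd m" and nz: "e \<noteq> 0" "h \<noteq> 0" "z \<noteq> 0"
  shows "hilbert m p (z * h) = hilbert m p (z * e)"
proof -
  have "4 * (e * h) = g\<^sup>2 - m * 1\<^sup>2" using m by simp
  then have eh: "hilbert m p (e * h) = 1" using hilbert_norm[OF p, of "e * h" g 1] nz by simp
  have "hilbert m p (z * h) = hilbert m p (e * e * (z * h))"
    using hilbert_sq_mult[OF p, of e "z * h"] nz by simp
  also have "e * e * (z * h) = (z * e) * (e * h)" by simp
  also have "hilbert m p \<dots> = hilbert m p (z * e)"
    using hilbert_mult[OF p(1), of "z * e" "e * h"] eh nz by simp
  finally show ?thesis .
qed

text \<open>Modulo \<open>p\<close> only \<open>e x^2 + s x + n\<close> is left. Assumption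
  \<open>nd\<close> excludes a double root, in terms of the derivative so that it is correct at 2 as
  well. For odd \<open>p\<close> and \<open>D = s^2 - 4 e n\<close> there are
  \<open>1 + (D/p)\<close> roots, and \<open>4 (- P e) = (2 e t - g s)^2 - m D\<close> makes
  \<open>(D/p)\<close> the Hilbert symbol. At 2 the parity of \<open>e * n\<close> takes the place
  of \<open>(D/p)\<close>.\<close>

lemma conic_nondegenerate:
  assumes m: "m = g\<^sup>2 - 4 * e * h" and p: "prime p" "p dvd m" and pg: "p dvd g" and e: "\<not> p dvd e" and h: "p dvd h"
    and t: "p dvd t" and nd: "\<not> (\<exists>x. p dvd e * x\<^sup>2 + s * x + n \<and> p dvd 2 * e * x + s)"
  defines "P \<equiv> conic_det e g h s t n"
  shows "p dvd P" "\<not> p\<^sup>2 dvd P" "conic_sum p e g h s t n = of_int (p\<^sup>2 * hilbert m p (- P * e))"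
proof -
  have p0: "p > 0" using p(1) prime_gt_0_int by blast
  have "ramanujan_sum p (conic_poly e g h s t n x y) = ramanujan_sum p (e * x\<^sup>2 + s * x + n)" for x y
    by (rule ramanujan_sum_cong) (use p0 pg h t in \<open>simp_all add: conic_poly_def cong_iff_dvd_diff algebra_simps\<close>)
  then have cs: "conic_sum p e g h s t n = of_int p * (\<Sum>x=0..<p. ramanujan_sum p (e * x\<^sup>2 + s * x + n))"
    using p0 by (simp add: conic_sum_def sum_distrib_left)
  have "p dvd P \<and> \<not> p\<^sup>2 dvd P \<and> (\<Sum>x=0..<p. ramanujan_sum p (e * x\<^sup>2 + s * x + n)) = of_int (p * hilbert m p (- P * e))"
  proof (cases "p = 2")
    case False
    define D where "D = s\<^sup>2 - 4 * e * n"
    have "\<not> p dvd 2 * e" using p(1) e False prime_2_dvd_iff[of p] by (simp add: prime_dvd_mult_iff)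
    then have cop: "coprime (2 * e) p" using p(1) prime_imp_coprime coprime_commute by blast
    have disc: "4 * e * (e * x\<^sup>2 + s * x + n) = (2 * e * x + s)\<^sup>2 - D" for x
      by (simp add: D_def power2_eq_square algebra_simps)
    have root: "p dvd e * x\<^sup>2 + s * x + n \<longleftrightarrow> [(2 * e * x + s)\<^sup>2 = D] (mod p)" for x
    proof -
      have "p dvd e * x\<^sup>2 + s * x + n \<longleftrightarrow> p dvd 4 * (e * (e * x\<^sup>2 + s * x + n))"
        using prime_dvd_4_mult[OF p(1) False] e p(1) by (simp add: prime_dvd_mult_iff)
      then show ?thesis by (simp only: mult.assoc [symmetric] disc cong_iff_dvd_diff)
    qed
    have D: "\<not> p dvd D"
    proof
      assume D: "p dvd D"
      obtain i where "[2 * e * i = 1] (mod p)" using cong_solve_coprime_int[OF cop] by blast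
      then have "[2 * e * i * (- s) + s = 1 * (- s) + s] (mod p)" by (intro cong_add cong_mult) auto
      then have x: "p dvd 2 * e * (- (i * s)) + s" by (simp add: cong_0_iff mult_ac)
      then have "p dvd (2 * e * (- (i * s)) + s)\<^sup>2 - D" using D by (simp add: power2_eq_square)
      then show False using nd root x by (metis cong_iff_dvd_diff)
    qed
    have "4 * (- P * e) = (2 * e * t - g * s)\<^sup>2 - m * D"
      by (simp add: P_def conic_det_def m D_def power2_eq_square algebra_simps)
    moreover obtain w where w: "2 * e * t - g * s = p * w" using pg t by (metis dvd_def dvd_diff dvd_mult dvd_mult2)
    ultimately have "4 * (- P * e) = p\<^sup>2 * w\<^sup>2 - m * D" by (simp add: power_mult_distrib)
    note sp = hilbert_at_odd_prime[OF p(1) False p(2) this D]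
    have "p dvd P" using sp(2) e p(1) by (simp add: prime_dvd_mult_iff)
    moreover have "\<not> p\<^sup>2 dvd P" using sp(3) by (metis dvd_minus_iff dvd_mult2 mult_minus_left)
    moreover have "(\<Sum>x=0..<p. ramanujan_sum p (e * x\<^sup>2 + s * x + n)) = of_int (p * Legendre D p)"
    proof -
      let ?f = "\<lambda>y. if [y\<^sup>2 = D] (mod p) then of_int p else 0 :: complex"
      have per: "periodic_mod p ?f"
      proof (rule periodic_modI)
        fix x y assume "[x = y] (mod p)"
        then have "[x\<^sup>2 = y\<^sup>2] (mod p)" by (rule cong_pow)
        then show "?f x = ?f y" by (simp add: cong_def)
      qed
      have "(\<Sum>x=0..<p. ramanujan_sum p (e * x\<^sup>2 + s * x + n)) = (\<Sum>x=0..<p. ?f (2 * e * x + s)) - of_int p"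
        using p0 by (simp add: ramanujan_sum_prime[OF p(1)] root sum_subtractf)
      also have "(\<Sum>x=0..<p. ?f (2 * e * x + s)) = (\<Sum>x=0..<p. ?f x)"
        by (rule sum_residues_affine[OF p0 per cop])
      also have "\<dots> = of_int (int (card {y \<in> {0..<p}. [y\<^sup>2 = D] (mod p)})) * of_int p"
        by (subst sum.inter_filter [symmetric]) auto
      finally show ?thesis unfolding card_square_roots[OF p(1) False] by (simp add: algebra_simps)
    qed
    ultimately show ?thesis using sp(1) by simp
  next
    case True
    define M where "M = m div 4"
    have m4: "m = 4 * M"
      using p(2) True unfolding M_def by (auto elim!: even_cases)
    \<comment> \<open>If \<open>s\<close> were even, \<open>x = n\<close> would be a double root
      modulo 2, because \<open>n^2 + n\<close> is even.\<close>
    have so: "odd s"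
    proof
      assume "even s"
      then have "p dvd e * n\<^sup>2 + s * n + n \<and> p dvd 2 * e * n + s" using True e by simp
      then show False using nd by blast
    qed
    obtain g' where g': "g = 2 * g'" using pg True by auto
    have Mg: "M = g'\<^sup>2 - e * h" using m m4 g' by (simp add: power2_eq_square)
    have "- P * e = (e * t - g' * s)\<^sup>2 - M * s\<^sup>2 + 4 * (M * (e * n))"
      unfolding P_def conic_det_def m [symmetric] m4 by (simp add: Mg g' power2_eq_square algebra_simps)
    moreover have "even (e * t - g' * s + M)" using Mg t h True so by (simp add: power2_eq_square)
    ultimately have sp: "hilbert m 2 (- P * e) = (if even (e * n) then 1 else - 1)" "2 dvd - P * e" "\<not> 4 dvd - P * e"
      using hilbert_at_2[OF m4 _ so] by blast+
    have "2 dvd P" using sp(2) e True by simp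
    moreover have "\<not> 4 dvd P" using sp(3) by (metis dvd_mult2 dvd_minus_iff)
    moreover have "(\<Sum>x=0..<p. ramanujan_sum p (e * x\<^sup>2 + s * x + n)) = of_int (2 * (if even (e * n) then 1 else - 1))"
    proof -
      have "{0..<2} = {0, 1::int}" by auto
      moreover have "ramanujan_sum 2 z = (if even z then 1 else -1)" for z using ramanujan_sum_prime[of 2 z] by simp
      ultimately show ?thesis using so e True by simp
    qed
    ultimately show ?thesis using True sp(1) by simp
  qed
  then show "p dvd P" "\<not> p\<^sup>2 dvd P" "conic_sum p e g h s t n = of_int (p\<^sup>2 * hilbert m p (- P * e))"
    using cs by (auto simp: power2_eq_square)
qed

text \<open>As in Hensel's lemma, near a simple root the values move linearly with \<open>x\<close>,
  which gives cancellation. Away from roots the values are prime to \<open>p\<close>, and for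
  \<open>k \<ge> 2\<close> their Ramanujan sums vanish.\<close>

lemma conic_sum_nondegenerate_eq_0:
  assumes p: "prime p" and pg: "p dvd g" and h: "p dvd h" and t: "p dvd t" and k: "k \<ge> 2"
    and nd: "\<not> (\<exists>x. p dvd e * x\<^sup>2 + s * x + n \<and> p dvd 2 * e * x + s)"
  shows "conic_sum (p ^ k) e g h s t n = 0"
proof -
  have p0: "p > 0" using p prime_gt_0_int by blast
  define q where "q = p ^ (k - 1)"
  have pk: "p ^ k = q * p" using k by (simp add: q_def power_eq_if)
  have q: "q > 0" "p dvd q" using p0 k by (auto simp: q_def)
  have "(\<Sum>z=0..<p. ramanujan_sum (p ^ k) (conic_poly e g h s t n (i + q * z) y)) = 0" for i y
  proof (cases "p dvd e * i\<^sup>2 + s * i + n")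
    case True
    then have "\<not> p dvd 2 * e * i + s" using nd by blast
    then have T: "\<not> p dvd 2 * e * i + g * y + s" using pg by (metis dvd_add_right_iff dvd_mult2 add.assoc add.commute)
    have "[conic_poly e g h s t n (i + q * z) y = conic_poly e g h s t n i y + q * (z * (2 * e * i + g * y + s))] (mod q * p)" for z
    proof -
      have "conic_poly e g h s t n (i + q * z) y - (conic_poly e g h s t n i y + q * (z * (2 * e * i + g * y + s))) = (q * q) * (e * z * z)"
        by (simp add: conic_poly_def power2_eq_square algebra_simps)
      then show ?thesis using q by (simp add: cong_iff_dvd_diff mult_dvd_mono)
    qed
    then have "ramanujan_sum (q * p) (conic_poly e g h s t n (i + q * z) y) =
        ramanujan_sum (q * p) (conic_poly e g h s t n i y + q * (z * (2 * e * i + g * y + s)))" for z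
      using q p0 by (intro ramanujan_sum_cong) auto
    then show ?thesis unfolding pk using sum_ramanujan_line[OF p T q(1)] by simp
  next
    case False
    have "\<not> p dvd conic_poly e g h s t n (i + q * z) y" for z
    proof
      assume "p dvd conic_poly e g h s t n (i + q * z) y"
      moreover have "conic_poly e g h s t n (i + q * z) y - (e * i\<^sup>2 + s * i + n) =
          q * (z * (2 * e * i + e * q * z + s)) + g * ((i + q * z) * y) + h * y\<^sup>2 + t * y"
        by (simp add: conic_poly_def power2_eq_square algebra_simps)
      ultimately show False using False pg h t q(2) by (metis dvd_add dvd_diff_right_iff dvd_mult2)
    qed
    then show ?thesis using ramanujan_sum_prime_power_eq_0[OF p k] by simp
  qed
  note zero = this
  have "conic_sum (p ^ k) e g h s t n = (\<Sum>y=0..<p ^ k. \<Sum>x=0..<q * p. ramanujan_sum (p ^ k) (conic_poly e g h s t n x y))"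
    unfolding conic_sum_def by (subst sum.swap) (simp add: pk)
  also have "\<dots> = 0" unfolding sum_residues_blocks[OF q(1) p0] zero by simp
  finally show ?thesis .
qed

text \<open>The derivative in \<open>y\<close> is congruent to the unit \<open>t\<close> everywhere,
  so moving \<open>y\<close> by multiples of \<open>p ^ (k - 1)\<close> cancels, already for
  \<open>k = 1\<close> because \<open>p\<close> divides \<open>h\<close>.\<close>

lemma conic_sum_smooth_eq_0:
  assumes p: "prime p" and pg: "p dvd g" and h: "p dvd h" and t: "\<not> p dvd t" and k: "k > 0"
  shows "conic_sum (p ^ k) e g h s t n = 0"
proof -
  have p0: "p > 0" using p prime_gt_0_int by blast
  define q where "q = p ^ (k - 1)"
  have pk: "p ^ k = q * p" using k by (simp add: q_def power_eq_if)
  have q: "q > 0" using p0 by (auto simp: q_def)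
  have "(\<Sum>z=0..<p. ramanujan_sum (p ^ k) (conic_poly e g h s t n x (i + q * z))) = 0" for i x
  proof -
    have T: "\<not> p dvd g * x + 2 * h * i + t" using pg h t by (simp add: dvd_add_right_iff)
    have "[conic_poly e g h s t n x (i + q * z) = conic_poly e g h s t n x i + q * (z * (g * x + 2 * h * i + t))] (mod q * p)" for z
    proof -
      have "conic_poly e g h s t n x (i + q * z) - (conic_poly e g h s t n x i + q * (z * (g * x + 2 * h * i + t))) = (q * h) * (q * z * z)"
        by (simp add: conic_poly_def power2_eq_square algebra_simps)
      then show ?thesis using h by (simp add: cong_iff_dvd_diff mult_dvd_mono)
    qed
    then have "ramanujan_sum (q * p) (conic_poly e g h s t n x (i + q * z)) =
        ramanujan_sum (q * p) (conic_poly e g h s t n x i + q * (z * (g * x + 2 * h * i + t)))" for z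
      using q p0 by (intro ramanujan_sum_cong) auto
    then show ?thesis unfolding pk using sum_ramanujan_line[OF p T q] by simp
  qed
  note zero = this
  have "conic_sum (p ^ k) e g h s t n = (\<Sum>x=0..<p ^ k. \<Sum>y=0..<q * p. ramanujan_sum (p ^ k) (conic_poly e g h s t n x y))"
    unfolding conic_sum_def by (simp add: pk)
  also have "\<dots> = 0" unfolding sum_residues_blocks[OF q(1) p0] zero by simp
  finally show ?thesis .
qed

text \<open>
  Only \<open>x\<close> divisible by \<open>p\<close> contribute, and dividing the substituted polynomial by \<open>p\<close> leaves one
  of the same discriminant in which \<open>x\<close> and \<open>y\<close> have changed roles. This is the descent on \<open>k\<close>.
\<close>

lemma conic_sum_degenerate:
  assumes p: "prime p" and pg: "p dvd g" and e: "\<not> p dvd e" and h: "h = p * h'"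
    and s: "p dvd s" and t: "t = p * t'" and n: "n = p * n'"
  shows "conic_sum (p ^ Suc (Suc k)) e g h s t n = of_int (p\<^sup>2) * conic_sum (p ^ Suc k) h' g (p * e) t' s n'"
    and "conic_sum p e g h s t n = 0"
proof -
  have p0: "p > 0" using p prime_gt_0_int by blast
  let ?F = "conic_poly e g h s t n"
  let ?c = "p ^ Suc (Suc k)"
  let ?F' = "conic_poly (p * e) g h' s t' n'"
  have modp: "[?F x y = e * x\<^sup>2] (mod p)" for x y
    using pg h s t n by (simp add: conic_poly_def cong_iff_dvd_diff algebra_simps)
  have unit: "p dvd ?F x y \<longleftrightarrow> p dvd x" for x y
    using cong_dvd_iff[OF modp[of x y]] e p prime_dvd_power_iff[OF p, of 2 x] by (simp add: prime_dvd_mult_iff)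
  have sub: "?F (p * x) y = p * ?F' x y" for x y
    by (simp add: conic_poly_def h t n power2_eq_square algebra_simps)
  have row: "(\<Sum>y=0..<?c. ramanujan_sum ?c (?F (p * x) y)) = of_int (p\<^sup>2) * (\<Sum>y=0..<p ^ Suc k. ramanujan_sum (p ^ Suc k) (?F' x y))" for x
  proof -
    have "ramanujan_sum ?c (?F (p * x) y) = of_int p * ramanujan_sum (p ^ Suc k) (?F' x y)" for y
      unfolding sub by (rule ramanujan_sum_prime_power_mult[OF p]) simp
    then have "(\<Sum>y=0..<?c. ramanujan_sum ?c (?F (p * x) y)) =
        of_int p * (\<Sum>y=0..<p ^ Suc k * p. ramanujan_sum (p ^ Suc k) (?F' x y))"
      by (simp add: sum_distrib_left mult.commute)
    also have "(\<Sum>y=0..<p ^ Suc k * p. ramanujan_sum (p ^ Suc k) (?F' x y)) =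
        of_int p * (\<Sum>y=0..<p ^ Suc k. ramanujan_sum (p ^ Suc k) (?F' x y))"
      using p0 by (intro sum_residues_multiple_period periodic_modI ramanujan_sum_cong conic_cong) auto
    finally show ?thesis by (simp add: power2_eq_square)
  qed
  have "conic_sum ?c e g h s t n = (\<Sum>x=0..<p * p ^ Suc k. if p dvd x then \<Sum>y=0..<?c. ramanujan_sum ?c (?F x y) else 0)"
    unfolding conic_sum_def
  proof (rule sum.cong)
    fix x
    show "(\<Sum>y=0..<?c. ramanujan_sum ?c (?F x y)) = (if p dvd x then \<Sum>y=0..<?c. ramanujan_sum ?c (?F x y) else 0)"
      using ramanujan_sum_prime_power_eq_0[OF p, of "Suc (Suc k)"] unit by simp
  qed simp
  also have "\<dots> = (\<Sum>x=0..<p ^ Suc k. of_int (p\<^sup>2) * (\<Sum>y=0..<p ^ Suc k. ramanujan_sum (p ^ Suc k) (?F' x y)))"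
    using p0 row sum_residues_multiples[of p "p ^ Suc k" "\<lambda>x. \<Sum>y=0..<?c. ramanujan_sum ?c (?F x y)"] by simp
  also have "\<dots> = of_int (p\<^sup>2) * conic_sum (p ^ Suc k) (p * e) g h' s t' n'"
    by (simp only: conic_sum_def sum_distrib_left)
  finally show "conic_sum ?c e g h s t n = of_int (p\<^sup>2) * conic_sum (p ^ Suc k) h' g (p * e) t' s n'"
    by (simp only: conic_sum_swap[of _ "p * e"])
  \<comment> \<open>For modulus \<open>p\<close> the zeros are the \<open>p\<close> points with
    \<open>x = 0\<close>; their weight \<open>p\<close> exactly cancels the \<open>-1\<close>
    contributed by each of the \<open>p^2\<close> points.\<close>
  have "conic_sum p e g h s t n = (\<Sum>x=0..<p. of_int p * ((if p dvd x then of_int p else 0) - 1))"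
    unfolding conic_sum_def ramanujan_sum_prime[OF p] unit using p0 by simp
  also have "\<dots> = (\<Sum>x=0..<p. of_int p * (if x = 0 then of_int p else 0)) - of_int p * of_int p"
  proof -
    have "p dvd x \<longleftrightarrow> x = 0" if "x \<in> {0..<p}" for x using that by (auto dest: zdvd_imp_le simp: order_le_less)
    then show ?thesis using p0 by (simp add: right_diff_distrib sum_subtractf)
  qed
  also have "\<dots> = 0" using p0 by (simp add: sum_distrib_left [symmetric])
  finally show "conic_sum p e g h s t n = 0" .
qed

text \<open>The hypotheses on \<open>g\<close> and \<open>h\<close> place the radical modulo
  \<open>p\<close> on the \<open>y\<close>-axis. The three cases correspond to \<open>P\<close>
  prime to \<open>p\<close>, to \<open>p\<close> dividing \<open>P\<close> exactly once, and to a
  double root, where \<open>P = p P'\<close> and the new form \<open>[h', g, p e]\<close> satisfies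
  the same hypotheses.\<close>

lemma conic_sum_ramified_aux:
  assumes "m = g\<^sup>2 - 4 * e * h" "prime p" "p dvd m" "p dvd g" "\<not> p dvd e" "p dvd h"
  shows "conic_sum (p ^ Suc k) e g h s t n =
    (if p ^ Suc k dvd conic_det e g h s t n \<and> \<not> p ^ Suc (Suc k) dvd conic_det e g h s t n
     then of_int (p ^ (2 * Suc k) * hilbert m p (- conic_det e g h s t n * e)) else 0)"
  using assms
proof (induction k arbitrary: e g h s t n rule: less_induct)
  case (less k)
  note m = less.prems(1) and p = less.prems(2,3) and pg = less.prems(4) and e = less.prems(5) and h = less.prems(6)
  have p0: "p > 0" using p(1) prime_gt_0_int by blast
  define P where "P = conic_det e g h s t n"
  have Pm: "P = - m * n - (e * t\<^sup>2 - g * s * t + h * s\<^sup>2)" by (simp add: P_def conic_det_def m)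
  consider (smooth) "\<not> p dvd t"
    | (nondeg) "p dvd t" "\<not> (\<exists>x. p dvd e * x\<^sup>2 + s * x + n \<and> p dvd 2 * e * x + s)"
    | (deg) x0 where "p dvd t" "p dvd e * x0\<^sup>2 + s * x0 + n" "p dvd 2 * e * x0 + s"
    by blast
  then show ?case
  proof cases
    case smooth
    obtain m1 g1 h1 where "m = p * m1" "g = p * g1" "h = p * h1" using p(2) pg h by (elim dvdE)
    then have "P = p * (- m1 * n + g1 * s * t - h1 * s\<^sup>2) - e * t\<^sup>2"
      by (simp add: Pm algebra_simps)
    moreover have "\<not> p dvd e * t\<^sup>2"
      using smooth e p(1) by (simp add: prime_dvd_mult_iff prime_dvd_power_iff)
    ultimately have "\<not> p dvd P" by (metis dvd_diff_right_iff dvd_triv_left)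
    then have "\<not> p ^ Suc k dvd P" by (metis dvd_mult_left power_Suc)
    then show ?thesis using conic_sum_smooth_eq_0[OF p(1) pg h smooth, of "Suc k"] by (simp add: P_def del: power_Suc)
  next
    case nondeg
    note nd = conic_nondegenerate[OF m p pg e h nondeg, folded P_def]
    show ?thesis
    proof (cases k)
      case 0
      then show ?thesis using nd by (simp add: P_def [symmetric] power2_eq_square)
    next
      case (Suc j)
      have "p\<^sup>2 dvd p ^ Suc k" using Suc by (intro le_imp_power_dvd) auto
      then have "\<not> p ^ Suc k dvd P" using nd(2) dvd_trans by blast
      then show ?thesis
        using conic_sum_nondegenerate_eq_0[OF p(1) pg h nondeg(1) _ nondeg(2), of "Suc k"] Suc by (simp add: P_def)
    qed
  next
    case deg
    \<comment> \<open>Translate the double root to the origin; then \<open>p\<close> divides the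
      linear and constant coefficients.\<close>
    define s' where "s' = s + 2 * e * x0"
    obtain t' where t': "t + g * x0 = p * t'" using deg(1) pg by (meson dvdE dvd_add dvd_mult2)
    obtain n' where n': "n + e * x0\<^sup>2 + s * x0 = p * n'" using deg(2) by (metis add.commute add.left_commute dvdE)
    obtain h' where h': "h = p * h'" using h by auto
    have s': "p dvd s'" using deg(3) by (simp add: s'_def add.commute)
    have sh: "conic_sum c e g h s t n = conic_sum c e g h s' (p * t') (p * n')" if "c > 0" for c
      using conic_sum_shift[OF that, of e g h s t n x0] by (simp only: s'_def t' n')
    have Psh: "P = conic_det e g h s' (p * t') (p * n')"
      using conic_det_shift[of e g h s x0 t n] by (simp only: P_def s'_def t' n')
    define P' where "P' = conic_det h' g (p * e) t' s' n'"
    have PP: "P = p * P'"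
      unfolding Psh P'_def conic_det_def h' by (simp add: power2_eq_square algebra_simps)
    note dg = conic_sum_degenerate[OF p(1) pg e h' s' refl refl]
    show ?thesis
    proof (cases k)
      case 0
      \<comment> \<open>A double root forces \<open>p^2\<close> to divide \<open>P\<close>, so both
        sides vanish for modulus \<open>p\<close>.\<close>
      obtain s1 m1 where "s' = p * s1" "m = p * m1" using s' p(2) by (elim dvdE)
      then have "P = p\<^sup>2 * (- m1 * n' - (e * t'\<^sup>2 - g * s1 * t' + h * s1\<^sup>2))"
        unfolding Psh conic_det_def m [symmetric] by (simp add: power2_eq_square algebra_simps)
      then have "p\<^sup>2 dvd P" by simp
      then show ?thesis using 0 dg(2)[of t' n'] sh[of p] p0 by (simp add: P_def [symmetric] power2_eq_square)
    next
      case (Suc j)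
      have nh': "\<not> p dvd h'"
        using ramified_coeffs[OF m p(1) pg] h' p0 by (simp add: power2_eq_square)
      have m': "m = g\<^sup>2 - 4 * h' * (p * e)" using m h' by (simp add: algebra_simps)
      have cs: "conic_sum (p ^ Suc k) e g h s t n = of_int (p\<^sup>2) * conic_sum (p ^ Suc j) h' g (p * e) t' s' n'"
        using sh[of "p ^ Suc k"] p0 dg(1)[of j t' n'] by (simp add: Suc)
      have dv: "p ^ Suc i dvd P \<longleftrightarrow> p ^ i dvd P'" for i using p0 by (simp add: PP)
      \<comment> \<open>The sign survives the descent: \<open>p^2 (- P' h') = - P h\<close>, and
        \<open>h\<close> and \<open>e\<close> have equal symbols.\<close>
      have hil: "hilbert m p (- P' * h') = hilbert m p (- P * e)" if "P' \<noteq> 0"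
      proof -
        have nz: "e \<noteq> 0" "h' \<noteq> 0" "p \<noteq> 0" "h \<noteq> 0" "P \<noteq> 0" using e nh' p0 that PP h' by auto
        have "hilbert m p (- P' * h') = hilbert m p (p * p * (- P' * h'))"
          using hilbert_sq_mult[OF p, of p "- P' * h'"] nz that by simp
        also have "p * p * (- P' * h') = - P * h" by (simp add: PP h')
        also have "hilbert m p (- P * h) = hilbert m p (- P * e)"
          by (rule hilbert_represented[OF m p]) (use nz in auto)
        finally show ?thesis .
      qed
      have IH: "conic_sum (p ^ Suc j) h' g (p * e) t' s' n' =
          (if p ^ Suc j dvd P' \<and> \<not> p ^ Suc (Suc j) dvd P' then of_int (p ^ (2 * Suc j) * hilbert m p (- P' * h')) else 0)"
        unfolding P'_def by (rule less.IH) (use Suc m' p pg nh' in auto)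
      show ?thesis
      proof (cases "P' = 0")
        case True
        then show ?thesis unfolding cs IH P_def [symmetric] by (simp add: PP)
      next
        case False
        have "p\<^sup>2 * (p ^ (2 * k) * x) = p ^ (2 * Suc k) * x" for x by (simp add: power2_eq_square)
        then have "of_int (p\<^sup>2) * of_int (p ^ (2 * k) * x) = (of_int (p ^ (2 * Suc k) * x) :: complex)" for x
          by (metis of_int_mult)
        then show ?thesis unfolding cs[folded Suc] IH[folded Suc] P_def [symmetric] dv hil[OF False]
          by (simp only: if_distrib[of "\<lambda>x. of_int (p\<^sup>2) * x"] mult_zero_right)
      qed
    qed
  qed
qed

text \<open>Modulo \<open>p\<close> the form is \<open>e\<close> times the square of a linear form,
  and a shear turns that linear form into \<open>x\<close>. The shear is
  \<open>w = - g / (2 e)\<close> for odd \<open>p\<close> and \<open>w = h\<close> for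
  \<open>p = 2\<close>, where \<open>g\<close> is even and \<open>h + e h^2\<close> is even.\<close>

lemma conic_sum_ramified_unit:
  assumes m: "m = g\<^sup>2 - 4 * e * h" and p: "prime p" "p dvd m" and e: "\<not> p dvd e"
  shows "conic_sum (p ^ Suc k) e g h s t n =
    (if p ^ Suc k dvd conic_det e g h s t n \<and> \<not> p ^ Suc (Suc k) dvd conic_det e g h s t n
     then of_int (p ^ (2 * Suc k) * hilbert m p (- conic_det e g h s t n * e)) else 0)"
proof -
  have p0: "p > 0" using p(1) prime_gt_0_int by blast
  obtain w where w: "p dvd g + 2 * e * w" "p dvd h + g * w + e * w\<^sup>2"
  proof (cases "p = 2")
    case True
    then have "even g" using p(2) m by simp
    then show ?thesis using that[of h] e True by (simp add: power2_eq_square)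
  next
    case False
    have "\<not> p dvd 2 * e" using p(1) e False prime_2_dvd_iff[of p] by (simp add: prime_dvd_mult_iff)
    then have "coprime (2 * e) p" using p(1) prime_imp_coprime coprime_commute by blast
    then obtain i where "[2 * e * i = 1] (mod p)" using cong_solve_coprime_int by blast
    then have "[2 * e * i * (- g) + g = 1 * (- g) + g] (mod p)" by (intro cong_add cong_mult) auto
    then have g: "p dvd g + 2 * e * (- (i * g))" by (simp add: cong_0_iff mult_ac add.commute)
    have "4 * (e * (h + g * w + e * w\<^sup>2)) = (g + 2 * e * w)\<^sup>2 - m" for w
      by (simp add: m power2_eq_square algebra_simps)
    then have "p dvd 4 * (e * (h + g * (- (i * g)) + e * (- (i * g))\<^sup>2))"
      using g p(2) by (metis dvd_diff dvd_mult power2_eq_square)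
    then have "p dvd h + g * (- (i * g)) + e * (- (i * g))\<^sup>2"
      using prime_dvd_4_mult[OF p(1) False] e p(1) by (simp add: prime_dvd_mult_iff)
    then show ?thesis using that g by blast
  qed
  have "m = (g + 2 * e * w)\<^sup>2 - 4 * e * (h + g * w + e * w\<^sup>2)" by (simp only: discriminant_shear m)
  from conic_sum_ramified_aux[OF this p w(1) e w(2), of k s "t + s * w" n]
  show ?thesis using conic_sum_shear[of "p ^ Suc k" e g h s t n w] p0 by (simp only: conic_det_shear zero_less_power)
qed

text \<open>If \<open>p\<close> divides \<open>e\<close>, minimality of the discriminant makes
  \<open>h\<close> a unit, and the variables are exchanged. Otherwise the symbol of \<open>e\<close>
  is replaced by that of \<open>h\<close>.\<close>

lemma conic_sum_ramified:
  fixes s t n :: int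
  assumes m: "m = g\<^sup>2 - 4 * e * h" and p: "prime p" "p dvd m" and h: "h \<noteq> 0"
  defines "P \<equiv> conic_det e g h s t n"
  shows "conic_sum (p ^ Suc k) e g h s t n =
    (if p ^ Suc k dvd P \<and> \<not> p ^ Suc (Suc k) dvd P
     then of_int (p ^ (2 * Suc k) * hilbert m p (- P * h)) else 0)"
proof (cases "p dvd e")
  case False
  then have "e \<noteq> 0" by auto
  then have "hilbert m p (- P * h) = hilbert m p (- P * e)" if "P \<noteq> 0"
    using hilbert_represented[OF m p _ h, of "- P"] that by simp
  then show ?thesis using conic_sum_ramified_unit[OF m p False, of k s t n, folded P_def]
    by (cases "P = 0") (simp_all del: power_Suc)
next
  case True
  have nh: "\<not> p dvd h"
  proof
    assume hh: "p dvd h"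
    have "p dvd g\<^sup>2" using p(2) True m by (metis diff_add_cancel dvd_add dvd_mult dvd_mult2)
    then have g: "p dvd g" using prime_dvd_power[OF p(1)] by blast
    obtain e' g' h' where o: "e = p * e'" "g = p * g'" "h = p * h'" using True g hh by (elim dvdE)
    then have mp: "m = p\<^sup>2 * (g'\<^sup>2 - 4 * (e' * h'))" using m by (simp add: power2_eq_square algebra_simps)
    show False using discriminant_minimal[OF p(1)] mp by blast
  qed
  have "m = g\<^sup>2 - 4 * h * e" using m by simp
  from conic_sum_ramified_unit[OF this p nh, of k t s n] show ?thesis
    unfolding P_def conic_sum_swap[of _ e] conic_det_swap[of e] .
qed

end

subsection \<open>Multiplicativity\<close>

lemma kronecker_pos: "u > 0 \<Longrightarrow> kronecker a u = (\<Prod>p\<in>#prime_factorization (nat u). kronecker_at_prime a p)"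
  by (simp add: kronecker_def)

lemma kronecker_mult_pos:
  assumes "u > 0" "v > 0"
  shows "kronecker a (u * v) = kronecker a u * kronecker a v"
  using assms by (simp add: kronecker_pos nat_mult_distrib prime_factorization_mult)

lemma kronecker_1_right [simp]: "kronecker a 1 = 1"
  by (simp add: kronecker_def)

lemma kronecker_prime_power:
  assumes "prime p"
  shows "kronecker a (p ^ k) = kron_at a p ^ k"
proof -
  have p: "p > 0" using assms prime_gt_0_int by blast
  then have "prime (nat p)" using assms by (simp add: prime_nat_iff_prime)
  then show ?thesis using p by (simp add: kronecker_pos nat_power_eq prime_factorization_prime_power)
qed

lemma conic_sum_mult:
  assumes "c1 > 0" "c2 > 0" "coprime c1 c2"
  shows "conic_sum (c1 * c2) e g h s t n = conic_sum c1 e g h s t n * conic_sum c2 e g h s t n"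
proof -
  let ?F = "conic_poly e g h s t n"
  have c: "c1 * c2 > 0" using assms by simp
  have part: "(\<Sum>x=0..<c. \<Sum>y=0..<c. ramanujan_sum c (?F (x * d) (y * d))) = conic_sum c e g h s t n"
    if "c > 0" "coprime d c" for c d
  proof -
    have per: "periodic_mod c (\<lambda>y. ramanujan_sum c (?F x y))"
      "periodic_mod c (\<lambda>x. \<Sum>y=0..<c. ramanujan_sum c (?F x y))" for x
      using that by (intro periodic_modI sum.cong refl ramanujan_sum_cong conic_cong; simp)+
    show ?thesis
      using sum_residues_mult[OF that(1) per(1) that(2)] sum_residues_mult[OF that(1) per(2) that(2)]
      by (simp add: conic_sum_def mult.commute[of _ d])
  qed
  have "conic_sum (c1 * c2) e g h s t n =
      (\<Sum>x1=0..<c1. \<Sum>x2=0..<c2. \<Sum>y1=0..<c1. \<Sum>y2\<in>{0..<c2}.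
         ramanujan_sum (c1 * c2) (?F (x1 * c2 + x2 * c1) (y1 * c2 + y2 * c1)))"
  proof -
    have per: "periodic_mod (c1 * c2) (\<lambda>y. ramanujan_sum (c1 * c2) (?F x y))"
      "periodic_mod (c1 * c2) (\<lambda>x. \<Sum>y=0..<c1 * c2. ramanujan_sum (c1 * c2) (?F x y))" for x
      using c by (intro periodic_modI sum.cong refl ramanujan_sum_cong conic_cong; simp)+
    show ?thesis
      unfolding conic_sum_def sum_residues_crt[OF assms per(2)]
      by (intro sum.cong refl sum_residues_crt[OF assms per(1)])
  qed
  also have "\<dots> = (\<Sum>x1=0..<c1. \<Sum>x2=0..<c2. \<Sum>y1=0..<c1. \<Sum>y2\<in>{0..<c2}.
         ramanujan_sum c1 (?F (x1 * c2) (y1 * c2)) * ramanujan_sum c2 (?F (x2 * c1) (y2 * c1)))"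
  proof (intro sum.cong refl)
    fix x1 x2 y1 y2
    have "ramanujan_sum c1 (?F (x1 * c2 + x2 * c1) (y1 * c2 + y2 * c1)) = ramanujan_sum c1 (?F (x1 * c2) (y1 * c2))"
      "ramanujan_sum c2 (?F (x1 * c2 + x2 * c1) (y1 * c2 + y2 * c1)) = ramanujan_sum c2 (?F (x2 * c1) (y2 * c1))"
      using assms by (intro ramanujan_sum_cong conic_cong; simp add: cong_def)+
    then show "ramanujan_sum (c1 * c2) (?F (x1 * c2 + x2 * c1) (y1 * c2 + y2 * c1)) =
        ramanujan_sum c1 (?F (x1 * c2) (y1 * c2)) * ramanujan_sum c2 (?F (x2 * c1) (y2 * c1))"
      using ramanujan_sum_mult[OF assms] by simp
  qed
  also have "\<dots> = (\<Sum>x1=0..<c1. \<Sum>y1=0..<c1. ramanujan_sum c1 (?F (x1 * c2) (y1 * c2)))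
       * (\<Sum>x2=0..<c2. \<Sum>y2=0..<c2. ramanujan_sum c2 (?F (x2 * c1) (y2 * c1)))"
    by (simp add: sum_product)
  finally show ?thesis
    using part[of c1 c2] part[of c2 c1] assms by (simp add: coprime_commute)
qed

lemma conic_sum_1 [simp]: "conic_sum 1 e g h s t n = 1"
  by (simp add: conic_sum_def)

lemma finite_pos_divisors: "c > 0 \<Longrightarrow> finite {u. u > 0 \<and> u dvd (c::int)}"
  by (rule finite_subset[of _ "{0..c}"]) (auto dest: zdvd_imp_le)

lemma sum_divisors_mult:
  fixes f :: "int \<Rightarrow> 'a::comm_monoid_add"
  assumes "c1 > 0" "c2 > 0" "coprime c1 c2"
  shows "(\<Sum>u | u > 0 \<and> u dvd c1 * c2. f u) =
    (\<Sum>u1 | u1 > 0 \<and> u1 dvd c1. \<Sum>u2 | u2 > 0 \<and> u2 dvd c2. f (u1 * u2))"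
proof -
  let ?D = "\<lambda>c::int. {u. u > 0 \<and> u dvd c}"
  have cop: "coprime u1 c2" "coprime u2 c1" if "u1 dvd c1" "u2 dvd c2" for u1 u2
    using assms(3) that by (meson coprime_commute coprime_divisors dvd_refl)+
  have gcds: "gcd (u1 * u2) c1 = u1" "gcd (u1 * u2) c2 = u2" if "u1 \<in> ?D c1" "u2 \<in> ?D c2" for u1 u2
  proof -
    have "gcd (u1 * u2) c1 = gcd u1 c1" using cop(2)[of u1 u2] that by (simp add: gcd_mult_right_right_cancel gcd.commute coprime_commute)
    moreover have "gcd (u1 * u2) c2 = gcd u2 c2" using cop(1)[of u1 u2] that by (simp add: gcd_mult_right_left_cancel gcd.commute coprime_commute)
    ultimately show "gcd (u1 * u2) c1 = u1" "gcd (u1 * u2) c2 = u2" using that by (auto simp: gcd_proj1_iff)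
  qed
  have bij: "bij_betw (\<lambda>(u1, u2). u1 * u2) (?D c1 \<times> ?D c2) (?D (c1 * c2))"
  proof (rule bij_betw_byWitness[where f' = "\<lambda>u. (gcd u c1, gcd u c2)"])
    show "\<forall>u\<in>?D c1 \<times> ?D c2. (gcd (case u of (u1, u2) \<Rightarrow> u1 * u2) c1, gcd (case u of (u1, u2) \<Rightarrow> u1 * u2) c2) = u"
      using gcds by auto
    show "\<forall>u\<in>?D (c1 * c2). (case (gcd u c1, gcd u c2) of (u1, u2) \<Rightarrow> u1 * u2) = u"
    proof clarsimp
      fix u assume u: "u > 0" "u dvd c1 * c2"
      obtain v1 v2 where v: "u = v1 * v2" "v1 dvd c1" "v2 dvd c2" using division_decomp[OF u(2)] by blast
      have "u = \<bar>v1\<bar> * \<bar>v2\<bar>" using v(1) u(1) by (simp add: abs_mult [symmetric])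
      moreover have "v1 \<noteq> 0" "v2 \<noteq> 0" using v(1) u(1) by auto
      ultimately show "gcd u c1 * gcd u c2 = u" using gcds[of "\<bar>v1\<bar>" "\<bar>v2\<bar>"] v by simp
    qed
    show "(\<lambda>(u1, u2). u1 * u2) ` (?D c1 \<times> ?D c2) \<subseteq> ?D (c1 * c2)" by (auto intro: mult_dvd_mono)
    show "(\<lambda>u. (gcd u c1, gcd u c2)) ` ?D (c1 * c2) \<subseteq> ?D c1 \<times> ?D c2" using assms by auto
  qed
  show ?thesis
    by (simp add: sum.cartesian_product sum.reindex_bij_betw[OF bij, symmetric] case_prod_unfold)
qed

text \<open>One factor \<open>1 / c\<close> comes from Fourier inversion in \<open>l\<close> modulo
  \<open>c\<close>. The other, \<open>1 / (c div u)\<close>, is the weight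
  \<open>sqrt (u / c)\<close> of the theorem times the \<open>1 / sqrt (c div u)\<close> of the Weil
  coefficient.\<close>

definition twisted_conic_sum :: "int \<Rightarrow> int \<Rightarrow> int \<Rightarrow> int \<Rightarrow> int \<Rightarrow> int \<Rightarrow> int \<Rightarrow> int \<Rightarrow> complex" where
  "twisted_conic_sum m c e g h s t n =
     (\<Sum>u | u > 0 \<and> u dvd c. of_int (kronecker m u) * conic_sum (c div u) e g h s t n / of_int (c * (c div u)))"

lemma twisted_conic_sum_mult:
  assumes "c1 > 0" "c2 > 0" "coprime c1 c2"
  shows "twisted_conic_sum m (c1 * c2) e g h s t n = twisted_conic_sum m c1 e g h s t n * twisted_conic_sum m c2 e g h s t n"
  unfolding twisted_conic_sum_def sum_divisors_mult[OF assms] sum_product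
proof (intro sum.cong refl)
  fix u1 u2 assume u: "u1 \<in> {u. u > 0 \<and> u dvd c1}" "u2 \<in> {u. u > 0 \<and> u dvd c2}"
  have q: "c1 * c2 div (u1 * u2) = (c1 div u1) * (c2 div u2)" using u by (simp add: div_mult_div_if_dvd)
  have pos: "c1 div u1 > 0" "c2 div u2 > 0" using u assms by (auto simp: pos_imp_zdiv_pos_iff dest: zdvd_imp_le)
  have "c1 div u1 dvd c1" "c2 div u2 dvd c2" using u by (metis dvd_div_mult_self dvd_triv_left mem_Collect_eq)+
  then have "coprime (c1 div u1) (c2 div u2)" using assms(3) coprime_divisors by blast
  then show "of_int (kronecker m (u1 * u2)) * conic_sum (c1 * c2 div (u1 * u2)) e g h s t n / of_int (c1 * c2 * (c1 * c2 div (u1 * u2))) =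
      of_int (kronecker m u1) * conic_sum (c1 div u1) e g h s t n / of_int (c1 * (c1 div u1)) *
      (of_int (kronecker m u2) * conic_sum (c2 div u2) e g h s t n / of_int (c2 * (c2 div u2)))"
    using u by (simp add: q conic_sum_mult[OF pos] kronecker_mult_pos mult_ac)
qed

lemma sum_ramanujan_prime_powers:
  assumes "prime p"
  shows "(\<Sum>j\<le>k. ramanujan_sum (p ^ j) z) = (if p ^ k dvd z then of_int (p ^ k) else 0)"
  by (induction k) (simp_all add: ramanujan_sum_prime_power[OF assms] del: power_Suc)

lemma pos_divisors_prime_power:
  assumes "prime (p::int)"
  shows "{u. u > 0 \<and> u dvd p ^ k} = (\<lambda>i. p ^ i) ` {..k}"
proof -
  have p: "p > 0" using assms prime_gt_0_int by blast
  have "\<exists>i\<le>k. u = p ^ i" if "u > 0" "u dvd p ^ k" for u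
    using that divides_primepow[OF assms that(2)] by auto
  then show ?thesis using p by (auto simp: le_imp_power_dvd)
qed

lemma twisted_conic_sum_prime_power:
  assumes "prime p"
  shows "twisted_conic_sum m (p ^ k) e g h s t n =
    (\<Sum>i\<le>k. of_int (kron_at m p ^ i) * conic_sum (p ^ (k - i)) e g h s t n / of_int (p ^ k * p ^ (k - i)))"
proof -
  have p: "p > 1" using assms prime_gt_1_int by blast
  then have inj: "inj_on (\<lambda>i. p ^ i) {..k}" by (auto intro: inj_onI simp: power_inject_exp)
  show ?thesis
    unfolding twisted_conic_sum_def pos_divisors_prime_power[OF assms] sum.reindex[OF inj]
    using p by (intro sum.cong) (auto simp: kronecker_prime_power[OF assms] power_diff)
qed

context fund_disc
begin

definition local_factor :: "int \<Rightarrow> int \<Rightarrow> int \<Rightarrow> nat \<Rightarrow> int" where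
  "local_factor P h p k =
     (if p ^ k dvd P then
        (if p dvd m then (if p ^ Suc k dvd P then 0 else hilbert m p (- P * h)) else kron_at m p ^ k)
      else 0)"

lemma twisted_conic_sum_local:
  assumes m: "m = g\<^sup>2 - 4 * e * h" and p: "prime p" and h: "h \<noteq> 0" and k: "k > 0"
  shows "twisted_conic_sum m (p ^ k) e g h s t n = of_int (local_factor (conic_det e g h s t n) h p k)"
proof (cases "p dvd m")
  case True
  have p0: "p > 0" using p prime_gt_0_int by blast
  obtain j where j: "k = Suc j" using k by (cases k) auto
  \<comment> \<open>The vanishing symbol leaves only the divisor \<open>u = 1\<close>.\<close>
  have "kron_at m p = 0" using True kron_at_eq_0_iff[OF p] by simp
  then have "twisted_conic_sum m (p ^ k) e g h s t n = conic_sum (p ^ k) e g h s t n / of_int (p ^ k * p ^ k)"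
    by (simp add: twisted_conic_sum_prime_power[OF p] sum.atMost_shift)
  also have "\<dots> = of_int (local_factor (conic_det e g h s t n) h p k)"
  proof -
    have "p ^ (2 * k) = p ^ k * p ^ k" by (simp add: mult_2 power_add)
    then show ?thesis
      using p0 by (simp add: conic_sum_ramified[OF m p True h, of j, folded j] local_factor_def True del: power_Suc)
  qed
  finally show ?thesis .
next
  case False
  have p0: "p > 0" using p prime_gt_0_int by blast
  let ?P = "conic_det e g h s t n"
  have nd: "\<not> p dvd g\<^sup>2 - 4 * e * h" using False m by simp
  have "twisted_conic_sum m (p ^ k) e g h s t n = (\<Sum>i\<le>k. of_int (kron_at m p ^ k) / of_int (p ^ k) * ramanujan_sum (p ^ (k - i)) ?P)"
    unfolding twisted_conic_sum_prime_power[OF p]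
  proof (intro sum.cong refl)
    fix i assume "i \<in> {..k}"
    then have "kron_at m p ^ k = kron_at m p ^ i * kron_at m p ^ (k - i)" by (simp add: power_add [symmetric])
    then show "of_int (kron_at m p ^ i) * conic_sum (p ^ (k - i)) e g h s t n / of_int (p ^ k * p ^ (k - i))
      = of_int (kron_at m p ^ k) / of_int (p ^ k) * ramanujan_sum (p ^ (k - i)) ?P"
      using p0 conic_sum_prime_power_unramified[OF p nd, of "k - i" s t n] by (simp add: m [symmetric])
  qed
  also have "\<dots> = of_int (kron_at m p ^ k) / of_int (p ^ k) * (\<Sum>i\<le>k. ramanujan_sum (p ^ (k - i)) ?P)"
    by (simp add: sum_distrib_left)
  also have "(\<Sum>i\<le>k. ramanujan_sum (p ^ (k - i)) ?P) = (\<Sum>i\<le>k. ramanujan_sum (p ^ i) ?P)"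
    by (rule sum.reindex_bij_witness[of _ "\<lambda>i. k - i" "\<lambda>i. k - i"]) auto
  finally show ?thesis using p0 False by (simp add: sum_ramanujan_prime_powers[OF p] local_factor_def)
qed

lemma twisted_conic_sum_eq_prod:
  assumes m: "m = g\<^sup>2 - 4 * e * h" and h: "h \<noteq> 0" and c: "c > 0"
  shows "twisted_conic_sum m c e g h s t n =
    of_int (\<Prod>p\<in>prime_factors c. local_factor (conic_det e g h s t n) h p (multiplicity p c))"
  using c
proof (induction "nat c" arbitrary: c rule: less_induct)
  case less
  show ?case
  proof (cases "c = 1")
    case True
    have "{u. u > 0 \<and> u dvd (1::int)} = {1}" by (auto simp: zdvd1_eq)
    then show ?thesis using True by (simp add: twisted_conic_sum_def)
  next
    case False
    then obtain p where p: "prime p" "p dvd c" using less.prems prime_divisor_exists[of c] by auto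
    have p1: "p > 1" using p prime_gt_1_int by blast
    define k where "k = multiplicity p c"
    obtain c' where c': "c = p ^ k * c'" "\<not> p dvd c'"
      using less.prems p(1) multiplicity_decompose'[of c p] not_prime_unit[of p] unfolding k_def by blast
    have k: "k > 0" using p less.prems prime_multiplicity_gt_zero_iff[of p c] by (auto simp: k_def)
    have c'0: "c' > 0" using c'(1) less.prems p1 by (simp add: zero_less_mult_iff)
    have "1 * c' < p ^ k * c'" using c'0 p1 k by (intro mult_strict_right_mono) auto
    then have lt: "nat c' < nat c" using c' c'0 by simp
    have cop: "coprime (p ^ k) c'" using prime_imp_coprime[OF p(1) c'(2)] by simp
    have pf: "prime_factors c = insert p (prime_factors c')" "p \<notin> prime_factors c'"
      using c' c'0 p1 k p(1) by (auto simp: prime_factorization_mult prime_factors_power prime_factorization_prime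
          dest: in_prime_factors_imp_dvd)
    have mult: "multiplicity q c = multiplicity q c'" if "q \<in> prime_factors c'" for q
    proof -
      have q: "prime q" using that by (rule in_prime_factors_imp_prime)
      have "q \<noteq> p" using that pf by auto
      then have "multiplicity q (p ^ k) = 0" using multiplicity_distinct_prime_power[OF q p(1)] by simp
      then show ?thesis using prime_elem_multiplicity_mult_distrib[OF prime_imp_prime_elem[OF q], of "p ^ k" c'] c'(1) c'0 p1 by simp
    qed
    have "twisted_conic_sum m c e g h s t n = twisted_conic_sum m (p ^ k) e g h s t n * twisted_conic_sum m c' e g h s t n"
      unfolding c'(1) using p1 c'0 cop by (intro twisted_conic_sum_mult) auto
    also have "\<dots> = of_int (local_factor (conic_det e g h s t n) h p k *
        (\<Prod>q\<in>prime_factors c'. local_factor (conic_det e g h s t n) h q (multiplicity q c')))"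
      using twisted_conic_sum_local[OF m p(1) h k] less.hyps[OF lt c'0] by simp
    also have "\<dots> = of_int (\<Prod>q\<in>prime_factors c. local_factor (conic_det e g h s t n) h q (multiplicity q c))"
      unfolding pf(1) using pf(2) mult by (simp add: k_def cong: prod.cong)
    finally show ?thesis .
  qed
qed

end

subsection \<open>The Gross--Kohnen--Zagier character\<close>

lemma multiplicity_int_nat:
  assumes "prime q" "n > 0"
  shows "multiplicity (int q) (int n) = multiplicity q n"
proof (rule multiplicity_eqI)
  have *: "int q ^ k dvd int n \<longleftrightarrow> q ^ k dvd n" for k by (metis int_dvd_int_iff of_nat_power)
  have "\<not> is_unit q" using assms(1) not_prime_unit by blast
  then show "int q ^ multiplicity q n dvd int n" "\<not> int q ^ Suc (multiplicity q n) dvd int n"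
    unfolding * using assms(2) by (auto simp: multiplicity_dvd power_dvd_iff_le_multiplicity simp del: power_Suc)
qed

lemma prod_prime_factorization_nat:
  fixes f :: "int \<Rightarrow> int"
  assumes "c > 0"
  shows "(\<Prod>q\<in>#prime_factorization (nat c). f (int q)) = (\<Prod>p\<in>prime_factors c. f p ^ multiplicity p c)"
proof -
  obtain n where n: "c = int n" "n > 0" using assms by (metis pos_int_cases)
  have bij: "bij_betw int (prime_factors n) (prime_factors c)"
  proof (rule bij_betw_byWitness[where f' = nat])
    show "int ` prime_factors n \<subseteq> prime_factors c" using n by (auto simp: in_prime_factors_iff)
    show "nat ` prime_factors c \<subseteq> prime_factors n"
      using n by (auto simp: in_prime_factors_iff prime_nat_iff_prime nat_dvd_iff prime_ge_0_int)
    show "\<forall>p\<in>prime_factors c. int (nat p) = p" by (auto simp: in_prime_factors_iff prime_ge_0_int)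
  qed auto
  have "(\<Prod>q\<in>#prime_factorization n. f (int q)) = (\<Prod>q\<in>prime_factors n. f (int q) ^ multiplicity (int q) c)"
    unfolding image_prod_mset_multiplicity using n
    by (intro prod.cong refl) (auto simp: multiplicity_int_nat in_prime_factors_iff count_prime_factorization_prime)
  also have "\<dots> = (\<Prod>p\<in>prime_factors c. f p ^ multiplicity p c)" by (rule prod.reindex_bij_betw[OF bij])
  finally show ?thesis using n by simp
qed

text \<open>Primes of \<open>N\<close> that divide \<open>c\<close> are put into \<open>N1\<close>
  and the others into \<open>N2\<close>, so that \<open>N2\<close> is prime to \<open>c\<close>.
  This splitting admits a represented number prime to \<open>m\<close>.\<close>

lemma coprime_part:
  fixes N c :: int
  assumes "N > 0"
  shows "\<exists>N1 N2. N = N1 * N2 \<and> N1 > 0 \<and> N2 > 0 \<and> (\<forall>p. prime p \<and> p dvd N1 \<longrightarrow> p dvd c) \<and> (\<forall>p. prime p \<and> p dvd N2 \<longrightarrow> \<not> p dvd c)"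
  using assms
proof (induction "nat N" arbitrary: N rule: less_induct)
  case less
  show ?case
  proof (cases "\<exists>p. prime p \<and> p dvd N \<and> p dvd c")
    case False
    then show ?thesis using less.prems by (intro exI[of _ 1] exI[of _ N]) (auto simp: not_prime_unit)
  next
    case True
    then obtain p N' where p: "prime p" "N = p * N'" "p dvd c" by (auto elim: dvdE)
    have p1: "p > 1" using p prime_gt_1_int by blast
    then have N': "N' > 0" using less.prems p by (simp add: zero_less_mult_iff)
    then have "1 * N' < p * N'" using p1 by (intro mult_strict_right_mono) auto
    then have "nat N' < nat N" using N' p by simp
    from less.hyps[OF this N'] obtain N1 N2 where N: "N' = N1 * N2" "N1 > 0" "N2 > 0"
      "\<forall>p. prime p \<and> p dvd N1 \<longrightarrow> p dvd c" "\<forall>p. prime p \<and> p dvd N2 \<longrightarrow> \<not> p dvd c" by blast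
    have "\<forall>q. prime q \<and> q dvd p * N1 \<longrightarrow> q dvd c"
      using p N(4) by (auto simp: prime_dvd_mult_iff dest: primes_dvd_imp_eq)
    then show ?thesis using p N p1 by (intro exI[of _ "p * N1"] exI[of _ N2]) auto
  qed
qed

lemma prime_dvd_prod_primes_iff:
  fixes p :: int
  assumes "prime p" "finite S" "\<And>q. q \<in> S \<Longrightarrow> prime q"
  shows "p dvd \<Prod>S \<longleftrightarrow> p \<in> S"
proof -
  have "p dvd \<Prod>S \<longleftrightarrow> (\<exists>q\<in>S. p dvd q)" using prime_dvd_prod_iff[OF assms(2,1), of "\<lambda>x. x"] by simp
  then show ?thesis using assms(1,3) primes_dvd_imp_eq by (metis dvd_refl)
qed

locale gkz_setting = fund_disc +
  fixes N a b n l c C :: int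
  assumes N: "N > 0" and c: "c > 0"
    and ma: "[m = a\<^sup>2] (mod 4 * N)" and nb: "[n = b\<^sup>2] (mod 4 * N)"
    and l: "[l = a * b] (mod 2 * N)" and C: "l\<^sup>2 - m * n = 4 * N * c * C"
begin

lemma n_mod_4: "n mod 4 = 0 \<or> n mod 4 = 1"
proof -
  have "[n = b\<^sup>2] (mod 4)" using nb by (rule cong_modulus_mult)
  then show ?thesis using square_diff_mod_4[of b 0] by (simp add: cong_def)
qed

text \<open>\<open>m\<close> is a square modulo \<open>4 N\<close>; for \<open>q = 2\<close> the
  modulus includes 8, as required for the symbol at 2.\<close>

lemma kron_at_dvd_level:
  assumes "prime q" "q dvd N" "\<not> q dvd m"
  shows "kron_at m q = 1"
proof (cases "q = 2")
  case True
  have "8 dvd 4 * N" using assms(2) True by (auto elim: dvdE)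
  then have "[m = a\<^sup>2] (mod 8)" using ma cong_dvd_modulus by blast
  moreover obtain w where "a\<^sup>2 = 8 * w \<or> a\<^sup>2 = 8 * w + 1 \<or> a\<^sup>2 = 8 * w + 4" by (rule square_form)
  then have "a\<^sup>2 mod 8 = 0 \<or> a\<^sup>2 mod 8 = 1 \<or> a\<^sup>2 mod 8 = 4" by auto
  moreover have "odd m" using assms(3) True by simp
  then have "m mod 8 \<noteq> 0" "m mod 8 \<noteq> 4" by presburger+
  ultimately have "m mod 8 = 1" by (simp add: cong_def)
  then show ?thesis using True assms(3) by (simp add: kron_at_2)
next
  case False
  have "[m = a\<^sup>2] (mod q)" using ma assms(2) cong_dvd_modulus[of m "a\<^sup>2" "4 * N" q] by simp
  moreover from this have "\<not> q dvd a" using assms(3) by (metis cong_dvd_iff dvd_power pos2 dvd_trans)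
  ultimately show ?thesis using Legendre_cong[of m "a\<^sup>2" q] Legendre_square[of q a] assms(1) odd_prime_gt_2[OF assms(1) False]
    by (simp add: kron_at_odd)
qed

lemma dvd_l:
  assumes "prime p" "p dvd m" "p dvd N * c"
  shows "p dvd l"
proof -
  have "l\<^sup>2 = m * n + N * c * (4 * C)" using C by simp
  then have "p dvd l\<^sup>2" using assms(2,3) by simp
  then show ?thesis using prime_dvd_power[OF assms(1)] by blast
qed

text \<open>The form has discriminant \<open>m n\<close>. Completing the square in either variable
  writes 4 times \<open>r\<close> times an outer coefficient as \<open>X^2 - m n Y^2\<close>, to
  which \<open>local_char_norm\<close> applies.\<close>

lemma local_char_represented:
  assumes "prime p" "p dvd m" "N = N1 * N2" "\<not> p dvd r" "r = c * N1 * x\<^sup>2 + l * x * y + C * N2 * y\<^sup>2"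
  shows "\<not> p dvd c * N1 \<Longrightarrow> local_char m p r = local_char m p (c * N1)"
    and "\<not> p dvd C * N2 \<Longrightarrow> local_char m p r = local_char m p (C * N2)"
proof -
  have "l\<^sup>2 = m * n + 4 * N * c * C" using C by linarith
  then have l2: "l\<^sup>2 = m * n + 4 * (c * N1) * (C * N2)" unfolding assms(3) by (simp add: mult_ac)
  have char_eq: "local_char m p r = local_char m p z" if "\<not> p dvd z" "4 * (z * r) = X\<^sup>2 - m * n * Y\<^sup>2" for z X Y
  proof -
    have "\<not> p dvd z * r" using that(1) assms(1,4) by (simp add: prime_dvd_mult_iff)
    then have "local_char m p (z * r) = 1" using local_char_norm[OF assms(1,2) _ that(2)] n_mod_4 by blast
    then show ?thesis using local_char_mult[OF assms(1) that(1) assms(4)] local_char_abs[OF assms(1) that(1), of m]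
        local_char_abs[OF assms(1,4), of m] by auto
  qed
  have "4 * (c * N1 * r) = (2 * (c * N1) * x + l * y)\<^sup>2 - (l\<^sup>2 - 4 * (c * N1) * (C * N2)) * y\<^sup>2"
    by (simp add: assms(5) power2_eq_square algebra_simps)
  then have 1: "4 * (c * N1 * r) = (2 * (c * N1) * x + l * y)\<^sup>2 - m * n * y\<^sup>2" by (simp add: l2)
  have "4 * (C * N2 * r) = (2 * (C * N2) * y + l * x)\<^sup>2 - (l\<^sup>2 - 4 * (c * N1) * (C * N2)) * x\<^sup>2"
    by (simp add: assms(5) power2_eq_square algebra_simps)
  then have 2: "4 * (C * N2 * r) = (2 * (C * N2) * y + l * x)\<^sup>2 - m * n * x\<^sup>2" by (simp add: l2)
  show "\<not> p dvd c * N1 \<Longrightarrow> local_char m p r = local_char m p (c * N1)" using char_eq 1 by blast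
  show "\<not> p dvd C * N2 \<Longrightarrow> local_char m p r = local_char m p (C * N2)" using char_eq 2 by blast
qed

text \<open>Settles the primes dividing \<open>N1\<close> but not \<open>c\<close> in
  \<open>kronecker_represented\<close>. With \<open>m = a^2 + 4 N m0\<close>, the number
  \<open>N (- m0)\<close> is a norm, and \<open>- m0 (c C)\<close> has the shape of
  \<open>local_char_norm\<close> with \<open>l0^2 - 4 m0 n0\<close> in place of \<open>n\<close>;
  their product is \<open>N (c C)\<close> up to a square. That \<open>m0\<close> is a unit follows
  from \<open>c C = - m0 b^2\<close> modulo \<open>p\<close>.\<close>

lemma hilbert_conic_det_unit:
  assumes "prime p" "p dvd m" "p dvd N" "\<not> p dvd c * C"
  shows "hilbert m p (N * (c * C)) = 1"
proof -
  obtain m0 where m0: "m = a\<^sup>2 + 4 * N * m0" using ma by (metis cong_iff_lin cong_sym)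
  obtain n0 where n0: "n = b\<^sup>2 + 4 * N * n0" using nb by (metis cong_iff_lin cong_sym)
  obtain l0 where l0: "l = a * b + 2 * N * l0" using l by (metis cong_iff_lin cong_sym)
  have "4 * N * (c * C) = 4 * N * (N * l0\<^sup>2 + a * b * l0 - m0 * b\<^sup>2 - m * n0)"
    using C unfolding l0 n0 m0 by (simp add: power2_eq_square algebra_simps)
  then have P: "c * C = N * l0\<^sup>2 + a * b * l0 - m0 * b\<^sup>2 - m * n0" using N by simp
  have "p dvd a\<^sup>2" using m0 assms(2,3) by (metis dvd_add_left_iff dvd_mult dvd_mult2)
  then have pa: "p dvd a" using prime_dvd_power[OF assms(1)] by blast
  have m0u: "\<not> p dvd m0"
  proof
    assume "p dvd m0"
    then have "p dvd c * C" unfolding P using pa assms(2,3) by simp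
    then show False using assms(4) by blast
  qed
  have "m0 \<noteq> 0" "c * C \<noteq> 0" using m0u assms(4) by auto
  have "4 * (N * (- m0)) = a\<^sup>2 - m * 1\<^sup>2" using m0 by simp
  then have 1: "hilbert m p (N * (- m0)) = 1" using hilbert_norm[OF assms(1,2), of "N * (- m0)" a 1] N \<open>m0 \<noteq> 0\<close> by simp
  have "4 * ((- m0) * (c * C)) = (2 * m0 * b - a * l0)\<^sup>2 - m * (l0\<^sup>2 - 4 * (m0 * n0)) * 1\<^sup>2"
    unfolding P m0 by (simp add: power2_eq_square algebra_simps)
  moreover have u: "\<not> p dvd (- m0) * (c * C)" using m0u assms(1,4) by (simp add: prime_dvd_mult_iff)
  moreover note square_diff_mod_4[of l0 "m0 * n0"]
  ultimately have "local_char m p ((- m0) * (c * C)) = 1" by (intro local_char_norm[OF assms(1,2)])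
  then have 2: "hilbert m p ((- m0) * (c * C)) = 1" using u hilbert_unit by simp
  have "hilbert m p (N * (c * C)) = hilbert m p ((- m0) * (- m0) * (N * (c * C)))"
    using hilbert_sq_mult[OF assms(1,2), of "- m0" "N * (c * C)"] \<open>m0 \<noteq> 0\<close> \<open>c * C \<noteq> 0\<close> N by simp
  also have "(- m0) * (- m0) * (N * (c * C)) = (N * (- m0)) * ((- m0) * (c * C))" by simp
  also have "hilbert m p \<dots> = 1"
    using hilbert_mult[OF assms(1), of "N * (- m0)" "(- m0) * (c * C)"] 1 2 \<open>m0 \<noteq> 0\<close> \<open>c * C \<noteq> 0\<close> N by simp
  finally show ?thesis .
qed

text \<open>The middle coefficient drops out: by \<open>dvd_l\<close>, a prime dividing
  \<open>m\<close> and \<open>c\<close> divides \<open>l\<close>.\<close>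

lemma Gcd_eq_1_iff: "Gcd {c, l, C, m} = 1 \<longleftrightarrow> (\<forall>p. prime p \<and> p dvd m \<and> p dvd c \<longrightarrow> \<not> p dvd C)"
proof -
  have "Gcd {c, l, C, m} = 1 \<longleftrightarrow> \<not> (\<exists>p. prime p \<and> p dvd Gcd {c, l, C, m})"
  proof
    assume "\<not> (\<exists>p. prime p \<and> p dvd Gcd {c, l, C, m})"
    then have "is_unit (Gcd {c, l, C, m})" using prime_divisor_exists[of "Gcd {c, l, C, m}"] c by auto
    then show "Gcd {c, l, C, m} = 1" using is_unit_normalize[of "Gcd {c, l, C, m}"] by simp
  qed (auto simp: not_prime_unit)
  moreover have "p dvd Gcd {c, l, C, m} \<longleftrightarrow> p dvd m \<and> p dvd c \<and> p dvd C" if "prime p" for p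
    using dvd_l[OF that] by (auto simp: dvd_Gcd_iff)
  ultimately show ?thesis by blast
qed

text \<open>Guarantees that the choice operator in \<open>gkz_char\<close> selects a genuine
  witness. The primes of \<open>m\<close> dividing \<open>c * N1\<close> are collected in
  \<open>x\<close>, the others in \<open>y\<close>; modulo each of them exactly one outer term of
  the form survives, and it is a unit.\<close>

lemma represents_coprime_exists:
  assumes "Gcd {c, l, C, m} = 1"
  shows "\<exists>r. coprime r m \<and> gkz_represents N c l C r"
proof -
  obtain N1 N2 where N12: "N = N1 * N2" "N1 > 0" "N2 > 0"
    "\<And>p. prime p \<Longrightarrow> p dvd N1 \<Longrightarrow> p dvd c" "\<And>p. prime p \<Longrightarrow> p dvd N2 \<Longrightarrow> \<not> p dvd c"
    using coprime_part[OF N, of c] by blast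
  define x where "x = \<Prod>{p \<in> prime_factors m. p dvd c * N1}"
  define y where "y = \<Prod>{p \<in> prime_factors m. \<not> p dvd c * N1}"
  define r where "r = c * N1 * x\<^sup>2 + l * x * y + C * N2 * y\<^sup>2"
  have "\<not> p dvd r" if p: "prime p" "p dvd m" for p
  proof -
    have pm: "p \<in> prime_factors m" using p nonzero by (simp add: in_prime_factors_iff)
    have px: "p dvd x \<longleftrightarrow> p dvd c * N1" and py: "p dvd y \<longleftrightarrow> \<not> p dvd c * N1"
      unfolding x_def y_def using pm p(1) by (subst prime_dvd_prod_primes_iff; auto intro: in_prime_factors_imp_prime)+
    show ?thesis
    proof (cases "p dvd c * N1")
      case True
      then have pc: "p dvd c" using N12(4) p(1) by (auto simp: prime_dvd_mult_iff)
      then have "\<not> p dvd C" "\<not> p dvd N2" using assms Gcd_eq_1_iff p N12(5) by blast+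
      then have "\<not> p dvd C * N2 * y\<^sup>2" using py True p(1) by (simp add: prime_dvd_mult_iff prime_dvd_power_iff)
      moreover have "r = C * N2 * y\<^sup>2 + x * (c * N1 * x + l * y)" by (simp add: r_def power2_eq_square algebra_simps)
      ultimately show ?thesis using px True by (simp add: dvd_add_left_iff)
    next
      case False
      then have "\<not> p dvd c * N1 * x\<^sup>2" using px p(1) by (auto simp: prime_dvd_mult_iff[of p "c * N1"] prime_dvd_power_iff)
      moreover have "r = c * N1 * x\<^sup>2 + y * (C * N2 * y + l * x)" by (simp add: r_def power2_eq_square algebra_simps)
      ultimately show ?thesis using py False by (simp add: dvd_add_left_iff)
    qed
  qed
  note np = this
  have "coprime r m"
  proof (rule ccontr)
    assume "\<not> coprime r m"
    then have "\<not> is_unit (gcd r m)" by (simp add: coprime_iff_gcd_eq_1)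
    then obtain p where "prime p" "p dvd gcd r m" using prime_divisor_exists[of "gcd r m"] nonzero by auto
    then show False using np by auto
  qed
  moreover have "gkz_represents N c l C r" unfolding gkz_represents_def using N12 r_def by blast
  ultimately show ?thesis by blast
qed

text \<open>As \<open>N (c C) = (c N1) (C N2)\<close>, the symbols of the two outer coefficients
  differ by that of \<open>N (c C)\<close>. So the symbol of \<open>c N1\<close> can be used at
  every prime of \<open>m\<close>, with a correction at those dividing \<open>c\<close>. The product
  formula moves the symbols of \<open>c\<close> to the primes of \<open>c\<close>, while those of
  \<open>N1\<close> multiply to 1 because \<open>m\<close> is a square modulo \<open>4 N\<close>.
  The right-hand side involves neither \<open>r\<close> nor the splitting, which is the known
  independence.\<close>

lemma kronecker_represented:
  assumes gcd: "Gcd {c, l, C, m} = 1" and r: "coprime r m" "gkz_represents N c l C r"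
  shows "kronecker m r = (\<Prod>p\<in>prime_factors c. if p dvd m then hilbert m p (N * (c * C)) else kron_at m p ^ multiplicity p c)"
proof -
  obtain N1 N2 x y where N12: "N = N1 * N2" "N1 > 0" and r_eq: "r = c * N1 * x\<^sup>2 + l * x * y + C * N2 * y\<^sup>2"
    using r(2) unfolding gkz_represents_def by blast
  have N2: "N2 > 0" using N N12 by (simp add: zero_less_mult_iff)
  have local: "local_char m p r = hilbert m p (c * N1) * (if p dvd c then hilbert m p (N * (c * C)) else 1)"
    if "p \<in> prime_factors m" for p
  proof -
    have p: "prime p" "p dvd m" using that by (auto simp: in_prime_factors_iff)
    have pr: "\<not> p dvd r" using coprime_common_divisor[OF r(1) _ p(2)] not_prime_unit p(1) by blast
    note lc = local_char_represented[OF p N12(1) pr r_eq]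
    have CN2: "local_char m p r = hilbert m p (c * N1) * hilbert m p (N * (c * C))" if u: "\<not> p dvd C * N2"
    proof -
      have nz: "C \<noteq> 0" "N1 \<noteq> 0" "N2 \<noteq> 0" "c \<noteq> 0" using u N12 N2 c by auto
      have "hilbert m p (N * (c * C)) = hilbert m p (c * N1) * hilbert m p (C * N2)"
        using hilbert_mult[OF p(1), of "c * N1" "C * N2"] nz by (simp add: N12(1) mult_ac)
      then show ?thesis using lc(2)[OF u] hilbert_unit[OF u] hilbert_abs[OF p, of "c * N1"] nz by auto
    qed
    show ?thesis
    proof (cases "p dvd c")
      case True
      then have "p dvd l" using dvd_l[OF p] by simp
      have "\<not> p dvd C * N2"
      proof
        assume "p dvd C * N2"
        then have "p dvd r" unfolding r_eq using True \<open>p dvd l\<close> by simp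
        then show False using pr by blast
      qed
      then show ?thesis using CN2 True by simp
    next
      case False
      show ?thesis
      proof (cases "p dvd N1")
        case True
        have "p dvd N" using True N12 by simp
        then have "p dvd l" using dvd_l[OF p] by simp
        have u: "\<not> p dvd C * N2"
        proof
          assume "p dvd C * N2"
          then have "p dvd r" unfolding r_eq using True \<open>p dvd l\<close> by simp
          then show False using pr by blast
        qed
        then have "\<not> p dvd c * C" using False p(1) by (auto simp: prime_dvd_mult_iff)
        then show ?thesis using CN2[OF u] hilbert_conic_det_unit[OF p \<open>p dvd N\<close>] False by simp
      next
        case nN1: False
        then have "\<not> p dvd c * N1" using False p(1) by (simp add: prime_dvd_mult_iff)
        then show ?thesis using lc(1) hilbert_unit False by simp
      qed
    qed
  qed
  have pf: "{p \<in> prime_factors m. p dvd c} = {p \<in> prime_factors c. p dvd m}"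
    using nonzero c by (auto simp: in_prime_factors_iff)
  have "kronecker m r = (\<Prod>p\<in>prime_factors m. hilbert m p (c * N1)) * (\<Prod>p\<in>prime_factors m. if p dvd c then hilbert m p (N * (c * C)) else 1)"
    using kronecker_eq_prod_local_char[OF r(1)] local by (simp add: prod.distrib)
  also have "(\<Prod>p\<in>prime_factors m. if p dvd c then hilbert m p (N * (c * C)) else 1) =
      (\<Prod>p\<in>prime_factors c. if p dvd m then hilbert m p (N * (c * C)) else 1)"
    using pf by (simp add: prod.inter_filter [symmetric])
  also have "(\<Prod>p\<in>prime_factors m. hilbert m p (c * N1)) = (\<Prod>p\<in>prime_factors c. if p dvd m then 1 else kron_at m p ^ multiplicity p c)"
  proof -
    have "(\<Prod>p\<in>prime_factors m. hilbert m p (c * N1)) = (\<Prod>p\<in>prime_factors m. hilbert m p c) * (\<Prod>p\<in>prime_factors m. hilbert m p N1)"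
      using c N12 by (simp add: prod.distrib [symmetric] hilbert_mult in_prime_factors_imp_prime cong: prod.cong_simp)
    also have "(\<Prod>p\<in>prime_factors m. hilbert m p N1) = 1"
    proof -
      have "(if int q dvd m then 1 else kronecker_at_prime m q) = 1" if "q \<in># prime_factorization (nat N1)" for q
      proof -
        have "prime q" "q dvd nat N1" using that by (auto simp: in_prime_factors_iff)
        then have "prime (int q)" "int q dvd int (nat N1)" by (simp, simp only: int_dvd_int_iff)
        then have "prime (int q)" "int q dvd N" using N12 by simp_all
        then show ?thesis using kron_at_dvd_level[of "int q"] by simp
      qed
      then show ?thesis unfolding prod_hilbert[OF N12(2)] by (simp cong: image_mset_cong)
    qed
    also have "(\<Prod>p\<in>prime_factors m. hilbert m p c) = (\<Prod>p\<in>prime_factors c. (if p dvd m then 1 else kron_at m p) ^ multiplicity p c)"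
      unfolding prod_hilbert[OF c] using prod_prime_factorization_nat[OF c, of "\<lambda>p. if p dvd m then 1 else kron_at m p"]
      by (simp cong: if_cong)
    finally show ?thesis by (simp add: if_distrib[of "\<lambda>x. x ^ _"] cong: if_cong)
  qed
  finally show ?thesis by (simp add: prod.distrib [symmetric] if_distrib cong: if_cong prod.cong)
qed

lemma gkz_char_eq_prod:
  "gkz_char N m c l C =
    (\<Prod>p\<in>prime_factors c. if p dvd m then (if p dvd C then 0 else hilbert m p (N * (c * C))) else kron_at m p ^ multiplicity p c)"
proof (cases "Gcd {c, l, C, m} = 1")
  case True
  define r where "r = (SOME r. coprime r m \<and> gkz_represents N c l C r)"
  have "coprime r m \<and> gkz_represents N c l C r"
    unfolding r_def by (rule someI_ex) (rule represents_coprime_exists[OF True])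
  then have "gkz_char N m c l C = (\<Prod>p\<in>prime_factors c. if p dvd m then hilbert m p (N * (c * C)) else kron_at m p ^ multiplicity p c)"
    using kronecker_represented[OF True] True by (simp add: gkz_char_def r_def)
  also have "\<dots> = (\<Prod>p\<in>prime_factors c. if p dvd m then (if p dvd C then 0 else hilbert m p (N * (c * C))) else kron_at m p ^ multiplicity p c)"
    using True Gcd_eq_1_iff by (intro prod.cong refl) (auto simp: in_prime_factors_iff)
  finally show ?thesis .
next
  case False
  then obtain p where "prime p" "p dvd m" "p dvd c" "p dvd C" using Gcd_eq_1_iff by blast
  then have "(\<Prod>p\<in>prime_factors c. if p dvd m then (if p dvd C then 0 else hilbert m p (N * (c * C))) else kron_at m p ^ multiplicity p c) = 0"
    using c by (intro prod_zero bexI[of _ p]) (auto simp: in_prime_factors_iff)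
  then show ?thesis using False by (simp add: gkz_char_def)
qed

end

subsection \<open>Kloosterman sums and the Fourier expansion\<close>

lemma sl2_completion_props:
  assumes "coprime d c"
  shows "[sl2_completion c d $ 1 $ 1 * d = 1] (mod c)"
    and "sl2_completion c d $ 2 $ 1 = c" and "sl2_completion c d $ 2 $ 2 = d"
proof -
  obtain x y where xy: "d * x + c * y = 1" using assms by (metis bezout_int coprime_iff_gcd_eq_1 mult.commute)
  define \<gamma> :: "int^2^2" where "\<gamma> = vector [vector [x, - y], vector [c, d]]"
  have "det \<gamma> = 1 \<and> \<gamma> $ 2 $ 1 = c \<and> \<gamma> $ 2 $ 2 = d"
    using xy by (simp add: \<gamma>_def det_2 mult.commute)
  then have *: "det (sl2_completion c d) = 1 \<and> sl2_completion c d $ 2 $ 1 = c \<and> sl2_completion c d $ 2 $ 2 = d"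
    unfolding sl2_completion_def by (rule someI)
  then have "sl2_completion c d $ 1 $ 1 * d - 1 = c * sl2_completion c d $ 1 $ 2"
    by (auto simp: det_2 mult.commute)
  then show "[sl2_completion c d $ 1 $ 1 * d = 1] (mod c)" by (simp add: cong_iff_dvd_diff)
  show "sl2_completion c d $ 2 $ 1 = c" "sl2_completion c d $ 2 $ 2 = d" using * by blast+
qed

text \<open>What is left of the Kloosterman sum at \<open>w = v / u\<close> once
  \<open>2 \<Delta>\<close> is cleared from the exponent. The matrix entry enters only as an inverse
  of \<open>d\<close> modulo \<open>c\<close>.\<close>

definition kloosterman_row :: "int \<Rightarrow> int \<Rightarrow> int \<Rightarrow> int \<Rightarrow> int \<Rightarrow> int \<Rightarrow> int \<Rightarrow> complex" where
  "kloosterman_row c e g h t n w =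
     (\<Sum>d | d \<in> {0..<c} \<and> coprime d c. \<Sum>r\<in>{0..<c}.
        echar c (sl2_completion c d $ 1 $ 1 * (e * w\<^sup>2 + g * w * r + h * r\<^sup>2) + t * r + d * n))"

text \<open>With \<open>A = 1 / d\<close> modulo \<open>c\<close>, putting \<open>r = d y\<close>
  turns \<open>A Q(w, d y)\<close> into \<open>d Q(A w, y)\<close> for the leading form
  \<open>Q\<close>. Thus \<open>w\<close> becomes the coordinate \<open>x = A w\<close>, and a
  common factor \<open>d\<close> comes out, as Ramanujan sums demand.\<close>

lemma kloosterman_row_eq:
  assumes "c > 0"
  shows "kloosterman_row c e g h t n w =
     (\<Sum>d | d \<in> {0..<c} \<and> coprime d c. \<Sum>y\<in>{0..<c}.
        echar c (d * conic_poly e g h 0 t n (sl2_completion c d $ 1 $ 1 * w) y))"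
  unfolding kloosterman_row_def
proof (rule sum.cong[OF refl])
  fix d assume "d \<in> {d. d \<in> {0..<c} \<and> coprime d c}"
  then have d: "coprime d c" by simp
  define A where "A = sl2_completion c d $ 1 $ 1"
  have A: "[A * d = 1] (mod c)" unfolding A_def by (rule sl2_completion_props(1)[OF d])
  let ?f = "\<lambda>r. echar c (A * (e * w\<^sup>2 + g * w * r + h * r\<^sup>2) + t * r + d * n)"
  have "periodic_mod c ?f"
    using assms by (intro periodic_modI echar_cong cong_add cong_mult cong_pow) auto
  then have "(\<Sum>r=0..<c. ?f r) = (\<Sum>r=0..<c. ?f (d * r))"
    by (rule sum_residues_mult[OF assms _ d, symmetric])
  also have "\<dots> = (\<Sum>y=0..<c. echar c (d * conic_poly e g h 0 t n (A * w) y))"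
  proof (rule sum.cong[OF refl], rule echar_cong)
    fix y
    have "A * (e * w\<^sup>2 + g * w * (d * y) + h * (d * y)\<^sup>2) + t * (d * y) + d * n - d * conic_poly e g h 0 t n (A * w) y
      = (A * d - 1) * (h * d * y\<^sup>2 - e * A * w\<^sup>2)"
      by (simp add: conic_poly_def power2_eq_square algebra_simps)
    then show "[A * (e * w\<^sup>2 + g * w * (d * y) + h * (d * y)\<^sup>2) + t * (d * y) + d * n = d * conic_poly e g h 0 t n (A * w) y] (mod c)"
      using A by (simp add: cong_iff_dvd_diff)
  qed (use assms in auto)
  finally show "(\<Sum>r=0..<c. echar c (sl2_completion c d $ 1 $ 1 * (e * w\<^sup>2 + g * w * r + h * r\<^sup>2) + t * r + d * n)) =
    (\<Sum>y=0..<c. echar c (d * conic_poly e g h 0 t n (sl2_completion c d $ 1 $ 1 * w) y))"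
    by (simp add: A_def)
qed

lemma i_powr_sigma:
  "exp (- (of_real pi * \<i> * of_real k / 2)) * cnj (i_powr ((b_minus \<Delta> - b_plus \<Delta>) / 2)) = i_powr (- sigma_weight \<Delta> k)"
  by (simp add: i_powr_def sigma_weight_def exp_cnj exp_add [symmetric] diff_divide_distrib add_divide_distrib algebra_simps)

lemma kloosterman_eq_row:
  fixes a b e h n0 w c \<Delta> :: int
  assumes h: "h \<noteq> 0" and \<Delta>: "\<Delta> = - 2 * h" and c: "c > 0"
    and m: "m = a\<^sup>2 - 4 * h * e" and n: "n = b\<^sup>2 - 4 * h * n0"
  shows "kloosterman \<Delta> k (of_int (a * w) / of_int \<Delta>) (of_int b / of_int \<Delta>) (m * w\<^sup>2) n c =
    i_powr (- sigma_weight \<Delta> k) / of_real (sqrt (of_int c) * sqrt (of_int \<bar>\<Delta>\<bar>)) *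
    (e_mod (\<Delta> * c) (of_int (a * b * w)) * kloosterman_row c e (- a) h b n0 w)"
proof -
  have \<Delta>0: "\<Delta> \<noteq> 0" using h \<Delta> by simp
  then have dR: "real_of_int \<Delta> \<noteq> 0" by simp
  have bpm: "(b_plus \<Delta> + b_minus \<Delta>) / 2 = 1 / 2" using \<Delta>0 by (auto simp: b_plus_def b_minus_def)
  have sq: "real_of_int c powr ((b_plus \<Delta> + b_minus \<Delta>) / 2) = sqrt (real_of_int c)"
    unfolding bpm using c by (simp add: powr_half_sqrt)
  let ?\<alpha> = "real_of_int (a * w) / of_int \<Delta>" and ?\<beta> = "real_of_int b / of_int \<Delta>"
  have summand: "cnj (e_mod c (of_int A * lat_q \<Delta> (?\<alpha> + of_int r)
        - lat_bil \<Delta> ?\<beta> (?\<alpha> + of_int r) + of_int d * lat_q \<Delta> ?\<beta>))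
      * e_mod (2 * \<Delta> * c) (of_int (m * w\<^sup>2 * A + n * d)) =
      e_mod (\<Delta> * c) (of_int (a * b * w)) * echar c (A * (e * w\<^sup>2 + (- a) * w * r + h * r\<^sup>2) + b * r + d * n0)" for A r d
  proof -
    define y where "y = real_of_int (a * w) / of_int \<Delta> + of_int r"
    have y: "of_int \<Delta> * y = of_int (a * w + \<Delta> * r)" using dR by (simp add: y_def field_simps)
    define x where "x = of_int A * lat_q \<Delta> y - lat_bil \<Delta> ?\<beta> y + of_int d * lat_q \<Delta> ?\<beta>"
    have q1: "of_int (2 * \<Delta>) * lat_q \<Delta> y = (of_int (a * w + \<Delta> * r))\<^sup>2"
      unfolding y [symmetric] lat_q_def lat_bil_def by (simp add: power2_eq_square)
    have q2: "of_int (2 * \<Delta>) * lat_bil \<Delta> ?\<beta> y = 2 * of_int b * of_int (a * w + \<Delta> * r)"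
      unfolding y [symmetric] lat_bil_def using dR by simp
    have q3: "of_int (2 * \<Delta>) * lat_q \<Delta> ?\<beta> = (of_int b)\<^sup>2"
      unfolding lat_q_def lat_bil_def using dR by (simp add: power2_eq_square)
    have "of_int (2 * \<Delta>) * x = of_int A * (of_int (2 * \<Delta>) * lat_q \<Delta> y)
        - of_int (2 * \<Delta>) * lat_bil \<Delta> ?\<beta> y + of_int d * (of_int (2 * \<Delta>) * lat_q \<Delta> ?\<beta>)"
      by (simp add: x_def algebra_simps)
    also have "\<dots> = of_int (A * (a * w + \<Delta> * r)\<^sup>2 - 2 * b * (a * w + \<Delta> * r) + d * b\<^sup>2)"
      unfolding q1 q2 q3 by simp
    finally have X: "of_int (2 * \<Delta>) * x = of_int (A * (a * w + \<Delta> * r)\<^sup>2 - 2 * b * (a * w + \<Delta> * r) + d * b\<^sup>2)" .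
    let ?I = "A * (e * w\<^sup>2 + (- a) * w * r + h * r\<^sup>2) + b * r + d * n0"
    have "cnj (e_mod c x) * e_mod (2 * \<Delta> * c) (of_int (m * w\<^sup>2 * A + n * d)) =
        e_mod (2 * \<Delta> * c) (of_int (m * w\<^sup>2 * A + n * d) - of_int (2 * \<Delta>) * x)"
    proof -
      have "cnj (e_mod c x) = e_mod (2 * \<Delta> * c) (of_int (2 * \<Delta>) * (- x))"
        using e_mod_mult_cancel[of "2 * \<Delta>" c "- x"] \<Delta>0 by (simp add: e_mod_minus)
      then show ?thesis by (simp add: e_mod_add [symmetric])
    qed
    \<comment> \<open>Here the binary form arises: the squares of \<open>a w\<close> and
      \<open>b\<close> cancel against \<open>m w^2\<close> and \<open>n\<close> by the choice of
      \<open>e\<close> and \<open>n0\<close>. Apart from the cross term \<open>2 a b w\<close>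
      everything is a multiple of \<open>2 \<Delta>\<close>.\<close>
    also have "of_int (m * w\<^sup>2 * A + n * d) - of_int (2 * \<Delta>) * x = of_int (2 * (a * b * w) + 2 * \<Delta> * ?I)"
    proof -
      have "m * w\<^sup>2 * A + n * d - (A * (a * w + \<Delta> * r)\<^sup>2 - 2 * b * (a * w + \<Delta> * r) + d * b\<^sup>2) = 2 * (a * b * w) + 2 * \<Delta> * ?I"
        by (simp add: m n \<Delta> power2_eq_square algebra_simps)
      then show ?thesis unfolding X by (metis of_int_diff)
    qed
    also have "e_mod (2 * \<Delta> * c) (of_int (2 * (a * b * w) + 2 * \<Delta> * ?I)) = e_mod (\<Delta> * c) (of_int (a * b * w)) * echar c ?I"
    proof -
      have "e_mod (2 * \<Delta> * c) (of_int (2 * (a * b * w))) = e_mod (\<Delta> * c) (of_int (a * b * w))"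
        using e_mod_mult_cancel[of 2 "\<Delta> * c" "of_int (a * b * w)"] by (simp add: mult.assoc)
      moreover have "e_mod (2 * \<Delta> * c) (of_int (2 * \<Delta> * ?I)) = echar c ?I"
        using e_mod_mult_cancel[of "2 * \<Delta>" c "of_int ?I"] \<Delta>0 by (simp only: echar_def of_int_mult)
      ultimately show ?thesis unfolding of_int_add e_mod_add by simp
    qed
    finally show ?thesis unfolding x_def y_def .
  qed
  define W where "W = i_powr ((b_minus \<Delta> - b_plus \<Delta>) / 2) / of_real (sqrt (of_int c) * sqrt (of_int \<bar>\<Delta>\<bar>))"
  define R where "R d = (\<Sum>r=0..<c. echar c (sl2_completion c d $ 1 $ 1 * (e * w\<^sup>2 + (- a) * w * r + h * r\<^sup>2) + b * r + d * n0))" for d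
  have row: "cnj (weil_coeff \<Delta> ?\<alpha> ?\<beta> (sl2_completion c d)) *
      e_mod (2 * \<Delta> * c) (of_int (m * w\<^sup>2 * sl2_completion c d $ 1 $ 1 + n * d)) =
      cnj W * (e_mod (\<Delta> * c) (of_int (a * b * w)) * R d)" if "coprime d c" for d
  proof -
    define S where "S = (\<Sum>r=0..<c. e_mod c (of_int (sl2_completion c d $ 1 $ 1) * lat_q \<Delta> (?\<alpha> + of_int r)
          - lat_bil \<Delta> ?\<beta> (?\<alpha> + of_int r) + of_int d * lat_q \<Delta> ?\<beta>))"
    have "weil_coeff \<Delta> ?\<alpha> ?\<beta> (sl2_completion c d) = W * S"
      unfolding weil_coeff_def Let_def sl2_completion_props(2,3)[OF that] sq W_def S_def ..
    moreover have "cnj S * e_mod (2 * \<Delta> * c) (of_int (m * w\<^sup>2 * sl2_completion c d $ 1 $ 1 + n * d)) =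
        e_mod (\<Delta> * c) (of_int (a * b * w)) * R d"
      unfolding S_def cnj_sum sum_distrib_right summand R_def sum_distrib_left ..
    ultimately show ?thesis by (simp only: complex_cnj_mult mult.assoc[of "cnj W"])
  qed
  have "kloosterman \<Delta> k ?\<alpha> ?\<beta> (m * w\<^sup>2) n c =
      exp (- (of_real pi * \<i> * of_real k / 2)) *
      (\<Sum>d | d \<in> {0..<c} \<and> coprime d c. cnj W * (e_mod (\<Delta> * c) (of_int (a * b * w)) * R d))"
    unfolding kloosterman_def Let_def by (intro arg_cong2[where f = times] refl sum.cong row) simp
  also have "\<dots> = (exp (- (of_real pi * \<i> * of_real k / 2)) * cnj W) *
      (e_mod (\<Delta> * c) (of_int (a * b * w)) * kloosterman_row c e (- a) h b n0 w)"
    by (simp only: kloosterman_row_def R_def sum_distrib_left mult.assoc)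
  also have "exp (- (of_real pi * \<i> * of_real k / 2)) * cnj W =
      i_powr (- sigma_weight \<Delta> k) / of_real (sqrt (of_int c) * sqrt (of_int \<bar>\<Delta>\<bar>))"
    by (simp add: W_def i_powr_sigma [symmetric])
  finally show ?thesis .
qed

lemma sum_solve_linear:
  fixes f :: "int \<Rightarrow> complex"
  assumes "c > 0" "periodic_mod c f" "[A * d = 1] (mod c)"
  shows "(\<Sum>x=0..<c. if c dvd w - d * x then f x else 0) = f (A * w)"
proof -
  have "c dvd w - d * x \<longleftrightarrow> [x = A * w] (mod c)" for x
  proof
    assume "c dvd w - d * x"
    then have "[w = d * x] (mod c)" by (simp add: cong_iff_dvd_diff)
    then have "[A * w = A * (d * x)] (mod c)" by (rule cong_mult[OF cong_refl])
    moreover have "[A * d * x = 1 * x] (mod c)" using assms(3) by (rule cong_mult) simp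
    ultimately show "[x = A * w] (mod c)" by (metis cong_sym cong_trans mult.assoc mult_1)
  next
    assume "[x = A * w] (mod c)"
    then have "[d * x = d * (A * w)] (mod c)" by (rule cong_mult[OF cong_refl])
    moreover have "[A * d * w = 1 * w] (mod c)" using assms(3) by (rule cong_mult) simp
    ultimately have "[d * x = w] (mod c)" by (metis cong_trans mult.assoc mult.commute mult_1)
    then show "c dvd w - d * x" by (metis cong_iff_dvd_diff cong_sym)
  qed
  then have "(\<Sum>x=0..<c. if c dvd w - d * x then f x else 0) = (\<Sum>x=0..<c. if x = (A * w) mod c then f x else 0)"
    using assms(1) by (intro sum.cong refl) (auto simp: cong_def)
  also have "\<dots> = f (A * w)"
    using assms(1) periodic_modD[OF assms(2), of "(A * w) mod c" "A * w"] by simp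
  finally show ?thesis .
qed

text \<open>The linear coefficient \<open>- l\<close> is the dual variable of \<open>x\<close>.
  Summing over \<open>l\<close> imposes \<open>v = u d x\<close> modulo \<open>c\<close>, so
  \<open>u\<close> divides \<open>v\<close> and \<open>x\<close> is the single point
  \<open>(v / u) / d\<close> modulo \<open>c'\<close>.\<close>

lemma conic_sum_fourier:
  assumes c': "c' > 0" and u: "u > 0" and c: "c = u * c'"
  shows "(\<Sum>l=0..<c. conic_sum c' e g h (- l) t n * echar c (l * v)) =
    (if u dvd v then of_int c * kloosterman_row c' e g h t n (v div u) else 0)"
proof -
  have c0: "c > 0" using assms by simp
  let ?U = "{d. d \<in> {0..<c'} \<and> coprime d c'}"
  let ?F = "conic_poly e g h 0 t n"
  have ph: "echar c' (d * conic_poly e g h (- l) t n x y) * echar c (l * v) = echar c' (d * ?F x y) * echar c (l * (v - u * (d * x)))" for d l x y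
  proof -
    have "echar c' (d * conic_poly e g h (- l) t n x y) = echar c' (d * ?F x y) * echar c' (- (l * (d * x)))"
      by (simp add: conic_poly_def echar_add [symmetric] algebra_simps)
    also have "echar c' (- (l * (d * x))) = echar c (u * (- (l * (d * x))))"
      using echar_mult_cancel[of u c' "- (l * (d * x))"] u c by simp
    finally show ?thesis by (simp add: mult.assoc echar_add [symmetric] algebra_simps)
  qed
  have "(\<Sum>l=0..<c. conic_sum c' e g h (- l) t n * echar c (l * v)) =
     (\<Sum>l=0..<c. \<Sum>x=0..<c'. \<Sum>y=0..<c'. \<Sum>d\<in>?U. echar c' (d * ?F x y) * echar c (l * (v - u * (d * x))))"
    unfolding conic_sum_def ramanujan_sum_def sum_distrib_right ph ..
  also have "\<dots> = (\<Sum>d\<in>?U. \<Sum>x=0..<c'. \<Sum>y=0..<c'. \<Sum>l=0..<c. echar c' (d * ?F x y) * echar c (l * (v - u * (d * x))))"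
  proof -
    have "(\<Sum>l\<in>L. \<Sum>x\<in>S. \<Sum>y\<in>S. \<Sum>d\<in>U. f l x y d) = (\<Sum>d\<in>U. \<Sum>x\<in>S. \<Sum>y\<in>S. \<Sum>l\<in>L. f l x y d)" for L S U :: "int set" and f :: "int \<Rightarrow> int \<Rightarrow> int \<Rightarrow> int \<Rightarrow> complex"
    proof -
      have "(\<Sum>l\<in>L. \<Sum>x\<in>S. \<Sum>y\<in>S. \<Sum>d\<in>U. f l x y d) = (\<Sum>l\<in>L. \<Sum>x\<in>S. \<Sum>d\<in>U. \<Sum>y\<in>S. f l x y d)"
        by (intro sum.cong refl sum.swap)
      also have "\<dots> = (\<Sum>l\<in>L. \<Sum>d\<in>U. \<Sum>x\<in>S. \<Sum>y\<in>S. f l x y d)"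
        by (intro sum.cong refl sum.swap)
      also have "\<dots> = (\<Sum>d\<in>U. \<Sum>l\<in>L. \<Sum>x\<in>S. \<Sum>y\<in>S. f l x y d)"
        by (rule sum.swap)
      also have "\<dots> = (\<Sum>d\<in>U. \<Sum>x\<in>S. \<Sum>l\<in>L. \<Sum>y\<in>S. f l x y d)"
        by (intro sum.cong refl sum.swap)
      also have "\<dots> = (\<Sum>d\<in>U. \<Sum>x\<in>S. \<Sum>y\<in>S. \<Sum>l\<in>L. f l x y d)"
        by (intro sum.cong refl sum.swap)
      finally show ?thesis .
    qed
    then show ?thesis .
  qed
  also have "\<dots> = (\<Sum>d\<in>?U. \<Sum>x=0..<c'. if c dvd v - u * (d * x) then of_int c * (\<Sum>y=0..<c'. echar c' (d * ?F x y)) else 0)"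
    unfolding sum_distrib_left [symmetric] sum_echar[OF c0] by (intro sum.cong refl) (simp add: sum_distrib_left mult.commute)
  also have "\<dots> = (if u dvd v then of_int c * kloosterman_row c' e g h t n (v div u) else 0)"
  proof (cases "u dvd v")
    case False
    then have "\<not> c dvd v - u * z" for z unfolding c by (metis dvd_diff_left_iff dvd_mult_left dvd_triv_left)
    then show ?thesis using False by simp
  next
    case True
    define w where "w = v div u"
    have v: "v = u * w" using True by (simp add: w_def)
    have "v - u * z = u * (w - z)" for z by (simp add: v algebra_simps)
    then have dv: "c dvd v - u * z \<longleftrightarrow> c' dvd w - z" for z unfolding c using u by simp
    have "(\<Sum>x=0..<c'. if c' dvd w - d * x then of_int c * (\<Sum>y=0..<c'. echar c' (d * ?F x y)) else 0) =
        of_int c * (\<Sum>y=0..<c'. echar c' (d * ?F (sl2_completion c' d $ 1 $ 1 * w) y))" if "d \<in> ?U" for d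
    proof (rule sum_solve_linear[OF c'])
      show "periodic_mod c' (\<lambda>x. of_int c * (\<Sum>y=0..<c'. echar c' (d * ?F x y)))"
        using c' by (intro periodic_modI arg_cong2[where f = times] refl sum.cong echar_cong cong_mult conic_cong) auto
    qed (use that in \<open>simp add: sl2_completion_props\<close>)
    then show ?thesis using True by (simp add: dv kloosterman_row_eq[OF c'] sum_distrib_left w_def)
  qed
  finally show ?thesis .
qed

lemma twisted_conic_sum_fourier:
  assumes c: "c > 0"
  shows "(\<Sum>l=0..<c. twisted_conic_sum m c e g h (- l) t n * echar c (l * v)) =
    (\<Sum>u | u > 0 \<and> u dvd gcd v c. of_int (kronecker m u) / of_int (c div u) * kloosterman_row (c div u) e g h t n (v div u))"
proof -
  let ?D = "{u. u > 0 \<and> u dvd c}"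
  have "(\<Sum>l=0..<c. twisted_conic_sum m c e g h (- l) t n * echar c (l * v)) =
      (\<Sum>l=0..<c. \<Sum>u\<in>?D. of_int (kronecker m u) / of_int (c * (c div u)) * (conic_sum (c div u) e g h (- l) t n * echar c (l * v)))"
    unfolding twisted_conic_sum_def sum_distrib_right by (intro sum.cong refl) simp
  also have "\<dots> = (\<Sum>u\<in>?D. of_int (kronecker m u) / of_int (c * (c div u)) * (\<Sum>l=0..<c. conic_sum (c div u) e g h (- l) t n * echar c (l * v)))"
    by (subst sum.swap) (simp add: sum_distrib_left)
  also have "\<dots> = (\<Sum>u\<in>?D. if u dvd v then of_int (kronecker m u) / of_int (c div u) * kloosterman_row (c div u) e g h t n (v div u) else 0)"
  proof (rule sum.cong[OF refl])
    fix u assume u: "u \<in> ?D"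
    then have "c div u > 0" using c by (auto simp: pos_imp_zdiv_pos_iff dest: zdvd_imp_le)
    from conic_sum_fourier[OF this, of u c e g h t n v] u c
    show "of_int (kronecker m u) / of_int (c * (c div u)) * (\<Sum>l=0..<c. conic_sum (c div u) e g h (- l) t n * echar c (l * v)) =
      (if u dvd v then of_int (kronecker m u) / of_int (c div u) * kloosterman_row (c div u) e g h t n (v div u) else 0)"
      by simp
  qed
  also have "\<dots> = (\<Sum>u | u \<in> ?D \<and> u dvd v. of_int (kronecker m u) / of_int (c div u) * kloosterman_row (c div u) e g h t n (v div u))"
    by (subst sum.inter_filter [symmetric]) (use finite_pos_divisors[OF c] in auto)
  also have "{u. u \<in> ?D \<and> u dvd v} = {u. u > 0 \<and> u dvd gcd v c}" by auto
  finally show ?thesis .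
qed

section \<open>Comparison of Fourier coefficients and the final identity\<close>

lemma twisted_conic_sum_cong:
  assumes "c > 0" "[s = s'] (mod c)"
  shows "twisted_conic_sum m c e g h s t n = twisted_conic_sum m c e g h s' t n"
  unfolding twisted_conic_sum_def
proof (intro sum.cong refl arg_cong2[where f = divide] arg_cong2[where f = times])
  fix u assume u: "u \<in> {u. u > 0 \<and> u dvd c}"
  then have "c div u > 0" using assms(1) by (auto simp: pos_imp_zdiv_pos_iff dest: zdvd_imp_le)
  moreover have "[s = s'] (mod (c div u))"
  proof -
    have "c div u dvd c" using u by (metis dvd_div_mult_self dvd_triv_left mem_Collect_eq)
    then show ?thesis using assms(2) cong_dvd_modulus by blast
  qed
  ultimately show "conic_sum (c div u) e g h s t n = conic_sum (c div u) e g h s' t n"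
    unfolding conic_sum_def conic_poly_def
    by (intro sum.cong refl ramanujan_sum_cong cong_add cong_mult) auto
qed

context gkz_setting
begin

text \<open>Since \<open>P\<close> is \<open>c * C\<close> up to sign, the full power of
  \<open>p\<close> in \<open>c\<close> always divides \<open>P\<close>, and one more factor
  \<open>p\<close> does so exactly when \<open>p\<close> divides \<open>C\<close>. Hence exact
  divisibility in \<open>local_factor\<close> is the gcd condition of the character.\<close>

lemma gkz_char_eq_twisted_conic_sum:
  assumes h: "h\<^sup>2 = N\<^sup>2" and m: "m = g\<^sup>2 - 4 * e * h" and P: "h * conic_det e g h s t n' = - (N * (c * C))"
  shows "twisted_conic_sum m c e g h s t n' = of_int (gkz_char N m c l C)"
proof -
  define P where "P = conic_det e g h s t n'"
  have h0: "h \<noteq> 0" using h N by auto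
  have hN: "h = N \<or> h = - N" using h by (simp add: power2_eq_iff)
  have PC: "P = c * C \<or> P = - (c * C)" using hN
  proof
    assume "h = N"
    then have "N * P = N * (- (c * C))" using P by (simp add: P_def)
    then show ?thesis using N by (metis mult_cancel_left less_irrefl)
  next
    assume "h = - N"
    then have "N * P = N * (c * C)" using P by (simp add: P_def)
    then show ?thesis using N by simp
  qed
  have Ph: "- P * h = N * (c * C)" using P by (simp add: P_def mult.commute)
  have "local_factor P h p (multiplicity p c) =
      (if p dvd m then (if p dvd C then 0 else hilbert m p (N * (c * C))) else kron_at m p ^ multiplicity p c)"
    if "p \<in> prime_factors c" for p
  proof -
    have p: "prime p" using that by (rule in_prime_factors_imp_prime)
    obtain c' where c': "c = p ^ multiplicity p c * c'" "\<not> p dvd c'"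
      using c p multiplicity_decompose'[of c p] not_prime_unit[of p] by blast
    define k where "k = multiplicity p c"
    have p0: "p \<noteq> 0" using p by auto
    have dv: "p ^ j dvd P \<longleftrightarrow> p ^ j dvd c * C" for j using PC by auto
    have cC: "c * C = p ^ k * (c' * C)" using c'(1) by (simp add: k_def mult.assoc)
    have "p ^ k dvd P" unfolding dv cC by simp
    moreover have "p ^ Suc k dvd P \<longleftrightarrow> p dvd c' * C"
    proof -
      have "p ^ Suc k dvd P \<longleftrightarrow> p ^ k * p dvd p ^ k * (c' * C)" using dv[of "Suc k"] unfolding cC power_Suc2 .
      then show ?thesis using p0 by simp
    qed
    then have "p ^ Suc k dvd P \<longleftrightarrow> p dvd C" using c'(2) p by (simp add: prime_dvd_mult_iff)
    ultimately have "p ^ k dvd P" "p ^ Suc k dvd P \<longleftrightarrow> p dvd C" by blast+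
    then show ?thesis unfolding local_factor_def Ph k_def by simp
  qed
  then show ?thesis
    using twisted_conic_sum_eq_prod[OF m h0 c, of s t n'] unfolding gkz_char_eq_prod P_def by (simp cong: prod.cong)
qed

end

lemma (in fund_disc) twisted_conic_sum_eq_0:
  assumes "m = g\<^sup>2 - 4 * e * h" "h \<noteq> 0" "c > 0" "\<not> c dvd conic_det e g h s t n"
  shows "twisted_conic_sum m c e g h s t n = 0"
proof -
  let ?P = "conic_det e g h s t n"
  have "\<exists>p\<in>prime_factors c. \<not> p ^ multiplicity p c dvd ?P"
  proof (rule ccontr)
    assume *: "\<not> ?thesis"
    have P0: "?P \<noteq> 0" using assms(4) by auto
    have "multiplicity p c \<le> multiplicity p ?P" if "prime p" for p
    proof (cases "p \<in> prime_factors c")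
      case True
      then have "p ^ multiplicity p c dvd ?P" using * by blast
      then show ?thesis using P0 that not_prime_unit[of p] by (intro multiplicity_geI) auto
    next
      case False
      then show ?thesis using assms(3) that by (simp add: in_prime_factors_iff not_dvd_imp_multiplicity_0)
    qed
    then have "c dvd ?P" using multiplicity_le_imp_dvd[of c ?P] assms(3) by auto
    then show False using assms(4) by blast
  qed
  then show ?thesis
    unfolding twisted_conic_sum_eq_prod[OF assms(1-3)] by (auto simp: local_factor_def intro!: prod_zero)
qed

lemma sum_arithmetic_progression:
  fixes f :: "int \<Rightarrow> complex"
  assumes \<Delta>: "\<Delta> = M \<or> \<Delta> = - M" and M: "M > 0" and c: "c > 0" and f: "periodic_mod (M * c) f"
  shows "(\<Sum>l | l \<in> {0..<M * c} \<and> [l = l0] (mod M). f l) = (\<Sum>j=0..<c. f (l0 + \<Delta> * j))"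
proof -
  have Mc: "M * c > 0" using M c by simp
  have cancel: "[\<Delta> * x = \<Delta> * y] (mod M * c) \<longleftrightarrow> [x = y] (mod c)" for x y
  proof -
    have "M * c dvd \<Delta> * (x - y) \<longleftrightarrow> c dvd x - y" using \<Delta> M by auto
    then show ?thesis by (simp add: cong_iff_dvd_diff right_diff_distrib)
  qed
  have bij: "bij_betw (\<lambda>j. (l0 + \<Delta> * j) mod (M * c)) {0..<c} {l. l \<in> {0..<M * c} \<and> [l = l0] (mod M)}"
    unfolding bij_betw_def
  proof
    show "inj_on (\<lambda>j. (l0 + \<Delta> * j) mod (M * c)) {0..<c}"
    proof (rule inj_onI)
      fix x y assume xy: "x \<in> {0..<c}" "y \<in> {0..<c}" "(l0 + \<Delta> * x) mod (M * c) = (l0 + \<Delta> * y) mod (M * c)"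
      then have "[l0 + \<Delta> * x = l0 + \<Delta> * y] (mod M * c)" by (simp add: cong_def)
      then have "[x = y] (mod c)" using cancel by (simp add: cong_add_lcancel)
      then show "x = y" using xy(1,2) by (simp add: cong_def)
    qed
    show "(\<lambda>j. (l0 + \<Delta> * j) mod (M * c)) ` {0..<c} = {l. l \<in> {0..<M * c} \<and> [l = l0] (mod M)}"
    proof (intro equalityI subsetI)
      fix l assume "l \<in> (\<lambda>j. (l0 + \<Delta> * j) mod (M * c)) ` {0..<c}"
      then obtain j where l: "l = (l0 + \<Delta> * j) mod (M * c)" by blast
      have "[l = l0 + \<Delta> * j] (mod M * c)" unfolding l by (simp add: cong_def)
      then have "[l = l0 + \<Delta> * j] (mod M)" by (rule cong_modulus_mult)
      moreover have "[l0 + \<Delta> * j = l0] (mod M)" using \<Delta> by (auto simp: cong_iff_dvd_diff)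
      ultimately have "[l = l0] (mod M)" by (rule cong_trans)
      then show "l \<in> {l. l \<in> {0..<M * c} \<and> [l = l0] (mod M)}" using l Mc by simp
    next
      fix l assume l: "l \<in> {l. l \<in> {0..<M * c} \<and> [l = l0] (mod M)}"
      then have "\<Delta> dvd l - l0" using \<Delta> by (auto simp: cong_iff_dvd_diff)
      then obtain j where j: "l = l0 + \<Delta> * j" by (metis dvd_def add.commute diff_add_cancel)
      have "[\<Delta> * (j mod c) = \<Delta> * j] (mod M * c)" unfolding cancel by (simp add: cong_def)
      then have "[l0 + \<Delta> * (j mod c) = l] (mod M * c)" unfolding j by (rule cong_add[OF cong_refl])
      then have "(l0 + \<Delta> * (j mod c)) mod (M * c) = l" using l by (simp add: cong_def)
      then show "l \<in> (\<lambda>j. (l0 + \<Delta> * j) mod (M * c)) ` {0..<c}" using c by (intro image_eqI[of _ _ "j mod c"]) auto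
    qed
  qed
  have "(\<Sum>l | l \<in> {0..<M * c} \<and> [l = l0] (mod M). f l) = (\<Sum>j=0..<c. f ((l0 + \<Delta> * j) mod (M * c)))"
    by (rule sum.reindex_bij_betw[OF bij, symmetric])
  also have "\<dots> = (\<Sum>j=0..<c. f (l0 + \<Delta> * j))"
    by (intro sum.cong refl periodic_modD[OF f]) (simp add: cong_def)
  finally show ?thesis .
qed

theorem theorem2p1:
  fixes N \<Delta> a b m n v c :: int and k \<alpha> \<beta> :: real
  assumes "N > 0"
    and "\<Delta> \<in> {2 * N, - 2 * N}"
    and "2 * k \<in> \<int>"
    and "sigma_weight \<Delta> k \<in> \<int>"
    and "\<alpha> = of_int a / of_int \<Delta>"
    and "\<beta> = of_int b / of_int \<Delta>"
    and "[m = a\<^sup>2] (mod 4 * N)"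
    and "[n = b\<^sup>2] (mod 4 * N)"
    and "fundamental_discriminant m"
    and "c \<ge> 1"
  shows "(\<Sum>u | u > 0 \<and> u dvd gcd v c.
            of_int (kronecker m u) * of_real (sqrt (of_int u / of_int c)) *
            kloosterman \<Delta> k (\<alpha> * of_int v / of_int u) \<beta> (m * v\<^sup>2 div u\<^sup>2) n (c div u))
       = i_powr (- sigma_weight \<Delta> k) / of_real (sqrt (of_int (2 * N))) *
         (\<Sum>l | l \<in> {0..<2 * N * c} \<and> [l = a * b] (mod 2 * N) \<and> [l\<^sup>2 = m * n] (mod 4 * N * c).
            of_int (gkz_char N m c l ((l\<^sup>2 - m * n) div (4 * N * c))) *
            e_mod (\<Delta> * c) (of_int (l * v)))"
proof -
  interpret fund_disc m by standard (rule assms(9))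
  have c: "c > 0" using assms(10) by simp
  have N: "N > 0" by (rule assms(1))
  have \<Delta>: "\<Delta> = 2 * N \<or> \<Delta> = - (2 * N)" using assms(2) by auto
  \<comment> \<open>The sign of \<open>\<Delta>\<close> is absorbed in \<open>h\<close>, so both
    signatures are treated together.\<close>
  define h where "h = - (\<Delta> div 2)"
  have h: "\<Delta> = - 2 * h" "h = N \<or> h = - N" using \<Delta> by (auto simp: h_def)
  have h0: "h \<noteq> 0" and hN: "h\<^sup>2 = N\<^sup>2" using h N by auto
  have "- 4 * h dvd m - a\<^sup>2" "- 4 * h dvd n - b\<^sup>2" using assms(7,8) h(2) by (auto simp: cong_iff_dvd_diff)
  then obtain e n0 where en: "m - a\<^sup>2 = - 4 * h * e" "n - b\<^sup>2 = - 4 * h * n0" by (elim dvdE)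
  then have m: "m = a\<^sup>2 - 4 * h * e" and n: "n = b\<^sup>2 - 4 * h * n0" by simp_all
  have m': "m = (- a)\<^sup>2 - 4 * e * h" using m by simp
  define \<kappa> where "\<kappa> = i_powr (- sigma_weight \<Delta> k) / of_real (sqrt (of_int (2 * N)))"
  define ee where "ee = e_mod (\<Delta> * c) (of_int (a * b * v))"
  define X where "X l = twisted_conic_sum m c e (- a) h (- l) b n0" for l
  have "(\<Sum>u | u > 0 \<and> u dvd gcd v c.
            of_int (kronecker m u) * of_real (sqrt (of_int u / of_int c)) *
            kloosterman \<Delta> k (\<alpha> * of_int v / of_int u) \<beta> (m * v\<^sup>2 div u\<^sup>2) n (c div u)) =
      (\<Sum>u | u > 0 \<and> u dvd gcd v c. \<kappa> * (ee *
         (of_int (kronecker m u) / of_int (c div u) * kloosterman_row (c div u) e (- a) h b n0 (v div u))))"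
  proof (rule sum.cong[OF refl])
    fix u assume "u \<in> {u. u > 0 \<and> u dvd gcd v c}"
    then have u: "u > 0" "u dvd v" "u dvd c" by auto
    define w where "w = v div u"
    define c' where "c' = c div u"
    have v: "v = u * w" and cc: "c = u * c'" using u by (simp_all add: w_def c'_def)
    have c': "c' > 0" using c u cc by (simp add: zero_less_mult_iff)
    have 1: "\<alpha> * of_int v / of_int u = of_int (a * w) / of_int \<Delta>" using u by (simp add: assms(5) v)
    have 2: "m * v\<^sup>2 div u\<^sup>2 = m * w\<^sup>2" using u by (simp add: v power_mult_distrib mult.left_commute)
    have 3: "e_mod (\<Delta> * c') (of_int (a * b * w)) = ee"
      using e_mod_mult_cancel[of u "\<Delta> * c'" "of_int (a * b * w)"] u by (simp add: ee_def v cc mult_ac)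
    have 4: "\<bar>\<Delta>\<bar> = 2 * N" using \<Delta> N by auto
    have "sqrt (real_of_int u / of_int c) = 1 / sqrt (of_int c')"
      using u c' by (simp add: cc real_sqrt_divide real_sqrt_mult)
    then have 5: "sqrt (real_of_int u / of_int c) / (sqrt (of_int c') * sqrt (of_int (2 * N))) = 1 / (of_int c' * sqrt (of_int (2 * N)))"
    proof -
      have "sqrt (real_of_int c') * sqrt (of_int c') = of_int c'" using c' by simp
      then show ?thesis unfolding \<open>sqrt (of_int u / of_int c) = _\<close> by (simp add: mult.assoc [symmetric])
    qed
    have "of_int (kronecker m u) * of_real (sqrt (of_int u / of_int c)) *
            kloosterman \<Delta> k (of_int (a * w) / of_int \<Delta>) (of_int b / of_int \<Delta>) (m * w\<^sup>2) n c' =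
        of_int (kronecker m u) * i_powr (- sigma_weight \<Delta> k) *
          of_real (sqrt (of_int u / of_int c) / (sqrt (of_int c') * sqrt (of_int (2 * N)))) * (ee * kloosterman_row c' e (- a) h b n0 w)"
      unfolding kloosterman_eq_row[OF h0 h(1) c' m n] 3 4 by simp
    also have "\<dots> = \<kappa> * (ee * (of_int (kronecker m u) / of_int c' * kloosterman_row c' e (- a) h b n0 w))"
      unfolding 5 by (simp add: \<kappa>_def mult_ac)
    finally show "of_int (kronecker m u) * of_real (sqrt (of_int u / of_int c)) *
            kloosterman \<Delta> k (\<alpha> * of_int v / of_int u) \<beta> (m * v\<^sup>2 div u\<^sup>2) n (c div u) =
        \<kappa> * (ee * (of_int (kronecker m u) / of_int (c div u) * kloosterman_row (c div u) e (- a) h b n0 (v div u)))"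
      unfolding 1 2 assms(6) w_def [symmetric] c'_def [symmetric] .
  qed
  also have "\<dots> = \<kappa> * (ee * (\<Sum>l=0..<c. X l * echar c (l * v)))"
    unfolding X_def twisted_conic_sum_fourier[OF c] by (simp add: sum_distrib_left)
  \<comment> \<open>The argument of \<open>X\<close> is just \<open>j\<close>; writing it through
    \<open>l = a b + \<Delta> j\<close> makes the summand a function of \<open>l\<close>, and the
    factor \<open>ee\<close> supplies the part \<open>a b\<close> of the frequency.\<close>
  also have "ee * (\<Sum>l=0..<c. X l * echar c (l * v)) =
      (\<Sum>j=0..<c. X ((a * b + \<Delta> * j - a * b) div \<Delta>) * e_mod (\<Delta> * c) (of_int ((a * b + \<Delta> * j) * v)))"
    unfolding sum_distrib_left
  proof (rule sum.cong[OF refl])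
    fix j
    have "echar c (j * v) = e_mod (\<Delta> * c) (of_int (\<Delta> * j * v))"
      using e_mod_mult_cancel[of \<Delta> c "of_int (j * v)"] h h0 by (simp add: echar_def mult.assoc)
    then show "ee * (X j * echar c (j * v)) = X ((a * b + \<Delta> * j - a * b) div \<Delta>) * e_mod (\<Delta> * c) (of_int ((a * b + \<Delta> * j) * v))"
      using h h0 by (simp add: ee_def e_mod_add [symmetric] ring_distribs)
  qed
  also have "\<dots> = (\<Sum>l | l \<in> {0..<2 * N * c} \<and> [l = a * b] (mod 2 * N). X ((l - a * b) div \<Delta>) * e_mod (\<Delta> * c) (of_int (l * v)))"
  proof (rule sum_arithmetic_progression[symmetric])
    show "periodic_mod (2 * N * c) (\<lambda>l. X ((l - a * b) div \<Delta>) * e_mod (\<Delta> * c) (of_int (l * v)))"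
    proof (rule periodic_modI)
      fix l l' assume "[l = l'] (mod 2 * N * c)"
      moreover have "\<Delta> * c dvd 2 * N * c" using \<Delta> by auto
      ultimately have *: "[l = l'] (mod \<Delta> * c)" by (rule cong_dvd_modulus)
      then obtain j where j: "l' = l + \<Delta> * c * j" by (metis cong_iff_lin)
      have \<Delta>0: "\<Delta> \<noteq> 0" using \<Delta> N by auto
      have "l' - a * b = l - a * b + \<Delta> * (c * j)" by (simp add: j)
      then have "(l' - a * b) div \<Delta> = c * j + (l - a * b) div \<Delta>" by (simp only: div_mult_self2[OF \<Delta>0])
      then have "[(l - a * b) div \<Delta> = (l' - a * b) div \<Delta>] (mod c)" by (simp add: cong_iff_dvd_diff)
      then have "X ((l - a * b) div \<Delta>) = X ((l' - a * b) div \<Delta>)"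
        unfolding X_def by (intro twisted_conic_sum_cong[OF c]) (simp add: cong_minus_minus_iff)
      moreover have "echar (\<Delta> * c) (l * v) = echar (\<Delta> * c) (l' * v)"
        using * \<Delta>0 c by (intro echar_cong cong_mult) auto
      ultimately show "X ((l - a * b) div \<Delta>) * e_mod (\<Delta> * c) (of_int (l * v)) = X ((l' - a * b) div \<Delta>) * e_mod (\<Delta> * c) (of_int (l' * v))"
        by (simp only: echar_def)
    qed
  qed (use \<Delta> N c in auto)
  also have "\<dots> = (\<Sum>l | l \<in> {0..<2 * N * c} \<and> [l = a * b] (mod 2 * N) \<and> [l\<^sup>2 = m * n] (mod 4 * N * c).
            of_int (gkz_char N m c l ((l\<^sup>2 - m * n) div (4 * N * c))) * e_mod (\<Delta> * c) (of_int (l * v)))"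
  proof (rule sum.mono_neutral_cong_right)
    let ?S = "{l. l \<in> {0..<2 * N * c} \<and> [l = a * b] (mod 2 * N)}"
    let ?T = "{l. l \<in> {0..<2 * N * c} \<and> [l = a * b] (mod 2 * N) \<and> [l\<^sup>2 = m * n] (mod 4 * N * c)}"
    show "finite ?S" by (rule finite_subset[of _ "{0..<2 * N * c}"]) auto
    show "?T \<subseteq> ?S" by blast
    have X: "X ((l - a * b) div \<Delta>) = (if [l\<^sup>2 = m * n] (mod 4 * N * c)
        then of_int (gkz_char N m c l ((l\<^sup>2 - m * n) div (4 * N * c))) else 0)" if l: "l \<in> ?S" for l
    proof -
      define j where "j = (l - a * b) div \<Delta>"
      have "\<Delta> dvd l - a * b" using l \<Delta> by (auto simp: cong_iff_dvd_diff)
      then have lj: "l = a * b + \<Delta> * j" by (simp add: j_def)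
      let ?P = "conic_det e (- a) h (- j) b n0"
      \<comment> \<open>As \<open>h\<close> is \<open>N\<close> or \<open>- N\<close>, this
        translates \<open>c dvd P\<close> into the congruence modulo \<open>4 N c\<close>; the
        coefficients outside that congruence vanish.\<close>
      have P: "l\<^sup>2 - m * n = - 4 * h * ?P"
        unfolding lj h(1) conic_det_def by (simp add: m n power2_eq_square algebra_simps)
      have Nc: "4 * N * c \<noteq> 0" using N c by simp
      show ?thesis
      proof (cases "[l\<^sup>2 = m * n] (mod 4 * N * c)")
        case True
        define C where "C = (l\<^sup>2 - m * n) div (4 * N * c)"
        have C: "l\<^sup>2 - m * n = 4 * N * c * C" using True by (simp add: C_def cong_iff_dvd_diff)
        have lab: "[l = a * b] (mod 2 * N)" using l by simp
        have "gkz_setting m N a b n l c C"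
          by (rule gkz_setting.intro[OF fund_disc_axioms gkz_setting_axioms.intro[OF N c assms(7) assms(8) lab C]])
        moreover have "h * ?P = - (N * (c * C))"
        proof -
          have "- 4 * (h * ?P) = 4 * (N * (c * C))" using trans[OF P[symmetric] C] by (simp only: mult.assoc)
          then show ?thesis by linarith
        qed
        ultimately have "X j = of_int (gkz_char N m c l C)"
          unfolding X_def by (intro gkz_setting.gkz_char_eq_twisted_conic_sum[OF _ hN m'])
        then show ?thesis using True by (simp add: j_def C_def)
      next
        case False
        have "\<not> c dvd ?P"
        proof
          assume "c dvd ?P"
          then have "4 * N * c dvd - 4 * h * ?P" using h(2) by (auto intro: mult_dvd_mono)
          then show False using False P by (simp add: cong_iff_dvd_diff)
        qed
        then show ?thesis using twisted_conic_sum_eq_0[OF m' h0 c] False by (simp add: X_def j_def)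
      qed
    qed
    show "\<forall>l\<in>?S - ?T. X ((l - a * b) div \<Delta>) * e_mod (\<Delta> * c) (of_int (l * v)) = 0"
      using X by auto
    show "X ((l - a * b) div \<Delta>) * e_mod (\<Delta> * c) (of_int (l * v)) =
        of_int (gkz_char N m c l ((l\<^sup>2 - m * n) div (4 * N * c))) * e_mod (\<Delta> * c) (of_int (l * v))" if "l \<in> ?T" for l
      using X that by auto
  qed
  finally show ?thesis by (simp only: \<kappa>_def)
qed

end
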